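(* Assume that for every $n\in\mathbb{T}$ there exists $B_n<\infty$ such that $w_n(\mathbf{x}_n)\le B_n$ for all $\mathbf{x}_n\in\mathcal{S}_n$. Then for any $n\in\mathbb{T}$ and any $p\ge1$ there exist constants $C_{1,n},C_{2,p}<\infty$ such that, for any initial values $\mathbf{x}_{1:n}^{(0)}=(\mathbf{x}_1^{(0)},\ldots,\mathbf{x}_n^{(0)})\in\mathcal{S}_1\times\cdots\times\mathcal{S}_n$ and any integer $i\ge1$: for $n=1$, $$\mathbb{E}_{\mathbf{x}_1^{(0)}}\left[\left|\widehat{Z}_1^{(i)}-Z_1\right|^p\right]^{1/p}\le\frac{B_1C_{1,1}C_{2,p}}{i^{1/2}},$$ and for $n\in\mathbb{T}\setminus\{1\}$, $$\mathbb{E}_{\mathbf{x}_{1:n}^{(0)}}\left[\left|\widehat{\left(\frac{Z_n}{Z_{n-1}}\right)}^{(i)}-\frac{Z_n}{Z_{n-1}}\right|^p\right]^{1/p}\le\frac{B_nC_{1,n}C_{2,p}}{i^{1/2}}.$$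
   Context: Targets. $P\ge 1$ is an integer and $\mathbb{T}=\{1,\ldots,P\}$. $(E,\mathcal{F})$ is a measurable space; $E_1=E$, $\mathcal{F}_1=\mathcal{F}$, $E_n=E_{n-1}\times E$, $\mathcal{F}_n=\mathcal{F}_{n-1}\times\mathcal{F}$; write $\mathbf{x}_n=(x_1,\ldots,x_n)\in E_n$. Each $\pi_n$ is a probability measure on $(E_n,\mathcal{F}_n)$ with density $\pi_n(\mathbf{x}_n)=\gamma_n(\mathbf{x}_n)/Z_n$ with respect to a $\sigma$-finite measure $d\mathbf{x}_n$, where $d\mathbf{x}_n=d\mathbf{x}_{n-1}\times dx_n$, $\gamma_n:E_n\to\mathbb{R}^+$ and $Z_n\in(0,\infty)$ is the normalizing constant. Let $\mathcal{S}_n=\{\mathbf{x}_n\in E_n:\pi_n(\mathbf{x}_n)>0\}$. Proposals and weights. $q_1$ is a probability density on $E$ with respect to $dx_1$; for $n\ge 2$, $q_n(\mathbf{x}_{n-1},x_n)$ is a probability density in $x_n$ with respect to $dx_n$ for each $\mathbf{x}_{n-1}\in E_{n-1}$. The weights are $w_1(\mathbf{x}_1)=\gamma_1(\mathbf{x}_1)/q_1(\mathbf{x}_1)$ and, for $n\ge2$, $w_n(\mathbf{x}_n)=\dfrac{\gamma_n(\mathbf{x}_n)}{\gamma_{n-1}(\mathbf{x}_{n-1})q_n(\mathbf{x}_{n-1},x_n)}$ (a ratio $a/0$ with $a>0$ is $+\infty$). For a measure $\mu$ on $E_{n-1}$, $(\mu\times q_n)(d\mathbf{x}_n)=\mu(d\mathbf{x}_{n-1})q_n(\mathbf{x}_{n-1},x_n)dx_n$.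 Algorithm (SIMCMC). Set $\mathbf{X}_n^{(0)}=\mathbf{x}_n^{(0)}\in\mathcal{S}_n$ for $n\in\mathbb{T}$. At each iteration $i\ge1$, process $n=1,2,\ldots,P$ in order: for $n=1$ sample $\mathbf{X}_1^{*(i)}\sim q_1$; for $n\ge2$ sample $\mathbf{X}_n^{*(i)}\sim\widehat{\pi}_{n-1}^{(i)}\times q_n$. With probability $1\wedge\frac{w_n(\mathbf{X}_n^{*(i)})}{w_n(\mathbf{X}_n^{(i-1)})}$ set $\mathbf{X}_n^{(i)}=\mathbf{X}_n^{*(i)}$, otherwise set $\mathbf{X}_n^{(i)}=\mathbf{X}_n^{(i-1)}$. All proposal and acceptance draws are made with fresh independent randomness given the past. Here $\widehat{\pi}_n^{(i)}=\frac{1}{i+1}\sum_{m=0}^{i}\delta_{\mathbf{X}_n^{(m)}}$ is the empirical measure. Normalizing constant estimates, for $i\ge1$: $\widehat{Z}_1^{(i)}=\frac1i\sum_{m=1}^{i}w_1(\mathbf{X}_1^{*(m)})$ and, for $n\ge2$, $\widehat{\left(\frac{Z_n}{Z_{n-1}}\right)}^{(i)}=\frac1i\sum_{m=1}^{i}w_n(\mathbf{X}_n^{*(m)})$. Notation. $\mathbb{E}_{\mathbf{x}_{1:n}^{(0)}}$ is expectation for the algorithm initialized at $\mathbf{x}_{1:n}^{(0)}$. Subscripts on constants indicate what they depend on: $C_{1,n}$ on $n$ and $C_{2,p}$ on $p$ (for the fixed model and proposals). *)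

theory Defs
  imports "HOL-Probability.Probability"
begin

text \<open>
  A point \<open>(x\<^sub>1, \<dots>, x\<^sub>n)\<close> of \<open>E\<^sub>n\<close> is an extensional function on \<open>{1..n}\<close>.
  \<open>L n\<close> is the reference measure \<open>dx\<^sub>n\<close> on the \<open>n\<close>-th coordinate, so that the reference
  measure on \<open>E\<^sub>n\<close> is the product of \<open>L 1, \<dots>, L n\<close>; \<open>q1\<close> is the first proposal density,
  and \<open>q n\<close> is only used for \<open>n \<ge> 2\<close>.
\<close>

locale simcmc_data =
  fixes P :: nat
    and L :: "nat \<Rightarrow> 'a measure"
    and \<gamma> :: "nat \<Rightarrow> (nat \<Rightarrow> 'a) \<Rightarrow> real"
    and q1 :: "'a \<Rightarrow> real"
    and q :: "nat \<Rightarrow> (nat \<Rightarrow> 'a) \<Rightarrow> 'a \<Rightarrow> real"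
begin

definition E :: "nat \<Rightarrow> (nat \<Rightarrow> 'a) measure" where
  "E n = PiM {1..n} L"

definition Z :: "nat \<Rightarrow> real" where
  "Z n = (\<integral>x. \<gamma> n x \<partial>E n)"

definition target_density :: "nat \<Rightarrow> (nat \<Rightarrow> 'a) \<Rightarrow> real" where
  "target_density n x = \<gamma> n x / Z n"

definition S :: "nat \<Rightarrow> (nat \<Rightarrow> 'a) set" where
  "S n = {x \<in> space (E n). 0 < target_density n x}"

text \<open>
  Division on \<open>ennreal\<close> gives \<open>a / 0 = \<infinity>\<close> for \<open>a > 0\<close>, and \<open>0 / 0 = 0\<close>. In particular a
  weight vanishes wherever the target density does.
\<close>

definition weight :: "nat \<Rightarrow> (nat \<Rightarrow> 'a) \<Rightarrow> ennreal" where
  "weight n x =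
    (if n = 1 then ennreal (\<gamma> 1 x) / ennreal (q1 (x 1))
     else let x' = restrict x {1..n - 1}
          in ennreal (\<gamma> n x) / ennreal (\<gamma> (n - 1) x' * q n x' (x n)))"

text \<open>The measure \<open>\<mu> \<times> q\<^sub>n\<close> on \<open>E\<^sub>n\<close>, for \<open>\<mu>\<close> on \<open>E\<^bsub>n-1\<^esub>\<close>.\<close>

definition extend :: "nat \<Rightarrow> (nat \<Rightarrow> 'a) measure \<Rightarrow> (nat \<Rightarrow> 'a) measure" where
  "extend n \<mu> =
    \<mu> \<bind> (\<lambda>x. distr (density (L n) (\<lambda>a. ennreal (q n x a))) (E n) (\<lambda>a. x(n := a)))"

text \<open>
  A history \<open>h\<close> of a run maps \<open>(m, k)\<close> to the pair of the proposal \<open>X*\<close> and the state \<open>X\<close> of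
  level \<open>k\<close> at iteration \<open>m\<close>. There is no proposal at iteration \<open>0\<close>; that component is filled
  with the initial state and is never read. \<open>hist_space i k\<close> carries the histories up to the
  moment when level \<open>k\<close> of iteration \<open>i\<close> has been processed.
\<close>

definition hist_space ::
    "nat \<Rightarrow> nat \<Rightarrow> (nat \<times> nat \<Rightarrow> (nat \<Rightarrow> 'a) \<times> (nat \<Rightarrow> 'a)) measure" where
  "hist_space i k = PiM ({0..<i} \<times> {1..P} \<union> {i} \<times> {1..k}) (\<lambda>(m, j). E j \<Otimes>\<^sub>M E j)"

definition empirical ::
    "nat \<Rightarrow> nat \<Rightarrow> (nat \<times> nat \<Rightarrow> (nat \<Rightarrow> 'a) \<times> (nat \<Rightarrow> 'a)) \<Rightarrow> (nat \<Rightarrow> 'a) measure" where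
  "empirical n i h = distr (uniform_count_measure {0..i}) (E n) (\<lambda>m. snd (h (m, n)))"

definition proposal ::
    "nat \<Rightarrow> nat \<Rightarrow> (nat \<times> nat \<Rightarrow> (nat \<Rightarrow> 'a) \<times> (nat \<Rightarrow> 'a)) \<Rightarrow> (nat \<Rightarrow> 'a) measure" where
  "proposal i n h =
    (if n = 1 then distr (density (L 1) (\<lambda>a. ennreal (q1 a))) (E 1) (\<lambda>a. \<lambda>j\<in>{1}. a)
     else extend n (empirical (n - 1) i h))"

definition accept_prob :: "nat \<Rightarrow> (nat \<Rightarrow> 'a) \<Rightarrow> (nat \<Rightarrow> 'a) \<Rightarrow> real" where
  "accept_prob n x y = enn2real (min 1 (weight n y / weight n x))"

text \<open>The joint law of proposal and new state of level \<open>n\<close> at iteration \<open>i \<ge> 1\<close>, given the past.\<close>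

definition level_step ::
    "nat \<Rightarrow> nat \<Rightarrow> (nat \<times> nat \<Rightarrow> (nat \<Rightarrow> 'a) \<times> (nat \<Rightarrow> 'a))
      \<Rightarrow> ((nat \<Rightarrow> 'a) \<times> (nat \<Rightarrow> 'a)) measure" where
  "level_step i n h =
    (let x = snd (h (i - 1, n)) in
     proposal i n h \<bind> (\<lambda>y.
     measure_pmf (bernoulli_pmf (accept_prob n x y)) \<bind> (\<lambda>b.
     return (E n \<Otimes>\<^sub>M E n) (y, if b then y else x))))"

primrec sweep ::
    "nat \<Rightarrow> nat \<Rightarrow> (nat \<times> nat \<Rightarrow> (nat \<Rightarrow> 'a) \<times> (nat \<Rightarrow> 'a))
      \<Rightarrow> (nat \<times> nat \<Rightarrow> (nat \<Rightarrow> 'a) \<times> (nat \<Rightarrow> 'a)) measure" where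
  "sweep i 0 h = return (hist_space i 0) h"
| "sweep i (Suc k) h =
    sweep i k h \<bind> (\<lambda>h'.
    level_step i (Suc k) h' \<bind> (\<lambda>z.
    return (hist_space i (Suc k)) (h'((i, Suc k) := z))))"

text \<open>The law of the first \<open>i\<close> iterations of all \<open>P\<close> levels, started from \<open>x0 1, \<dots>, x0 P\<close>.\<close>

primrec run ::
    "(nat \<Rightarrow> nat \<Rightarrow> 'a) \<Rightarrow> nat
      \<Rightarrow> (nat \<times> nat \<Rightarrow> (nat \<Rightarrow> 'a) \<times> (nat \<Rightarrow> 'a)) measure" where
  "run x0 0 = return (hist_space 0 P) (\<lambda>(m, k)\<in>{0} \<times> {1..P}. (x0 k, x0 k))"
| "run x0 (Suc i) = run x0 i \<bind> sweep (Suc i) P"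

text \<open>
  The estimate of \<open>Z\<^sub>1\<close> (for \<open>n = 1\<close>) or of \<open>Z\<^sub>n / Z\<^bsub>n-1\<^esub>\<close> (for \<open>n \<ge> 2\<close>). If the weights are bounded
  on \<open>S n\<close> they are finite on all of \<open>E\<^sub>n\<close>, since they vanish off \<open>S n\<close>; \<open>enn2real\<close> then loses
  nothing.
\<close>

definition estimate ::
    "nat \<Rightarrow> nat \<Rightarrow> (nat \<times> nat \<Rightarrow> (nat \<Rightarrow> 'a) \<times> (nat \<Rightarrow> 'a)) \<Rightarrow> real" where
  "estimate n i h = (1 / real i) * (\<Sum>m = 1..i. enn2real (weight n (fst (h (m, n)))))"

end

locale simcmc = simcmc_data P L \<gamma> q1 q
  for P :: nat
    and F :: "'a measure"
    and L :: "nat \<Rightarrow> 'a measure"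
    and \<gamma> :: "nat \<Rightarrow> (nat \<Rightarrow> 'a) \<Rightarrow> real"
    and q1 :: "'a \<Rightarrow> real"
    and q :: "nat \<Rightarrow> (nat \<Rightarrow> 'a) \<Rightarrow> 'a \<Rightarrow> real" +
  assumes P_ge_1: "P \<ge> 1"
    and sets_L: "\<And>n. n \<in> {1..P} \<Longrightarrow> sets (L n) = sets F"
    and sigma_finite_L: "\<And>n. n \<in> {1..P} \<Longrightarrow> sigma_finite_measure (L n)"
    and \<gamma>_nonneg: "\<And>n x. n \<in> {1..P} \<Longrightarrow> x \<in> space (E n) \<Longrightarrow> 0 \<le> \<gamma> n x"
    and \<gamma>_integrable: "\<And>n. n \<in> {1..P} \<Longrightarrow> integrable (E n) (\<gamma> n)"
    and Z_pos: "\<And>n. n \<in> {1..P} \<Longrightarrow> 0 < Z n"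
    and q1_measurable: "q1 \<in> borel_measurable (L 1)"
    and q1_nonneg: "\<And>a. a \<in> space (L 1) \<Longrightarrow> 0 \<le> q1 a"
    and q1_prob: "(\<integral>\<^sup>+a. ennreal (q1 a) \<partial>L 1) = 1"
    and q_measurable: "\<And>n. n \<in> {2..P} \<Longrightarrow>
          (\<lambda>(x, a). q n x a) \<in> borel_measurable (E (n - 1) \<Otimes>\<^sub>M L n)"
    and q_nonneg: "\<And>n x a. n \<in> {2..P} \<Longrightarrow> x \<in> space (E (n - 1)) \<Longrightarrow> a \<in> space (L n) \<Longrightarrow>
          0 \<le> q n x a"
    and q_prob: "\<And>n x. n \<in> {2..P} \<Longrightarrow> x \<in> space (E (n - 1)) \<Longrightarrow>
          (\<integral>\<^sup>+a. ennreal (q n x a) \<partial>L n) = 1"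

end

theory Submission
  imports Defs
begin

text \<open>
  Level \<open>n\<close> of the algorithm is an independence Metropolis-Hastings chain whose proposal law \<open>\<nu>\<close>
  changes with the empirical measure of level \<open>n - 1\<close>. For fixed \<open>\<nu>\<close> its kernel has the explicit
  invariant law proportional to \<open>w\<^sub>n \<nu>\<close>, and \<open>w\<^sub>n \<le> B\<^sub>n\<close> gives a Doeblin minorization, hence a bounded
  solution of the Poisson equation. Using the Poisson equation of the current kernel (not of the
  limiting one) writes the ergodic sum as a bounded-increment martingale, plus increments of the
  solutions, which are \<open>O(1/m)\<close> because one iteration moves the empirical measure by \<open>O(1/m)\<close> in
  total variation, plus deviations of \<open>\<nu>\<close> from its limit on the two fixed functions \<open>w\<^sub>n\<close> and
  \<open>w\<^sub>n f\<close>. No uniformity over the current state is needed, so an induction over the levels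
  closes with deviations of order \<open>m\<^bsup>-1/2\<^esup>\<close> in every \<open>L\<^sup>p\<close>. The solution is only used when
  \<open>\<nu>(w\<^sub>n)\<close> is at least half its limit; otherwise the deviation of \<open>\<nu>(w\<^sub>n)\<close> itself pays.
\<close>

section \<open>Moment bounds\<close>

text \<open>An empirical measure need not approach a diffuse law in total variation, so the kernels
  of level \<open>n\<close> are not expected to converge in operator norm. The Poisson equation of
  the limiting kernel would leave the difference of two kernels applied to its solution at the
  random current state, hence a family of test functions indexed by that state. The equation of the
  current kernel leaves a difference of two invariant means, that is, of quotients whose integrands
  do not depend on the run.

  The induction passes test functions downwards: the deviation of the proposal of level
  \<open>Suc n\<close> on \<open>\<phi>\<close> is an ergodic average at level \<open>n\<close> of
  the image of \<open>\<phi>\<close> under \<open>kern (Suc n)\<close>. Hence the induction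
  hypothesis quantifies over all measurable functions bounded by \<open>1\<close>, with a constant
  that depends only on the level and the exponent.

  Exponents are natural numbers until the end, where a real \<open>p\<close> is replaced by its
  ceiling; Minkowski's inequality and the passage from exponential moments are then
  elementary.\<close>

text \<open>\<open>a\<close> bounds the norm in L^k. Comparing with \<open>a ^ k\<close> avoids
  roots, and the nonnegative integral makes finiteness of the moment part of the bound rather than a
  side condition.\<close>

definition moment_le :: "'a measure \<Rightarrow> nat \<Rightarrow> ('a \<Rightarrow> real) \<Rightarrow> real \<Rightarrow> bool" where
  "moment_le M k X a \<longleftrightarrow>
    X \<in> borel_measurable M \<and> (\<integral>\<^sup>+x. ennreal (\<bar>X x\<bar> ^ k) \<partial>M) \<le> ennreal (a ^ k)"

lemma moment_le_measurable: "moment_le M k X a \<Longrightarrow> X \<in> borel_measurable M"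
  by (simp add: moment_le_def)

lemma moment_le_mono:
  assumes "moment_le M k Y a" "X \<in> borel_measurable M"
    and "\<And>x. x \<in> space M \<Longrightarrow> \<bar>X x\<bar> \<le> \<bar>Y x\<bar>" "0 \<le> a" "a \<le> b"
  shows "moment_le M k X b"
proof -
  have "(\<integral>\<^sup>+x. ennreal (\<bar>X x\<bar> ^ k) \<partial>M) \<le> (\<integral>\<^sup>+x. ennreal (\<bar>Y x\<bar> ^ k) \<partial>M)"
    by (intro nn_integral_mono ennreal_leI power_mono assms) auto
  also have "\<dots> \<le> ennreal (a ^ k)"
    using assms by (simp add: moment_le_def)
  also have "\<dots> \<le> ennreal (b ^ k)"
    by (intro ennreal_leI power_mono assms)
  finally show ?thesis
    using assms by (simp add: moment_le_def)
qed

lemma moment_le_cmult: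
  assumes "moment_le M k X a"
  shows "moment_le M k (\<lambda>x. c * X x) (\<bar>c\<bar> * a)"
proof -
  have [measurable]: "X \<in> borel_measurable M"
    using assms by (simp add: moment_le_def)
  have "(\<integral>\<^sup>+x. ennreal (\<bar>c * X x\<bar> ^ k) \<partial>M) = ennreal (\<bar>c\<bar> ^ k) * (\<integral>\<^sup>+x. ennreal (\<bar>X x\<bar> ^ k) \<partial>M)"
    by (subst nn_integral_cmult[symmetric]) (auto simp: abs_mult power_mult_distrib ennreal_mult)
  also have "\<dots> \<le> ennreal (\<bar>c\<bar> ^ k) * ennreal (a ^ k)"
    using assms by (intro mult_left_mono) (auto simp: moment_le_def)
  also have "\<dots> = ennreal ((\<bar>c\<bar> * a) ^ k)"
    by (simp add: ennreal_mult'[symmetric] power_mult_distrib)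
  finally show ?thesis
    by (simp add: moment_le_def)
qed

lemma (in prob_space) moment_le_bounded:
  assumes "X \<in> borel_measurable M" "\<And>x. x \<in> space M \<Longrightarrow> \<bar>X x\<bar> \<le> a"
  shows "moment_le M k X a"
proof -
  have "(\<integral>\<^sup>+x. ennreal (\<bar>X x\<bar> ^ k) \<partial>M) \<le> (\<integral>\<^sup>+x. ennreal (a ^ k) \<partial>M)"
    by (intro nn_integral_mono ennreal_leI power_mono assms) auto
  also have "\<dots> = ennreal (a ^ k)"
    by (simp add: emeasure_space_1)
  finally show ?thesis
    using assms by (simp add: moment_le_def)
qed

text \<open>Jensen's inequality for \<open>x ^ k\<close> at the points \<open>U i / a i\<close> with
  weights \<open>a i / sum a I\<close>. The coefficients are such that replacing each
  \<open>U i ^ k\<close> by \<open>a i ^ k\<close> turns the right side into exactly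
  \<open>sum a I ^ k\<close>.\<close>

lemma sum_power_le_weighted:
  fixes U a :: "'i \<Rightarrow> real"
  assumes "finite I" "I \<noteq> {}" "\<And>i. i \<in> I \<Longrightarrow> 0 < a i" "\<And>i. i \<in> I \<Longrightarrow> 0 \<le> U i"
  shows "(\<Sum>i\<in>I. U i) ^ k \<le> (\<Sum>i\<in>I. (sum a I ^ k / sum a I * a i / a i ^ k) * U i ^ k)"
proof -
  let ?A = "sum a I"
  have A: "0 < ?A"
    using assms by (intro sum_pos) auto
  have conv: "convex_on {0..} (\<lambda>x::real. x ^ k)"
    by (rule convex_on_realI[where f' = "\<lambda>x. real k * x ^ (k - 1)"])
       (auto intro!: derivative_eq_intros mult_left_mono power_mono)
  have "(\<Sum>i\<in>I. (a i / ?A) *\<^sub>R (U i / a i)) ^ k \<le> (\<Sum>i\<in>I. (a i / ?A) * (U i / a i) ^ k)"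
    using assms A
    by (intro convex_on_sum[OF _ _ conv]) (auto simp: sum_divide_distrib[symmetric] less_imp_le)
  also have "(\<Sum>i\<in>I. (a i / ?A) *\<^sub>R (U i / a i)) = (\<Sum>i\<in>I. U i) / ?A"
    using assms(3) by (auto simp: sum_divide_distrib intro!: sum.cong) (metis less_irrefl)
  finally have "(\<Sum>i\<in>I. U i) ^ k / ?A ^ k \<le> (\<Sum>i\<in>I. (a i / ?A) * (U i / a i) ^ k)"
    by (simp add: power_divide)
  then have "(\<Sum>i\<in>I. U i) ^ k \<le> ?A ^ k * (\<Sum>i\<in>I. (a i / ?A) * (U i / a i) ^ k)"
    using A by (simp add: field_simps)
  also have "\<dots> = (\<Sum>i\<in>I. (?A ^ k / ?A * a i / a i ^ k) * U i ^ k)"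
    by (simp add: sum_distrib_left power_divide mult_ac)
  finally show ?thesis .
qed

text \<open>Minkowski's inequality. It loses no factor in the number of summands, which is what lets
  bounds of order \<open>1 / sqrt m\<close> add up to order \<open>sqrt i\<close>.\<close>

lemma moment_le_sum:
  assumes "finite I" "I \<noteq> {}" "\<And>i. i \<in> I \<Longrightarrow> moment_le M k (X i) (a i)" "\<And>i. i \<in> I \<Longrightarrow> 0 < a i"
  shows "moment_le M k (\<lambda>x. \<Sum>i\<in>I. X i x) (\<Sum>i\<in>I. a i)"
proof -
  let ?A = "sum a I"
  have A: "0 < ?A"
    using assms by (intro sum_pos) auto
  have [measurable]: "X i \<in> borel_measurable M" if "i \<in> I" for i
    using assms that by (simp add: moment_le_def)
  define b where "b i = ?A ^ k / ?A * a i / a i ^ k" for i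
  have b: "0 \<le> b i" if "i \<in> I" for i
    using A assms(4)[OF that] by (auto simp: b_def)
  have "(\<integral>\<^sup>+x. ennreal (\<bar>\<Sum>i\<in>I. X i x\<bar> ^ k) \<partial>M)
      \<le> (\<integral>\<^sup>+x. (\<Sum>i\<in>I. ennreal (b i) * ennreal (\<bar>X i x\<bar> ^ k)) \<partial>M)"
  proof (intro nn_integral_mono)
    fix x
    have "\<bar>\<Sum>i\<in>I. X i x\<bar> ^ k \<le> (\<Sum>i\<in>I. \<bar>X i x\<bar>) ^ k"
      by (intro power_mono sum_abs) auto
    also have "\<dots> \<le> (\<Sum>i\<in>I. b i * \<bar>X i x\<bar> ^ k)"
      unfolding b_def by (intro sum_power_le_weighted assms) auto
    finally have "ennreal (\<bar>\<Sum>i\<in>I. X i x\<bar> ^ k) \<le> ennreal (\<Sum>i\<in>I. b i * \<bar>X i x\<bar> ^ k)"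
      by (rule ennreal_leI)
    also have "\<dots> = (\<Sum>i\<in>I. ennreal (b i) * ennreal (\<bar>X i x\<bar> ^ k))"
      using b by (subst sum_ennreal[symmetric]) (auto simp: ennreal_mult intro!: sum.cong)
    finally show "ennreal (\<bar>\<Sum>i\<in>I. X i x\<bar> ^ k) \<le> (\<Sum>i\<in>I. ennreal (b i) * ennreal (\<bar>X i x\<bar> ^ k))" .
  qed
  also have "\<dots> = (\<Sum>i\<in>I. ennreal (b i) * (\<integral>\<^sup>+x. ennreal (\<bar>X i x\<bar> ^ k) \<partial>M))"
    by (subst nn_integral_sum) (auto intro!: sum.cong nn_integral_cmult)
  also have "\<dots> \<le> (\<Sum>i\<in>I. ennreal (b i) * ennreal (a i ^ k))"
    using assms(3) by (intro sum_mono mult_left_mono) (auto simp: moment_le_def)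
  also have "\<dots> = (\<Sum>i\<in>I. ennreal (?A ^ k / ?A * a i))"
  proof (intro sum.cong refl)
    fix i assume i: "i \<in> I"
    then have "b i * a i ^ k = ?A ^ k / ?A * a i"
      using assms(4)[OF i] by (simp add: b_def)
    then show "ennreal (b i) * ennreal (a i ^ k) = ennreal (?A ^ k / ?A * a i)"
      using b[OF i] assms(4)[OF i] by (simp add: ennreal_mult[symmetric] less_imp_le)
  qed
  also have "\<dots> = ennreal (\<Sum>i\<in>I. ?A ^ k / ?A * a i)"
    using A assms(4) by (intro sum_ennreal) (auto simp: less_imp_le)
  also have "(\<Sum>i\<in>I. ?A ^ k / ?A * a i) = ?A ^ k"
    using A by (subst sum_distrib_left[symmetric]) simp
  finally show ?thesis
    by (auto simp: moment_le_def)
qed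

lemma moment_le_add:
  assumes "moment_le M k X a" "moment_le M k Y b" "0 < a" "0 < b"
  shows "moment_le M k (\<lambda>x. X x + Y x) (a + b)"
  using moment_le_sum[of "UNIV :: bool set" M k "\<lambda>i. if i then X else Y" "\<lambda>i. if i then a else b"] assms
  by (auto simp: UNIV_bool add.commute)

lemma power_le_fact_mult_exp:
  fixes x :: real
  assumes "0 \<le> x"
  shows "x ^ k \<le> fact k * exp x"
proof -
  have "x ^ k /\<^sub>R fact k \<le> (\<Sum>n. x ^ n /\<^sub>R fact n)"
    using sum_le_suminf[of "\<lambda>n. x ^ n /\<^sub>R fact n" "{k}"] summable_exp_generic[of x] assms by auto
  then show ?thesis
    by (simp add: exp_def field_simps)
qed

text \<open>The factor \<open>fact k\<close> comes from \<open>power_le_fact_mult_exp\<close>, the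
  \<open>2\<close> from the two signs in the exponent, and \<open>exp (1 / 2)\<close> from the
  exponential moment of a variable that is sub-Gaussian at unit scale.\<close>

definition subgaussian_const :: "nat \<Rightarrow> real" where
  "subgaussian_const k = 2 * fact k * exp (1 / 2)"

lemma subgaussian_const_ge_1: "1 \<le> subgaussian_const k"
proof -
  have "1 * 1 \<le> fact k * exp (1 / 2 :: real)"
    by (intro mult_mono) (auto simp: fact_ge_1)
  then show ?thesis
    by (simp add: subgaussian_const_def)
qed

text \<open>Exponential moments at one scale \<open>c\<close>, for both signs, control every power:
  \<open>exp \<bar>t\<bar>\<close> is at most \<open>exp t + exp (- t)\<close>.\<close>

lemma moment_le_of_exp:
  assumes [measurable]: "X \<in> borel_measurable M" and "0 < c" "1 \<le> k"
    and "(\<integral>\<^sup>+x. ennreal (exp (X x / c)) \<partial>M) \<le> ennreal (exp (1 / 2))"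
    and "(\<integral>\<^sup>+x. ennreal (exp (- X x / c)) \<partial>M) \<le> ennreal (exp (1 / 2))"
  shows "moment_le M k X (subgaussian_const k * c)"
proof -
  have "(\<integral>\<^sup>+x. ennreal (\<bar>X x\<bar> ^ k) \<partial>M)
    \<le> (\<integral>\<^sup>+x. ennreal (c ^ k * fact k) * (ennreal (exp (X x / c)) + ennreal (exp (- X x / c))) \<partial>M)"
  proof (intro nn_integral_mono)
    fix x
    have "\<bar>X x\<bar> ^ k = c ^ k * \<bar>X x / c\<bar> ^ k"
      using assms by (simp add: power_divide abs_divide)
    also have "\<dots> \<le> c ^ k * (fact k * exp \<bar>X x / c\<bar>)"
      using assms by (intro mult_left_mono power_le_fact_mult_exp) auto
    also have "\<dots> \<le> c ^ k * (fact k * (exp (X x / c) + exp (- X x / c)))"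
      using assms by (intro mult_left_mono) (auto simp: abs_if)
    finally have "ennreal (\<bar>X x\<bar> ^ k) \<le> ennreal (c ^ k * fact k * (exp (X x / c) + exp (- X x / c)))"
      by (intro ennreal_leI) (simp add: mult.assoc)
    then show "ennreal (\<bar>X x\<bar> ^ k)
        \<le> ennreal (c ^ k * fact k) * (ennreal (exp (X x / c)) + ennreal (exp (- X x / c)))"
      using assms by (simp add: ennreal_mult)
  qed
  also have "\<dots> = ennreal (c ^ k * fact k) *
      ((\<integral>\<^sup>+x. ennreal (exp (X x / c)) \<partial>M) + (\<integral>\<^sup>+x. ennreal (exp (- X x / c)) \<partial>M))"
    by (subst nn_integral_cmult) (auto simp: nn_integral_add)
  also have "\<dots> \<le> ennreal (c ^ k * fact k) * (ennreal (exp (1 / 2)) + ennreal (exp (1 / 2)))"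
    by (intro mult_left_mono add_mono assms) auto
  also have "\<dots> = ennreal (c ^ k * subgaussian_const k)"
    using assms by (simp add: ennreal_mult[symmetric] ennreal_plus[symmetric] subgaussian_const_def mult_ac del: ennreal_plus)
  \<comment> \<open>A constant that is at least \<open>1\<close> may be raised to the power
    \<open>k\<close>, which gives the k-th power form that \<open>moment_le\<close> asks
    for.\<close>
  also have "\<dots> \<le> ennreal (c ^ k * subgaussian_const k ^ k)"
    using assms power_increasing[OF \<open>1 \<le> k\<close> subgaussian_const_ge_1[of k]]
    by (intro ennreal_leI mult_left_mono) auto
  finally show ?thesis
    by (simp add: moment_le_def power_mult_distrib mult.commute)
qed

lemma sum_inverse_sqrt_le: "(\<Sum>m=1..n. 1 / sqrt (real m)) \<le> 2 * sqrt (real n)"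
proof (induction n)
  case (Suc n)
  define a b where "a = sqrt (real n)" and "b = sqrt (real (Suc n))"
  have "0 < b" "b ^ 2 = a ^ 2 + 1"
    by (auto simp: a_def b_def)
  \<comment> \<open>\<open>2 * (b - a) * b\<close> equals
    \<open>(b - a) ^ 2 + (b ^ 2 - a ^ 2)\<close>, and the last bracket is \<open>1\<close>.\<close>
  moreover have "0 \<le> (b - a) ^ 2"
    by simp
  ultimately have "1 \<le> 2 * (b - a) * b"
    by (simp add: power2_eq_square algebra_simps)
  then have "1 / b \<le> 2 * (b - a)"
    using \<open>0 < b\<close> by (simp add: field_simps)
  with Suc show ?case
    by (simp add: a_def b_def)
qed simp

text \<open>Passage from the natural exponent \<open>k\<close> to a real \<open>p\<close> below it,
  through \<open>t powr p \<le> 1 + t ^ k\<close> with \<open>t = \<bar>X x\<bar> / a\<close>. The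
  two summands produce the factor \<open>2\<close>, whose power \<open>1 / p\<close> is again at
  most \<open>2\<close>.\<close>

lemma (in prob_space) moment_le_imp_powr_norm:
  assumes X: "moment_le M k X a" and a: "0 < a" and p: "1 \<le> p" "p \<le> real k"
  shows "integrable M (\<lambda>x. \<bar>X x\<bar> powr p)"
    and "(\<integral>x. \<bar>X x\<bar> powr p \<partial>M) powr (1 / p) \<le> 2 * a"
proof -
  have [measurable]: "X \<in> borel_measurable M"
    using X by (simp add: moment_le_def)
  have le: "\<bar>X x\<bar> powr p \<le> a powr p * (1 + (\<bar>X x\<bar> / a) ^ k)" for x
  proof -
    have "(\<bar>X x\<bar> / a) powr p \<le> 1 + (\<bar>X x\<bar> / a) ^ k"
    proof (cases "\<bar>X x\<bar> / a \<le> 1")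
      case True
      then have "(\<bar>X x\<bar> / a) powr p \<le> 1"
        using p a by (intro powr_le1) auto
      with a show ?thesis
        by (smt (verit) divide_nonneg_pos zero_le_power abs_ge_zero)
    next
      case False
      then have "(\<bar>X x\<bar> / a) powr p \<le> (\<bar>X x\<bar> / a) powr real k"
        using p by (intro powr_mono) auto
      also have "\<dots> = (\<bar>X x\<bar> / a) ^ k"
        using False by (intro powr_realpow) auto
      finally show ?thesis by simp
    qed
    moreover have "\<bar>X x\<bar> powr p = a powr p * (\<bar>X x\<bar> / a) powr p"
      using a by (simp add: powr_mult[symmetric])
    ultimately show ?thesis
      by (simp add: mult_left_mono)
  qed
  have "(\<integral>\<^sup>+x. ennreal (\<bar>X x\<bar> powr p) \<partial>M)
    \<le> (\<integral>\<^sup>+x. ennreal (a powr p) * (1 + ennreal (1 / a ^ k) * ennreal (\<bar>X x\<bar> ^ k)) \<partial>M)"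
  proof (intro nn_integral_mono)
    fix x
    have "ennreal (\<bar>X x\<bar> powr p) \<le> ennreal (a powr p * (1 + (\<bar>X x\<bar> / a) ^ k))"
      by (intro ennreal_leI le)
    also have "\<dots> = ennreal (a powr p) * (1 + ennreal (1 / a ^ k * \<bar>X x\<bar> ^ k))"
      using a by (subst ennreal_mult) (auto simp: ennreal_plus power_divide simp flip: ennreal_1)
    also have "ennreal (1 / a ^ k * \<bar>X x\<bar> ^ k) = ennreal (1 / a ^ k) * ennreal (\<bar>X x\<bar> ^ k)"
      using a by (intro ennreal_mult) auto
    finally show "ennreal (\<bar>X x\<bar> powr p)
        \<le> ennreal (a powr p) * (1 + ennreal (1 / a ^ k) * ennreal (\<bar>X x\<bar> ^ k))" .
  qed
  also have "\<dots> = ennreal (a powr p) * (1 + ennreal (1 / a ^ k) * (\<integral>\<^sup>+x. ennreal (\<bar>X x\<bar> ^ k) \<partial>M))"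
    by (simp add: nn_integral_cmult nn_integral_add emeasure_space_1)
  also have "\<dots> \<le> ennreal (a powr p) * (1 + ennreal (1 / a ^ k) * ennreal (a ^ k))"
    using X by (intro mult_left_mono add_mono) (auto simp: moment_le_def)
  also have "\<dots> = ennreal (2 * a powr p)"
    using a by (simp add: ennreal_mult[symmetric] ennreal_mult'' mult.commute)
  finally have nn: "(\<integral>\<^sup>+x. ennreal (\<bar>X x\<bar> powr p) \<partial>M) \<le> ennreal (2 * a powr p)" .
  then show int: "integrable M (\<lambda>x. \<bar>X x\<bar> powr p)"
    by (intro integrableI_bounded) (auto simp: le_less_trans[OF nn])
  have "(\<integral>x. \<bar>X x\<bar> powr p \<partial>M) \<le> 2 * a powr p"
    using nn int by (subst (asm) nn_integral_eq_integral) auto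
  then have "(\<integral>x. \<bar>X x\<bar> powr p \<partial>M) powr (1 / p) \<le> (2 * a powr p) powr (1 / p)"
    using p by (intro powr_mono2) auto
  also have "\<dots> = 2 powr (1 / p) * a"
    using a p by (simp add: powr_mult powr_powr)
  also have "\<dots> \<le> 2 powr 1 * a"
    using a p by (intro mult_right_mono powr_mono) auto
  finally show "(\<integral>x. \<bar>X x\<bar> powr p \<partial>M) powr (1 / p) \<le> 2 * a"
    by simp
qed

section \<open>Independence Metropolis-Hastings kernels\<close>

text \<open>The rejected mass stays under the integral, so each value is a \<open>\<nu>\<close>-mean
  of convex combinations of \<open>f y\<close> and \<open>f x\<close>. Supremum bounds and changes
  of \<open>\<nu>\<close> can then be read off the integrand.\<close>

definition imh_op :: "'a measure \<Rightarrow> ('a \<Rightarrow> 'a \<Rightarrow> real) \<Rightarrow> ('a \<Rightarrow> real) \<Rightarrow> 'a \<Rightarrow> real" where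
  "imh_op \<nu> \<alpha> f x = (\<integral>y. \<alpha> x y * f y + (1 - \<alpha> x y) * f x \<partial>\<nu>)"

definition weighted_mean :: "'a measure \<Rightarrow> ('a \<Rightarrow> real) \<Rightarrow> ('a \<Rightarrow> real) \<Rightarrow> real" where
  "weighted_mean \<nu> w f = (\<integral>y. w y * f y \<partial>\<nu>) / (\<integral>y. w y \<partial>\<nu>)"

text \<open>The Neumann series for the inverse of identity minus kernel, applied to the centered
  function. Being built from iterates, it also depends measurably on \<open>\<nu>\<close>.\<close>

definition imh_potential ::
    "'a measure \<Rightarrow> ('a \<Rightarrow> 'a \<Rightarrow> real) \<Rightarrow> ('a \<Rightarrow> real) \<Rightarrow> ('a \<Rightarrow> real) \<Rightarrow> 'a \<Rightarrow> real" where
  "imh_potential \<nu> \<alpha> w f x = (\<Sum>k. (imh_op \<nu> \<alpha> ^^ k) (\<lambda>y. f y - weighted_mean \<nu> w f) x)"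

lemma abs_convex_combination_le:
  fixes a u v c :: real
  assumes "0 \<le> a" "a \<le> 1" "\<bar>u\<bar> \<le> c" "\<bar>v\<bar> \<le> c"
  shows "\<bar>a * u + (1 - a) * v\<bar> \<le> c"
proof -
  have "\<bar>a * u + (1 - a) * v\<bar> \<le> a * \<bar>u\<bar> + (1 - a) * \<bar>v\<bar>"
    using assms by (intro order_trans[OF abs_triangle_ineq]) (simp add: abs_mult)
  also have "\<dots> \<le> a * c + (1 - a) * c"
    using assms by (intro add_mono mult_left_mono) auto
  finally show ?thesis by (simp add: algebra_simps)
qed

lemma (in prob_space) integrable_bounded:
  fixes f :: "'a \<Rightarrow> real"
  assumes "f \<in> borel_measurable M" "\<And>x. x \<in> space M \<Longrightarrow> \<bar>f x\<bar> \<le> c"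
  shows "integrable M f"
  using assms by (intro integrable_const_bound[where B = c]) auto

lemma (in prob_space) abs_integral_le:
  fixes f :: "'a \<Rightarrow> real"
  assumes "f \<in> borel_measurable M" "\<And>x. x \<in> space M \<Longrightarrow> \<bar>f x\<bar> \<le> c"
  shows "\<bar>\<integral>x. f x \<partial>M\<bar> \<le> c"
proof -
  have int: "integrable M f"
    by (rule integrable_bounded[OF assms])
  have "\<bar>\<integral>x. f x \<partial>M\<bar> \<le> (\<integral>x. \<bar>f x\<bar> \<partial>M)"
    by (rule integral_abs_bound)
  also have "\<dots> \<le> (\<integral>x. c \<partial>M)"
    using int assms by (intro integral_mono) auto
  finally show ?thesis by (simp add: prob_space)
qed

lemma integral_diff_scaled:
  fixes \<phi> :: "'a \<Rightarrow> real"
  assumes close: "\<And>\<phi>. \<phi> \<in> borel_measurable \<nu> \<Longrightarrow> (\<And>x. x \<in> space \<nu> \<Longrightarrow> \<bar>\<phi> x\<bar> \<le> 1)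
      \<Longrightarrow> \<bar>(\<integral>x. \<phi> x \<partial>\<nu>) - (\<integral>x. \<phi> x \<partial>\<nu>')\<bar> \<le> \<delta>"
    and [measurable]: "\<phi> \<in> borel_measurable \<nu>" and \<phi>: "\<And>x. x \<in> space \<nu> \<Longrightarrow> \<bar>\<phi> x\<bar> \<le> b"
    and b: "0 < b"
  shows "\<bar>(\<integral>x. \<phi> x \<partial>\<nu>) - (\<integral>x. \<phi> x \<partial>\<nu>')\<bar> \<le> \<delta> * b"
proof -
  have "\<bar>(\<integral>x. \<phi> x / b \<partial>\<nu>) - (\<integral>x. \<phi> x / b \<partial>\<nu>')\<bar> \<le> \<delta>"
    using \<phi> b by (intro close) (auto simp: abs_divide)
  then show ?thesis
    using b by (simp add: field_simps abs_if split: if_splits)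
qed

text \<open>The acceptance probability enters through two pointwise facts.
  \<open>detailed_balance\<close> gives a symmetric expression, hence reversibility with respect to
  \<open>w \<nu>\<close>. By \<open>minorization\<close> the accepted moves dominate
  \<open>\<theta> / B\<close> times the invariant law. Both hold at every point, so all later bounds
  are suprema without exceptional null sets.\<close>

locale imh = prob_space \<nu> for \<nu> :: "'a measure" +
  fixes w :: "'a \<Rightarrow> real" and \<alpha> :: "'a \<Rightarrow> 'a \<Rightarrow> real" and B :: real
  assumes w_measurable [measurable]: "w \<in> borel_measurable \<nu>"
    and \<alpha>_measurable [measurable]: "(\<lambda>(x, y). \<alpha> x y) \<in> borel_measurable (\<nu> \<Otimes>\<^sub>M \<nu>)"
    and w_nonneg: "x \<in> space \<nu> \<Longrightarrow> 0 \<le> w x"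
    and \<alpha>_nonneg: "x \<in> space \<nu> \<Longrightarrow> y \<in> space \<nu> \<Longrightarrow> 0 \<le> \<alpha> x y"
    and \<alpha>_le_1: "x \<in> space \<nu> \<Longrightarrow> y \<in> space \<nu> \<Longrightarrow> \<alpha> x y \<le> 1"
    and detailed_balance: "x \<in> space \<nu> \<Longrightarrow> y \<in> space \<nu> \<Longrightarrow> w x * \<alpha> x y = min (w x) (w y)"
    and minorization: "x \<in> space \<nu> \<Longrightarrow> y \<in> space \<nu> \<Longrightarrow> w y \<le> B * \<alpha> x y"
    and w_le: "x \<in> space \<nu> \<Longrightarrow> w x \<le> B"
    and mean_w_pos: "0 < (\<integral>x. w x \<partial>\<nu>)"
begin

abbreviation "\<theta> \<equiv> (\<integral>x. w x \<partial>\<nu>)"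
abbreviation "K \<equiv> imh_op \<nu> \<alpha>"
abbreviation "\<Phi> \<equiv> weighted_mean \<nu> w"

lemma mean_w_le: "\<theta> \<le> B"
  using abs_integral_le[of w B] w_nonneg w_le by fastforce

lemma B_pos: "0 < B"
  using mean_w_le mean_w_pos by simp

lemma integrable_w: "integrable \<nu> w"
  using w_nonneg w_le by (intro integrable_bounded[where c = B]) auto

lemma op_measurable [measurable]:
  assumes [measurable]: "f \<in> borel_measurable \<nu>"
  shows "K f \<in> borel_measurable \<nu>"
  unfolding imh_op_def by measurable

lemma op_bound:
  assumes [measurable]: "f \<in> borel_measurable \<nu>" and "\<And>x. x \<in> space \<nu> \<Longrightarrow> \<bar>f x\<bar> \<le> c"
    and x: "x \<in> space \<nu>"
  shows "\<bar>K f x\<bar> \<le> c"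
  unfolding imh_op_def
  using assms(2) \<alpha>_nonneg \<alpha>_le_1 x by (intro abs_integral_le abs_convex_combination_le) auto

lemma integrable_op:
  assumes [measurable]: "f \<in> borel_measurable \<nu>" and "\<And>x. x \<in> space \<nu> \<Longrightarrow> \<bar>f x\<bar> \<le> c"
    and x: "x \<in> space \<nu>"
  shows "integrable \<nu> (\<lambda>y. \<alpha> x y * f y + (1 - \<alpha> x y) * f x)"
  using assms(2) \<alpha>_nonneg \<alpha>_le_1 x
  by (intro integrable_bounded[where c = c] abs_convex_combination_le) auto

lemma integrable_w_mult:
  assumes [measurable]: "f \<in> borel_measurable \<nu>" and "\<And>x. x \<in> space \<nu> \<Longrightarrow> \<bar>f x\<bar> \<le> c"
  shows "integrable \<nu> (\<lambda>x. w x * f x)"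
proof (rule integrable_bounded[where c = "B * c"])
  fix x assume x: "x \<in> space \<nu>"
  then show "\<bar>w x * f x\<bar> \<le> B * c"
    using assms(2)[OF x] w_nonneg[OF x] w_le[OF x] by (auto simp: abs_mult intro!: mult_mono)
qed auto

lemma weighted_mean_bound:
  assumes [measurable]: "f \<in> borel_measurable \<nu>" and "\<And>x. x \<in> space \<nu> \<Longrightarrow> \<bar>f x\<bar> \<le> c"
  shows "\<bar>\<Phi> f\<bar> \<le> c"
proof -
  have "\<bar>\<integral>x. w x * f x \<partial>\<nu>\<bar> \<le> (\<integral>x. \<bar>w x * f x\<bar> \<partial>\<nu>)"
    by (rule integral_abs_bound)
  also have "\<dots> \<le> (\<integral>x. w x * c \<partial>\<nu>)"
    using integrable_w assms(2) w_nonneg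
    by (intro integral_mono integrable_abs integrable_w_mult[OF assms])
       (auto simp: abs_mult intro!: mult_left_mono)
  finally show ?thesis
    using mean_w_pos by (simp add: weighted_mean_def abs_divide divide_le_eq mult.commute)
qed

text \<open>Reversibility: \<open>w x * (K f x - f x)\<close> is the integral over \<open>y\<close>
  of \<open>min (w x) (w y) * (f y - f x)\<close>, which is antisymmetric in \<open>x\<close> and
  \<open>y\<close>, so that by Fubini its double integral vanishes.\<close>

lemma weighted_mean_op:
  assumes [measurable]: "f \<in> borel_measurable \<nu>" and f: "\<And>x. x \<in> space \<nu> \<Longrightarrow> \<bar>f x\<bar> \<le> c"
  shows "\<Phi> (K f) = \<Phi> f"
proof -
  let ?F = "\<lambda>x y. min (w x) (w y) * (f y - f x)"
  have F_bound: "\<bar>?F x y\<bar> \<le> B * (2 * c)" if "x \<in> space \<nu>" "y \<in> space \<nu>" for x y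
  proof -
    have "\<bar>f y - f x\<bar> \<le> 2 * c"
      using f[OF that(1)] f[OF that(2)] by auto
    then show ?thesis
      using w_nonneg w_le that B_pos by (auto simp: abs_mult intro!: mult_mono split: split_min)
  qed
  have int_F: "integrable \<nu> (?F x)" if x: "x \<in> space \<nu>" for x
    using F_bound x by (intro integrable_bounded) auto
  note total_mass = prob_space
  interpret pair_prob_space \<nu> \<nu> ..
  have "integrable (\<nu> \<Otimes>\<^sub>M \<nu>) (\<lambda>(x, y). ?F x y)"
  proof (rule P.integrable_const_bound[where B = "B * (2 * c)"])
    show "AE z in \<nu> \<Otimes>\<^sub>M \<nu>. norm (case z of (x, y) \<Rightarrow> ?F x y) \<le> B * (2 * c)"
      using F_bound by (auto simp: space_pair_measure)
  qed measurable
  then have "(\<integral>y. (\<integral>x. ?F x y \<partial>\<nu>) \<partial>\<nu>) = (\<integral>x. (\<integral>y. ?F x y \<partial>\<nu>) \<partial>\<nu>)"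
    by (rule Fubini_integral)
  moreover have "(\<integral>x. (\<integral>y. ?F x y \<partial>\<nu>) \<partial>\<nu>) = (\<integral>x. (\<integral>y. - ?F y x \<partial>\<nu>) \<partial>\<nu>)"
    by (simp add: min.commute algebra_simps)
  ultimately have 0: "(\<integral>x. (\<integral>y. ?F x y \<partial>\<nu>) \<partial>\<nu>) = 0"
    by simp
  have eq: "w x * K f x = (\<integral>y. ?F x y \<partial>\<nu>) + w x * f x" if x: "x \<in> space \<nu>" for x
  proof -
    have "w x * K f x = (\<integral>y. w x * (\<alpha> x y * f y + (1 - \<alpha> x y) * f x) \<partial>\<nu>)"
      by (simp add: imh_op_def)
    also have "\<dots> = (\<integral>y. ?F x y + w x * f x \<partial>\<nu>)"
      using detailed_balance[OF x] by (intro Bochner_Integration.integral_cong) (auto simp: algebra_simps)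
    also have "\<dots> = (\<integral>y. ?F x y \<partial>\<nu>) + w x * f x"
      using int_F[OF x] by (simp add: total_mass)
    finally show ?thesis .
  qed
  have "(\<integral>x. w x * K f x \<partial>\<nu>) = (\<integral>x. (w x * K f x - w x * f x) + w x * f x \<partial>\<nu>)"
    by simp
  also have "\<dots> = (\<integral>x. (w x * K f x - w x * f x) \<partial>\<nu>) + (\<integral>x. w x * f x \<partial>\<nu>)"
    by (intro Bochner_Integration.integral_add Bochner_Integration.integrable_diff
          integrable_w_mult[where c = c] op_bound f) auto
  also have "(\<integral>x. (w x * K f x - w x * f x) \<partial>\<nu>) = (\<integral>x. (\<integral>y. ?F x y \<partial>\<nu>) \<partial>\<nu>)"
    using eq by (intro Bochner_Integration.integral_cong) auto
  finally show ?thesis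
    using 0 by (simp add: weighted_mean_def)
qed

text \<open>Doeblin's argument. For centered \<open>f\<close> the term \<open>w y * f y / B\<close>
  can be subtracted under the integral for free. By the minorization the remaining coefficients
  \<open>\<alpha> x y - w y / B\<close> and \<open>1 - \<alpha> x y\<close> are nonnegative, with
  sum \<open>1 - w y / B\<close>.\<close>

lemma op_contraction:
  assumes [measurable]: "f \<in> borel_measurable \<nu>" and f: "\<And>x. x \<in> space \<nu> \<Longrightarrow> \<bar>f x\<bar> \<le> c"
    and 0: "\<Phi> f = 0" and x: "x \<in> space \<nu>"
  shows "\<bar>K f x\<bar> \<le> (1 - \<theta> / B) * c"
proof -
  have "(\<integral>y. w y * f y \<partial>\<nu>) = 0"
    using 0 mean_w_pos by (simp add: weighted_mean_def)
  then have "K f x = (\<integral>y. \<alpha> x y * f y + (1 - \<alpha> x y) * f x \<partial>\<nu>) - (\<integral>y. w y * f y / B \<partial>\<nu>)"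
    by (simp add: imh_op_def)
  also have "\<dots> = (\<integral>y. (\<alpha> x y * f y + (1 - \<alpha> x y) * f x) - w y * f y / B \<partial>\<nu>)"
    by (subst Bochner_Integration.integral_diff)
       (auto intro!: integrable_op[OF _ f x] integrable_w_mult[OF _ f])
  finally have "\<bar>K f x\<bar> \<le> (\<integral>y. \<bar>(\<alpha> x y * f y + (1 - \<alpha> x y) * f x) - w y * f y / B\<bar> \<partial>\<nu>)"
    by (simp add: integral_abs_bound)
  also have "\<dots> \<le> (\<integral>y. (1 - w y / B) * c \<partial>\<nu>)"
  proof (rule integral_mono)
    show "integrable \<nu> (\<lambda>y. \<bar>(\<alpha> x y * f y + (1 - \<alpha> x y) * f x) - w y * f y / B\<bar>)"
      by (intro integrable_abs Bochner_Integration.integrable_diff integrable_op[OF _ f x]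
            integrable_divide_zero integrable_w_mult[OF _ f]) auto
    show "integrable \<nu> (\<lambda>y. (1 - w y / B) * c)"
      using integrable_w by auto
    fix y assume y: "y \<in> space \<nu>"
    have 1: "w y / B \<le> \<alpha> x y"
      using minorization[OF x y] B_pos by (simp add: field_simps)
    have "\<bar>(\<alpha> x y * f y + (1 - \<alpha> x y) * f x) - w y * f y / B\<bar>
        = \<bar>(\<alpha> x y - w y / B) * f y + (1 - \<alpha> x y) * f x\<bar>"
      by (simp add: algebra_simps)
    also have "\<dots> \<le> (\<alpha> x y - w y / B) * \<bar>f y\<bar> + (1 - \<alpha> x y) * \<bar>f x\<bar>"
      using 1 \<alpha>_le_1[OF x y] by (intro order_trans[OF abs_triangle_ineq]) (simp add: abs_mult)
    also have "\<dots> \<le> (\<alpha> x y - w y / B) * c + (1 - \<alpha> x y) * c"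
      using 1 \<alpha>_le_1[OF x y] f[OF x] f[OF y] by (intro add_mono mult_left_mono) auto
    finally show "\<bar>(\<alpha> x y * f y + (1 - \<alpha> x y) * f x) - w y * f y / B\<bar> \<le> (1 - w y / B) * c"
      by (simp add: algebra_simps)
  qed
  also have "\<dots> = (1 - \<theta> / B) * c"
    using integrable_w by (simp add: prob_space)
  finally show ?thesis .
qed

lemma rate_bounds: "0 \<le> 1 - \<theta> / B" "1 - \<theta> / B < 1"
  using mean_w_le mean_w_pos B_pos by auto

context
  fixes f :: "'a \<Rightarrow> real" and c :: real
  assumes f [measurable]: "f \<in> borel_measurable \<nu>"
    and f_bound: "\<And>x. x \<in> space \<nu> \<Longrightarrow> \<bar>f x\<bar> \<le> c"
begin

abbreviation "f\<^sub>0 \<equiv> \<lambda>y. f y - \<Phi> f"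
abbreviation "\<rho> \<equiv> 1 - \<theta> / B"
abbreviation "g \<equiv> imh_potential \<nu> \<alpha> w f"

lemma weighted_mean_centered: "\<Phi> f\<^sub>0 = 0"
proof -
  have "(\<integral>y. w y * f\<^sub>0 y \<partial>\<nu>) = (\<integral>y. w y * f y - w y * \<Phi> f \<partial>\<nu>)"
    by (simp add: algebra_simps)
  also have "\<dots> = (\<integral>y. w y * f y \<partial>\<nu>) - \<theta> * \<Phi> f"
    using integrable_w_mult[OF f f_bound] integrable_w by simp
  also have "\<dots> = 0"
    using mean_w_pos by (simp add: weighted_mean_def)
  finally show ?thesis
    by (simp add: weighted_mean_def)
qed

text \<open>The three claims need each other: contraction requires a centered function, and the
  kernel preserves the mean of bounded measurable functions. The factor \<open>2\<close> comes from
  subtracting the mean.\<close>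

lemma iterate:
  "(K ^^ k) f\<^sub>0 \<in> borel_measurable \<nu> \<and> \<Phi> ((K ^^ k) f\<^sub>0) = 0 \<and>
    (\<forall>x\<in>space \<nu>. \<bar>(K ^^ k) f\<^sub>0 x\<bar> \<le> \<rho> ^ k * (2 * c))"
proof (induction k)
  case 0
  then show ?case
    using weighted_mean_centered f_bound weighted_mean_bound[OF f f_bound] by fastforce
next
  case (Suc k)
  then have [measurable]: "(K ^^ k) f\<^sub>0 \<in> borel_measurable \<nu>" and z: "\<Phi> ((K ^^ k) f\<^sub>0) = 0"
    and b: "\<And>x. x \<in> space \<nu> \<Longrightarrow> \<bar>(K ^^ k) f\<^sub>0 x\<bar> \<le> \<rho> ^ k * (2 * c)"
    by auto
  show ?case
    using weighted_mean_op[OF _ b] z op_contraction[OF _ b z] by (auto simp: mult.assoc)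
qed

lemma iterate_measurable [measurable]: "(K ^^ k) f\<^sub>0 \<in> borel_measurable \<nu>"
  using iterate by simp

lemma iterate_bound: "x \<in> space \<nu> \<Longrightarrow> \<bar>(K ^^ k) f\<^sub>0 x\<bar> \<le> \<rho> ^ k * (2 * c)"
  using iterate by simp

lemma summable_geometric_bound: "summable (\<lambda>k. \<rho> ^ k * (2 * c))"
  using rate_bounds by (intro summable_mult2 summable_geometric) auto

lemma suminf_geometric_bound: "(\<Sum>k. \<rho> ^ k * (2 * c)) = 2 * c * B / \<theta>"
proof -
  have "(\<Sum>k. \<rho> ^ k * (2 * c)) = (\<Sum>k. \<rho> ^ k) * (2 * c)"
    using rate_bounds by (intro suminf_mult2[symmetric] summable_geometric) auto
  also have "\<dots> = (1 / (1 - \<rho>)) * (2 * c)"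
    using rate_bounds by (subst suminf_geometric) auto
  finally show ?thesis
    using mean_w_pos B_pos by simp
qed

lemma summable_abs_iterate: "x \<in> space \<nu> \<Longrightarrow> summable (\<lambda>k. \<bar>(K ^^ k) f\<^sub>0 x\<bar>)"
  using iterate_bound by (intro summable_comparison_test'[OF summable_geometric_bound]) auto

lemma potential_measurable [measurable]: "g \<in> borel_measurable \<nu>"
  unfolding imh_potential_def[abs_def] by measurable

lemma potential_bound:
  assumes "x \<in> space \<nu>"
  shows "\<bar>g x\<bar> \<le> 2 * c * B / \<theta>"
proof -
  have "\<bar>g x\<bar> \<le> (\<Sum>k. \<bar>(K ^^ k) f\<^sub>0 x\<bar>)"
    unfolding imh_potential_def using summable_abs_iterate[OF assms] by (rule summable_rabs)
  also have "\<dots> \<le> (\<Sum>k. \<rho> ^ k * (2 * c))"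
    using iterate_bound[OF assms] summable_abs_iterate[OF assms] summable_geometric_bound
    by (intro suminf_le) auto
  finally show ?thesis
    by (simp add: suminf_geometric_bound)
qed

text \<open>Fixes the additive constant that the Poisson equation leaves open, without which two
  solutions could not be compared. Every term of the series has mean zero, and the geometric bound
  lets sum and integral commute.\<close>

lemma weighted_mean_potential: "\<Phi> g = 0"
proof -
  let ?F = "\<lambda>k x. w x * (K ^^ k) f\<^sub>0 x"
  have b: "\<bar>?F k x\<bar> \<le> B * (\<rho> ^ k * (2 * c))" if "x \<in> space \<nu>" for k x
    using iterate_bound[OF that] w_nonneg[OF that] w_le[OF that]
    by (auto simp: abs_mult intro!: mult_mono)
  have int: "integrable \<nu> (?F k)" for k
    using b by (intro integrable_bounded) auto
  have "(\<integral>x. w x * g x \<partial>\<nu>) = (\<integral>x. (\<Sum>k. ?F k x) \<partial>\<nu>)"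
    unfolding imh_potential_def
    by (intro Bochner_Integration.integral_cong suminf_mult[symmetric] refl)
       (use summable_abs_iterate in \<open>auto intro: summable_rabs_cancel\<close>)
  also have "\<dots> = (\<Sum>k. \<integral>x. ?F k x \<partial>\<nu>)"
  proof (rule integral_suminf)
    show "AE x in \<nu>. summable (\<lambda>k. norm (?F k x))"
      using b by (auto intro!: AE_I2 summable_comparison_test'[OF summable_mult[OF summable_geometric_bound, of B]])
    show "summable (\<lambda>k. \<integral>x. norm (?F k x) \<partial>\<nu>)"
    proof (rule summable_comparison_test'[OF summable_mult[OF summable_geometric_bound, of B]])
      show "norm (\<integral>x. norm (?F k x) \<partial>\<nu>) \<le> B * (\<rho> ^ k * (2 * c))" for k
        using b by (simp only: real_norm_def) (intro abs_integral_le, auto)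
    qed
  qed (rule int)
  also have "(\<lambda>k. \<integral>x. ?F k x \<partial>\<nu>) = (\<lambda>k. 0)"
    using iterate mean_w_pos by (auto simp: weighted_mean_def[of _ _ "(K ^^ _) _"])
  finally show ?thesis
    by (simp add: weighted_mean_def[of _ _ g])
qed

text \<open>Domination by the geometric series allows the kernel to be applied term by term; the
  result is the same series without its first term.\<close>

lemma poisson_equation:
  assumes x: "x \<in> space \<nu>"
  shows "g x - K g x = f x - \<Phi> f"
proof -
  let ?F = "\<lambda>k y. \<alpha> x y * (K ^^ k) f\<^sub>0 y + (1 - \<alpha> x y) * (K ^^ k) f\<^sub>0 x"
  have b: "\<bar>?F k y\<bar> \<le> \<rho> ^ k * (2 * c)" if "y \<in> space \<nu>" for k y
    using iterate_bound[OF that] iterate_bound[OF x] \<alpha>_nonneg \<alpha>_le_1 x that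
    by (intro abs_convex_combination_le) auto
  have [measurable]: "?F k \<in> borel_measurable \<nu>" for k
    using x by measurable
  have int: "integrable \<nu> (?F k)" for k
    using b by (intro integrable_bounded) auto
  have sm: "summable (\<lambda>k. (K ^^ k) f\<^sub>0 y)" if "y \<in> space \<nu>" for y
    using summable_abs_iterate[OF that] by (rule summable_rabs_cancel)
  have "K g x = (\<integral>y. (\<Sum>k. ?F k y) \<partial>\<nu>)"
    unfolding imh_op_def[of _ _ g]
  proof (intro Bochner_Integration.integral_cong refl)
    fix y assume y: "y \<in> space \<nu>"
    show "\<alpha> x y * g y + (1 - \<alpha> x y) * g x = (\<Sum>k. ?F k y)"
      unfolding imh_potential_def
      using sm[OF x] sm[OF y] by (simp add: suminf_add[symmetric] suminf_mult summable_mult)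
  qed
  also have "\<dots> = (\<Sum>k. \<integral>y. ?F k y \<partial>\<nu>)"
  proof (rule integral_suminf)
    show "AE y in \<nu>. summable (\<lambda>k. norm (?F k y))"
      using b by (auto intro!: AE_I2 summable_comparison_test'[OF summable_geometric_bound])
    show "summable (\<lambda>k. \<integral>y. norm (?F k y) \<partial>\<nu>)"
    proof (rule summable_comparison_test'[OF summable_geometric_bound])
      show "norm (\<integral>y. norm (?F k y) \<partial>\<nu>) \<le> \<rho> ^ k * (2 * c)" for k
        using b by (simp only: real_norm_def) (intro abs_integral_le, auto)
    qed
  qed (rule int)
  also have "\<dots> = (\<Sum>k. (K ^^ Suc k) f\<^sub>0 x)"
    by (simp add: imh_op_def)
  also have "\<dots> = g x - f\<^sub>0 x"
    unfolding imh_potential_def using suminf_split_head[OF sm[OF x]] by simp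
  finally show ?thesis
    by simp
qed

end

end

section \<open>Dependence of the Poisson solution on the proposal law\<close>

text \<open>\<open>\<delta>\<close> is a total variation distance expressed through test functions
  bounded by \<open>1\<close>; \<open>\<kappa>\<close> is a common lower bound for the two mean
  weights, which bounds both potentials by the same constant.\<close>

locale imh_pair = A: imh \<nu> w \<alpha> B + B: imh \<nu>' w \<alpha> B for \<nu> \<nu>' w \<alpha> B +
  fixes \<delta> \<kappa> :: real
  assumes sets_eq: "sets \<nu>' = sets \<nu>"
    and close: "\<phi> \<in> borel_measurable \<nu> \<Longrightarrow> (\<And>x. x \<in> space \<nu> \<Longrightarrow> \<bar>\<phi> x\<bar> \<le> 1)
      \<Longrightarrow> \<bar>(\<integral>x. \<phi> x \<partial>\<nu>) - (\<integral>x. \<phi> x \<partial>\<nu>')\<bar> \<le> \<delta>"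
    and \<kappa>: "0 < \<kappa>" "\<kappa> \<le> A.\<theta>" "\<kappa> \<le> B.\<theta>"
begin

lemma space_eq: "space \<nu>' = space \<nu>"
  using sets_eq by (rule sets_eq_imp_space_eq)

lemma meas_eq: "f \<in> borel_measurable \<nu>' \<longleftrightarrow> f \<in> borel_measurable \<nu>"
  using measurable_cong_sets[OF sets_eq refl] by auto

lemma weighted_mean_diff:
  assumes [measurable]: "\<phi> \<in> borel_measurable \<nu>" and \<phi>: "\<And>x. x \<in> space \<nu> \<Longrightarrow> \<bar>\<phi> x\<bar> \<le> b" and b: "0 < b"
  shows "\<bar>A.\<Phi> \<phi> - B.\<Phi> \<phi>\<bar> \<le> 2 * B * b * \<delta> / \<kappa>"
proof -
  let ?a = "\<integral>x. w x * \<phi> x \<partial>\<nu>" and ?b = "\<integral>x. w x * \<phi> x \<partial>\<nu>'"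
  have \<phi>': "\<phi> \<in> borel_measurable \<nu>'"
    by (simp add: meas_eq)
  have "\<bar>?a - ?b\<bar> \<le> \<delta> * (B * b)"
    using \<phi> b A.w_nonneg A.w_le A.B_pos
    by (intro integral_diff_scaled close) (auto simp: abs_mult intro!: mult_mono)
  moreover have "\<bar>A.\<theta> - B.\<theta>\<bar> \<le> \<delta> * B"
    using A.w_nonneg A.w_le A.B_pos by (intro integral_diff_scaled close) auto
  moreover have B\<Phi>: "\<bar>B.\<Phi> \<phi>\<bar> \<le> b"
    using \<phi> by (intro B.weighted_mean_bound \<phi>') (auto simp: space_eq)
  ultimately have sum_le: "\<bar>?a - ?b\<bar> + \<bar>B.\<Phi> \<phi>\<bar> * \<bar>B.\<theta> - A.\<theta>\<bar> \<le> \<delta> * (B * b) + b * (\<delta> * B)"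
    using b by (intro add_mono mult_mono) (auto simp: abs_minus_commute)
  \<comment> \<open>The difference of quotients is arranged so that the change of the denominator is
    multiplied by \<open>B.\<Phi> \<phi>\<close>, which is at most \<open>b\<close>. Numerator and
    denominator then contribute \<open>\<delta> * B * b\<close> each.\<close>
  have "A.\<Phi> \<phi> - B.\<Phi> \<phi> = ((?a - ?b) + B.\<Phi> \<phi> * (B.\<theta> - A.\<theta>)) / A.\<theta>"
    using A.mean_w_pos B.mean_w_pos by (simp add: weighted_mean_def field_simps)
  also have "\<bar>\<dots>\<bar> \<le> (\<bar>?a - ?b\<bar> + \<bar>B.\<Phi> \<phi>\<bar> * \<bar>B.\<theta> - A.\<theta>\<bar>) / A.\<theta>"
    using A.mean_w_pos by (auto simp: abs_divide abs_mult[symmetric] intro!: divide_right_mono abs_triangle_ineq)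
  also have "\<dots> \<le> (\<bar>?a - ?b\<bar> + \<bar>B.\<Phi> \<phi>\<bar> * \<bar>B.\<theta> - A.\<theta>\<bar>) / \<kappa>"
    using \<kappa> by (intro divide_left_mono) auto
  also have "\<dots> \<le> (\<delta> * (B * b) + b * (\<delta> * B)) / \<kappa>"
    using \<kappa> sum_le by (intro divide_right_mono) auto
  finally show ?thesis
    by (simp add: algebra_simps)
qed

text \<open>The difference \<open>u\<close> of the solutions splits into its mean under the first
  invariant law and a centered part \<open>v\<close>. The mean is a change of invariant law, since
  both solutions are normalized. For \<open>v\<close>, \<open>v - A.K v\<close> is of order
  \<open>\<delta>\<close>, and the contraction turns this into a bound on \<open>v\<close>. Each
  part contributes half of the constant.\<close>

lemma potential_diff:
  assumes f [measurable]: "f \<in> borel_measurable \<nu>" and f_bound: "\<And>x. x \<in> space \<nu> \<Longrightarrow> \<bar>f x\<bar> \<le> c"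
    and c: "0 < c" and x: "x \<in> space \<nu>"
  shows "\<bar>imh_potential \<nu> \<alpha> w f x - imh_potential \<nu>' \<alpha> w f x\<bar> \<le> 8 * B\<^sup>2 * c * \<delta> / \<kappa>\<^sup>2"
proof -
  let ?g = "imh_potential \<nu> \<alpha> w f" and ?g' = "imh_potential \<nu>' \<alpha> w f"
  let ?G = "2 * c * B / \<kappa>"
  have B: "0 < B" by (rule A.B_pos)
  have \<delta>: "0 \<le> \<delta>"
    using close[of "\<lambda>_. 0"] by simp
  have f': "f \<in> borel_measurable \<nu>'" and f'_bound: "\<And>x. x \<in> space \<nu>' \<Longrightarrow> \<bar>f x\<bar> \<le> c"
    using f f_bound by (auto simp: meas_eq space_eq)
  note [measurable] = A.potential_measurable[OF f f_bound]
  have [measurable]: "?g' \<in> borel_measurable \<nu>"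
    using B.potential_measurable[OF f' f'_bound] by (simp add: meas_eq)
  have g: "\<bar>?g y\<bar> \<le> ?G" if "y \<in> space \<nu>" for y
  proof -
    have "\<bar>?g y\<bar> \<le> 2 * c * B / A.\<theta>"
      using f_bound that by (intro A.potential_bound) auto
    also have "\<dots> \<le> ?G"
      using \<kappa> c B by (intro divide_left_mono) auto
    finally show ?thesis .
  qed
  have g': "\<bar>?g' y\<bar> \<le> ?G" if "y \<in> space \<nu>" for y
  proof -
    have "\<bar>?g' y\<bar> \<le> 2 * c * B / B.\<theta>"
      using f'_bound f' that by (intro B.potential_bound) (auto simp: space_eq)
    also have "\<dots> \<le> ?G"
      using \<kappa> c B by (intro divide_left_mono) auto
    finally show ?thesis .
  qed
  have G: "0 < ?G"
    using \<kappa> B c by simp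
  define u where "u = (\<lambda>y. ?g y - ?g' y)"
  define v where "v = (\<lambda>y. u y - A.\<Phi> u)"
  have [measurable]: "u \<in> borel_measurable \<nu>" "v \<in> borel_measurable \<nu>"
    by (simp_all add: u_def v_def)
  have u: "\<bar>u y\<bar> \<le> 2 * ?G" if "y \<in> space \<nu>" for y
    using g[OF that] g'[OF that] by (simp add: u_def)
  have \<Phi>v: "A.\<Phi> v = 0"
    using u unfolding v_def by (intro A.weighted_mean_centered) auto
  have \<Phi>u: "A.\<Phi> u = B.\<Phi> ?g' - A.\<Phi> ?g'"
  proof -
    have "A.\<Phi> u = A.\<Phi> ?g - A.\<Phi> ?g'"
      using A.integrable_w_mult[OF _ g] A.integrable_w_mult[OF _ g']
      by (simp add: u_def weighted_mean_def right_diff_distrib diff_divide_distrib)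
    moreover have "A.\<Phi> ?g = 0"
      using f f_bound by (intro A.weighted_mean_potential)
    moreover have "B.\<Phi> ?g' = 0"
      using f' f'_bound by (intro B.weighted_mean_potential)
    ultimately show ?thesis by simp
  qed
  have \<Phi>u_bound: "\<bar>A.\<Phi> u\<bar> \<le> 4 * B\<^sup>2 * c * \<delta> / \<kappa>\<^sup>2"
  proof -
    have "\<bar>A.\<Phi> u\<bar> \<le> 2 * B * ?G * \<delta> / \<kappa>"
      unfolding \<Phi>u abs_minus_commute[of "B.\<Phi> ?g'"] using g' G by (intro weighted_mean_diff) auto
    then show ?thesis
      by (simp add: power2_eq_square mult_ac)
  qed
  \<comment> \<open>One half bounds the change of the invariant mean of \<open>f\<close>, the other
    the change of the kernel on a function bounded by \<open>?G\<close>.\<close>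
  let ?r = "4 * B * c * \<delta> / \<kappa>"
  have r: "\<bar>v y - A.K v y\<bar> \<le> ?r" if y: "y \<in> space \<nu>" for y
  proof -
    have "A.K v y = (\<integral>z. (\<alpha> y z * u z + (1 - \<alpha> y z) * u y) - A.\<Phi> u \<partial>\<nu>)"
      unfolding imh_op_def by (intro Bochner_Integration.integral_cong) (auto simp: v_def algebra_simps)
    also have "\<dots> = A.K u y - A.\<Phi> u"
      using A.integrable_op[of u "2 * ?G" y] u y by (simp add: imh_op_def A.prob_space)
    finally have "v y - A.K v y = u y - A.K u y"
      by (simp add: v_def)
    also have "A.K u y = (\<integral>z. (\<alpha> y z * ?g z + (1 - \<alpha> y z) * ?g y) - (\<alpha> y z * ?g' z + (1 - \<alpha> y z) * ?g' y) \<partial>\<nu>)"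
      unfolding imh_op_def by (intro Bochner_Integration.integral_cong) (auto simp: u_def algebra_simps)
    also have "\<dots> = A.K ?g y - A.K ?g' y"
      using A.integrable_op[of ?g ?G y] A.integrable_op[of ?g' ?G y] g g' y by (simp add: imh_op_def)
    \<comment> \<open>Exchanging \<open>A.K\<close> for \<open>B.K\<close> on \<open>?g'\<close>
      makes each solution meet its own kernel; both Poisson equations apply and \<open>f y\<close>
      cancels.\<close>
    also have "u y - (A.K ?g y - A.K ?g' y) = (?g y - A.K ?g y) - (?g' y - B.K ?g' y) + (A.K ?g' y - B.K ?g' y)"
      by (simp add: u_def)
    also have "?g y - A.K ?g y = f y - A.\<Phi> f"
      using f_bound y by (intro A.poisson_equation) auto
    also have "?g' y - B.K ?g' y = f y - B.\<Phi> f"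
      using f' f'_bound y by (intro B.poisson_equation) (auto simp: space_eq)
    finally have "\<bar>v y - A.K v y\<bar> \<le> \<bar>A.\<Phi> f - B.\<Phi> f\<bar> + \<bar>A.K ?g' y - B.K ?g' y\<bar>"
      by simp
    also have "\<bar>A.\<Phi> f - B.\<Phi> f\<bar> \<le> 2 * B * c * \<delta> / \<kappa>"
      using f_bound c by (intro weighted_mean_diff) auto
    also have "\<bar>A.K ?g' y - B.K ?g' y\<bar> \<le> \<delta> * ?G"
      unfolding imh_op_def
      using g' G y A.\<alpha>_nonneg A.\<alpha>_le_1
      by (intro integral_diff_scaled close abs_convex_combination_le) auto
    finally show ?thesis
      by (simp add: field_simps)
  qed
  define s where "s = (SUP y\<in>space \<nu>. \<bar>v y\<bar>)"
  have "\<bar>v y\<bar> \<le> 2 * ?G + \<bar>A.\<Phi> u\<bar>" if "y \<in> space \<nu>" for y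
    using u[OF that] by (simp add: v_def)
  then have bdd: "bdd_above ((\<lambda>y. \<bar>v y\<bar>) ` space \<nu>)"
    by (rule bdd_aboveI2)
  have v_le_s: "\<bar>v y\<bar> \<le> s" if "y \<in> space \<nu>" for y
    unfolding s_def using bdd that by (intro cSUP_upper)
  \<comment> \<open>The supremum bounds itself with a factor below \<open>1\<close>. Solving for
    \<open>s\<close> is legitimate because \<open>s\<close> is finite by \<open>bdd\<close>.\<close>
  have "s \<le> (1 - A.\<theta> / B) * s + ?r"
    unfolding s_def
  proof (rule cSUP_least)
    show "space \<nu> \<noteq> {}"
      using x by auto
    fix y assume y: "y \<in> space \<nu>"
    have "\<bar>A.K v y\<bar> \<le> (1 - A.\<theta> / B) * s"
      using v_le_s \<Phi>v y by (intro A.op_contraction) auto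
    with r[OF y] show "\<bar>v y\<bar> \<le> (1 - A.\<theta> / B) * (SUP y\<in>space \<nu>. \<bar>v y\<bar>) + ?r"
      unfolding s_def[symmetric] by linarith
  qed
  then have "s * (A.\<theta> / B) \<le> ?r"
    by (simp add: algebra_simps)
  then have "s \<le> ?r / (A.\<theta> / B)"
    using A.mean_w_pos B by (subst pos_le_divide_eq) auto
  then have "s \<le> ?r * B / A.\<theta>"
    by simp
  also have "\<dots> \<le> ?r * B / \<kappa>"
    using \<kappa> B c \<delta> by (intro divide_left_mono) auto
  finally have "s \<le> 4 * B\<^sup>2 * c * \<delta> / \<kappa>\<^sup>2"
    by (simp add: power2_eq_square mult_ac)
  moreover have "u x = v x + A.\<Phi> u"
    by (simp add: v_def)
  ultimately show ?thesis
    using v_le_s[OF x] \<Phi>u_bound unfolding u_def by linarith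
qed

end

section \<open>Measurability of the transition kernels\<close>

lemma integral_bind_prob:
  fixes f :: "'b \<Rightarrow> real"
  assumes "prob_space M" "f \<in> borel_measurable K" "\<And>x. x \<in> space K \<Longrightarrow> \<bar>f x\<bar> \<le> c"
    and N: "N \<in> M \<rightarrow>\<^sub>M prob_algebra K"
  shows "(\<integral>x. f x \<partial>(M \<bind> N)) = (\<integral>x. \<integral>y. f y \<partial>N x \<partial>M)"
proof (rule integral_bind[where K = K and B' = 1])
  interpret prob_space M by fact
  show "finite_measure M"
    by (rule finite_measure_axioms)
  show "AE x in M. emeasure (N x) (space (N x)) \<le> ennreal 1"
    using measurable_space[OF N]
    by (auto simp: space_prob_algebra prob_space.emeasure_space_1)
  show "N \<in> M \<rightarrow>\<^sub>M subprob_algebra K"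
    using N by (rule measurable_prob_algebraD)
qed fact+

lemma measurable_bernoulli_pmf [measurable]:
  "(\<lambda>p. measure_pmf (bernoulli_pmf p)) \<in> borel \<rightarrow>\<^sub>M prob_algebra (count_space UNIV)"
proof (intro measurable_prob_algebraI measurable_subprob_algebra)
  fix A :: "bool set"
  have "(\<lambda>p. ennreal (\<Sum>b\<in>A. pmf (bernoulli_pmf p) b)) \<in> borel_measurable borel"
    by (simp add: bernoulli_pmf.rep_eq)
  then show "(\<lambda>p. emeasure (measure_pmf (bernoulli_pmf p)) A) \<in> borel_measurable borel"
    by (simp add: emeasure_measure_pmf_finite)
qed (auto simp: measure_pmf.prob_space_axioms prob_space_imp_subprob_space)

context simcmc
begin

lemma sets_E_eq [measurable_cong]: "sets (E n) = sets (PiM {1..n} L)"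
  by (simp add: E_def)

lemma measurable_E_restrict:
  "(\<lambda>x. restrict x {1..n - 1}) \<in> E n \<rightarrow>\<^sub>M E (n - 1)"
  unfolding E_def by (rule measurable_restrict_subset) auto

lemma measurable_E_last: "1 \<le> n \<Longrightarrow> (\<lambda>x. x n) \<in> E n \<rightarrow>\<^sub>M L n"
  unfolding E_def by (rule measurable_component_singleton) auto

lemma measurable_E_extend:
  assumes "1 \<le> n"
  shows "(\<lambda>(x, a). x(n := a)) \<in> E (n - 1) \<Otimes>\<^sub>M L n \<rightarrow>\<^sub>M E n"
proof -
  have "insert n {1..n - 1} = {1..n}"
    using assms by auto
  then show ?thesis
    using measurable_add_dim[of n "{1..n - 1}" L] by (simp add: E_def)
qed

lemma \<gamma>_measurable: "n \<in> {1..P} \<Longrightarrow> \<gamma> n \<in> borel_measurable (E n)"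
  using \<gamma>_integrable by (rule borel_measurable_integrable)

lemma weight_measurable:
  assumes n: "n \<in> {1..P}"
  shows "weight n \<in> borel_measurable (E n)"
proof (cases "n = 1")
  case True
  have [measurable]: "\<gamma> 1 \<in> borel_measurable (E 1)" "q1 \<in> borel_measurable (L 1)"
      "(\<lambda>x. x 1) \<in> E 1 \<rightarrow>\<^sub>M L 1"
    using \<gamma>_measurable[of 1] q1_measurable measurable_E_last[of 1] P_ge_1 by auto
  have "(\<lambda>x. ennreal (\<gamma> 1 x) / ennreal (q1 (x 1))) \<in> borel_measurable (E 1)"
    by measurable
  then show ?thesis
    using True by (simp add: weight_def[abs_def])
next
  case False
  then have n2: "n \<in> {2..P}" "n - 1 \<in> {1..P}" "1 \<le> n"
    using n by auto
  note [measurable] = \<gamma>_measurable[OF n] measurable_E_restrict[of n] measurable_E_last[OF n2(3)]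
    \<gamma>_measurable[OF n2(2)] q_measurable[OF n2(1)]
  have [measurable]: "(\<lambda>x. q n (restrict x {1..n - 1}) (x n)) \<in> borel_measurable (E n)"
    using measurable_compose[OF measurable_Pair q_measurable[OF n2(1)],
        OF measurable_E_restrict[of n] measurable_E_last[OF n2(3)]] by simp
  have [measurable]: "(\<lambda>x. \<gamma> (n - 1) (restrict x {1..n - 1})) \<in> borel_measurable (E n)"
    by (rule measurable_compose[OF measurable_E_restrict \<gamma>_measurable[OF n2(2)]])
  have "(\<lambda>x. ennreal (\<gamma> n x) / ennreal (\<gamma> (n - 1) (restrict x {1..n - 1}) *
      q n (restrict x {1..n - 1}) (x n))) \<in> borel_measurable (E n)"
    by measurable
  then show ?thesis
    using False by (simp add: weight_def[abs_def] Let_def)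
qed

definition kern :: "nat \<Rightarrow> (nat \<Rightarrow> 'a) \<Rightarrow> (nat \<Rightarrow> 'a) measure" where
  "kern n x = distr (density (L n) (\<lambda>a. ennreal (q n x a))) (E n) (\<lambda>a. x(n := a))"

lemma extend_eq: "extend n \<mu> = \<mu> \<bind> kern n"
  by (simp add: extend_def kern_def[abs_def])

lemma kern_measurable [measurable]:
  assumes n: "n \<in> {2..P}"
  shows "kern n \<in> E (n - 1) \<rightarrow>\<^sub>M prob_algebra (E n)"
  unfolding kern_def[abs_def]
proof (rule measurable_distr_prob_space2[where M = "L n"])
  interpret sigma_finite_measure "L n"
    using sigma_finite_L n by auto
  note [measurable] = q_measurable[OF n]
  have q_x: "q n x \<in> borel_measurable (L n)" if "x \<in> space (E (n - 1))" for x
    using measurable_compose_Pair1[OF that q_measurable[OF n]] by simp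
  show "(\<lambda>x. density (L n) (\<lambda>a. ennreal (q n x a))) \<in> E (n - 1) \<rightarrow>\<^sub>M prob_algebra (L n)"
  proof (intro measurable_prob_algebraI measurable_subprob_algebra)
    show *: "prob_space (density (L n) (\<lambda>a. ennreal (q n x a)))" if x: "x \<in> space (E (n - 1))" for x
    proof (rule prob_spaceI)
      note [measurable] = q_x[OF x]
      have "(\<integral>\<^sup>+a. ennreal (q n x a) * indicator (space (L n)) a \<partial>L n) = (\<integral>\<^sup>+a. ennreal (q n x a) \<partial>L n)"
        by (intro nn_integral_cong) auto
      then show "emeasure (density (L n) (\<lambda>a. ennreal (q n x a)))
          (space (density (L n) (\<lambda>a. ennreal (q n x a)))) = 1"
        using q_prob[OF n x] by (simp add: emeasure_density)
    qed
    show "subprob_space (density (L n) (\<lambda>a. ennreal (q n x a)))" if "x \<in> space (E (n - 1))" for x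
      using *[OF that] by (rule prob_space_imp_subprob_space)
    fix A assume A [measurable]: "A \<in> sets (L n)"
    have "(\<lambda>x. \<integral>\<^sup>+a. ennreal (q n x a) * indicator A a \<partial>L n) \<in> borel_measurable (E (n - 1))"
      by measurable
    then show "(\<lambda>x. emeasure (density (L n) (\<lambda>a. ennreal (q n x a))) A) \<in> borel_measurable (E (n - 1))"
      by (rule measurable_cong[THEN iffD1, rotated]) (simp add: emeasure_density q_x)
  qed simp
  show "(\<lambda>(x, a). x(n := a)) \<in> E (n - 1) \<Otimes>\<^sub>M L n \<rightarrow>\<^sub>M E n"
    using n by (intro measurable_E_extend) auto
qed

section \<open>Histories and the draw of one level\<close>

definition hist_index :: "nat \<Rightarrow> nat \<Rightarrow> (nat \<times> nat) set" where
  "hist_index i k = {0..<i} \<times> {1..P} \<union> {i} \<times> {1..k}"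

lemma hist_space_eq: "hist_space i k = PiM (hist_index i k) (\<lambda>(m, j). E j \<Otimes>\<^sub>M E j)"
  by (simp add: hist_space_def hist_index_def)

lemma hist_index_Suc_0: "hist_index (Suc i) 0 = hist_index i P"
  by (auto simp: hist_index_def)

lemma hist_space_Suc_0: "hist_space (Suc i) 0 = hist_space i P"
  by (simp add: hist_space_eq hist_index_Suc_0)

lemma measurable_hist_component:
  "(m, j) \<in> hist_index i k \<Longrightarrow> (\<lambda>h. h (m, j)) \<in> hist_space i k \<rightarrow>\<^sub>M E j \<Otimes>\<^sub>M E j"
  unfolding hist_space_eq
  using measurable_component_singleton[of "(m, j)" "hist_index i k" "\<lambda>(m, j). E j \<Otimes>\<^sub>M E j"] by simp

lemma measurable_hist_state:
  "(m, j) \<in> hist_index i k \<Longrightarrow> (\<lambda>h. snd (h (m, j))) \<in> hist_space i k \<rightarrow>\<^sub>M E j"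
  using measurable_compose[OF measurable_hist_component measurable_snd] .

lemma measurable_hist_restrict:
  "hist_index i k \<subseteq> hist_index i' k' \<Longrightarrow>
    (\<lambda>h. restrict h (hist_index i k)) \<in> hist_space i' k' \<rightarrow>\<^sub>M hist_space i k"
  unfolding hist_space_eq by (rule measurable_restrict_subset)

lemma measurable_hist_upd:
  "(\<lambda>(h, z). h((i, Suc k) := z)) \<in> hist_space i k \<Otimes>\<^sub>M (E (Suc k) \<Otimes>\<^sub>M E (Suc k)) \<rightarrow>\<^sub>M hist_space i (Suc k)"
proof -
  have *: "hist_index i (Suc k) = insert (i, Suc k) (hist_index i k)"
    by (auto simp: hist_index_def)
  show ?thesis
    using measurable_add_dim[of "(i, Suc k)" "hist_index i k" "\<lambda>(m, j). E j \<Otimes>\<^sub>M E j"]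
    unfolding hist_space_eq * by simp
qed

lemma empirical_measurable:
  assumes "\<And>m. m \<le> i \<Longrightarrow> (m, n) \<in> hist_index i' k"
  shows "empirical n i \<in> hist_space i' k \<rightarrow>\<^sub>M prob_algebra (E n)"
  unfolding empirical_def[abs_def]
proof (rule measurable_distr_prob_space2[where M = "uniform_count_measure {0..i}"])
  show "(\<lambda>h. uniform_count_measure {0..i}) \<in> hist_space i' k \<rightarrow>\<^sub>M prob_algebra (uniform_count_measure {0..i})"
    by (rule measurable_const) (auto simp: space_prob_algebra intro!: prob_space_uniform_count_measure)
  have "(\<lambda>(m, h). snd (h (m, n))) \<in> count_space {0..i} \<Otimes>\<^sub>M hist_space i' k \<rightarrow>\<^sub>M E n"
    using assms by (intro measurable_pair_measure_countable1) (auto intro!: measurable_hist_state)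
  from measurable_compose[OF measurable_pair_swap' this]
  show "(\<lambda>(h, m). snd (h (m, n))) \<in> hist_space i' k \<Otimes>\<^sub>M uniform_count_measure {0..i} \<rightarrow>\<^sub>M E n"
    by (subst measurable_cong_sets[OF sets_pair_measure_cong[OF refl sets_uniform_count_measure_count_space] refl])
       (simp add: case_prod_beta')
qed

definition proposal1 :: "(nat \<Rightarrow> 'a) measure" where
  "proposal1 = distr (density (L 1) (\<lambda>a. ennreal (q1 a))) (E 1) (\<lambda>a. \<lambda>j\<in>{1}. a)"

lemma measurable_singleton_point: "(\<lambda>a. \<lambda>j\<in>{1}. a) \<in> L 1 \<rightarrow>\<^sub>M E 1"
  unfolding E_def atLeastAtMost_singleton by (rule measurable_restrict) auto

lemma prob_space_proposal1: "prob_space proposal1"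
  unfolding proposal1_def
proof (rule prob_space.prob_space_distr)
  note [measurable] = q1_measurable
  show "prob_space (density (L 1) (\<lambda>a. ennreal (q1 a)))"
  proof (rule prob_spaceI)
    have "(\<integral>\<^sup>+a. ennreal (q1 a) * indicator (space (L 1)) a \<partial>L 1) = (\<integral>\<^sup>+a. ennreal (q1 a) \<partial>L 1)"
      by (intro nn_integral_cong) auto
    then show "emeasure (density (L 1) (\<lambda>a. ennreal (q1 a)))
        (space (density (L 1) (\<lambda>a. ennreal (q1 a)))) = 1"
      using q1_prob by (simp add: emeasure_density del: One_nat_def)
  qed
  show "(\<lambda>a. \<lambda>j\<in>{1}. a) \<in> density (L 1) (\<lambda>a. ennreal (q1 a)) \<rightarrow>\<^sub>M E 1"
    using measurable_singleton_point by simp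
qed

lemma sets_proposal1: "sets proposal1 = sets (E 1)"
  by (simp add: proposal1_def)

lemma proposal_1: "proposal i 1 h = proposal1"
  by (simp add: proposal_def proposal1_def)

lemma proposal_ge_2: "2 \<le> n \<Longrightarrow> proposal i n h = empirical (n - 1) i h \<bind> kern n"
  by (simp add: proposal_def extend_eq)

lemma proposal_measurable:
  assumes n: "n \<in> {1..P}"
  shows "proposal i n \<in> hist_space i (n - 1) \<rightarrow>\<^sub>M prob_algebra (E n)"
proof (cases "n = 1")
  case True
  show ?thesis
    unfolding True proposal_1[abs_def]
    by (rule measurable_const) (auto simp: space_prob_algebra prob_space_proposal1 sets_proposal1)
next
  case False
  then have n2: "n \<in> {2..P}"
    using n by auto
  have "(\<lambda>h. empirical (n - 1) i h \<bind> kern n) \<in> hist_space i (n - 1) \<rightarrow>\<^sub>M prob_algebra (E n)"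
    \<comment> \<open>The empirical measure of level \<open>n - 1\<close> includes its state from
      the same iteration \<open>i\<close>, which \<open>hist_space i (n - 1)\<close> already
      carries.\<close>
    using n2 by (intro measurable_bind_prob_space[OF empirical_measurable kern_measurable])
      (auto simp: hist_index_def)
  moreover have "proposal i n = (\<lambda>h. empirical (n - 1) i h \<bind> kern n)"
    using n2 by (intro ext proposal_ge_2) auto
  ultimately show ?thesis
    by simp
qed

lemma prob_space_proposal:
  "n \<in> {1..P} \<Longrightarrow> h \<in> space (hist_space i (n - 1)) \<Longrightarrow> prob_space (proposal i n h)"
  and sets_proposal:
  "n \<in> {1..P} \<Longrightarrow> h \<in> space (hist_space i (n - 1)) \<Longrightarrow> sets (proposal i n h) = sets (E n)"
  using measurable_space[OF proposal_measurable] by (auto simp: space_prob_algebra)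

lemma accept_prob_measurable:
  assumes n: "n \<in> {1..P}"
  shows "(\<lambda>(x, y). accept_prob n x y) \<in> borel_measurable (E n \<Otimes>\<^sub>M E n)"
proof -
  note [measurable] = weight_measurable[OF n]
  show ?thesis
    unfolding accept_prob_def by measurable
qed

lemma accept_prob_bounds: "0 \<le> accept_prob n x y" "accept_prob n x y \<le> 1"
proof -
  have "enn2real (min 1 (weight n y / weight n x)) \<le> enn2real 1"
    by (intro enn2real_mono) auto
  then show "accept_prob n x y \<le> 1"
    by (simp add: accept_prob_def)
qed (simp add: accept_prob_def)

definition accept_step :: "nat \<Rightarrow> (nat \<Rightarrow> 'a) \<Rightarrow> (nat \<Rightarrow> 'a) \<Rightarrow> ((nat \<Rightarrow> 'a) \<times> (nat \<Rightarrow> 'a)) measure" where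
  "accept_step n x y = measure_pmf (bernoulli_pmf (accept_prob n x y)) \<bind>
     (\<lambda>b. return (E n \<Otimes>\<^sub>M E n) (y, if b then y else x))"

lemma level_step_eq: "level_step i n h = proposal i n h \<bind> accept_step n (snd (h (i - 1, n)))"
  by (simp add: level_step_def accept_step_def[abs_def] Let_def)

lemma accept_step_measurable:
  assumes n: "n \<in> {1..P}"
  shows "(\<lambda>(x, y). accept_step n x y) \<in> E n \<Otimes>\<^sub>M E n \<rightarrow>\<^sub>M prob_algebra (E n \<Otimes>\<^sub>M E n)"
proof -
  note [measurable] = accept_prob_measurable[OF n]
  have [measurable]: "(\<lambda>z. accept_prob n (fst z) (snd z)) \<in> borel_measurable (E n \<Otimes>\<^sub>M E n)"
    using accept_prob_measurable[OF n] by (simp add: case_prod_beta')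
  have "(\<lambda>z. measure_pmf (bernoulli_pmf (accept_prob n (fst z) (snd z))) \<bind>
     (\<lambda>b. return (E n \<Otimes>\<^sub>M E n) (snd z, if b then snd z else fst z)))
     \<in> E n \<Otimes>\<^sub>M E n \<rightarrow>\<^sub>M prob_algebra (E n \<Otimes>\<^sub>M E n)"
  proof (rule measurable_bind_prob_space2[where N = "count_space UNIV"])
    show "(\<lambda>(z, b). return (E n \<Otimes>\<^sub>M E n) (snd z, if b then snd z else fst z))
      \<in> (E n \<Otimes>\<^sub>M E n) \<Otimes>\<^sub>M count_space UNIV \<rightarrow>\<^sub>M prob_algebra (E n \<Otimes>\<^sub>M E n)"
      by measurable
  qed measurable
  then show ?thesis
    by (simp add: accept_step_def case_prod_beta')
qed

lemma level_step_measurable: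
  assumes n: "n \<in> {1..P}" and i: "1 \<le> i"
  shows "level_step i n \<in> hist_space i (n - 1) \<rightarrow>\<^sub>M prob_algebra (E n \<Otimes>\<^sub>M E n)"
  unfolding level_step_eq[abs_def]
proof (rule measurable_bind_prob_space2[OF proposal_measurable[OF n]])
  have [measurable]: "(\<lambda>h. snd (h (i - 1, n))) \<in> hist_space i (n - 1) \<rightarrow>\<^sub>M E n"
    using n i by (intro measurable_hist_state) (auto simp: hist_index_def)
  have "(\<lambda>z. (snd (fst z (i - 1, n)), snd z)) \<in> hist_space i (n - 1) \<Otimes>\<^sub>M E n \<rightarrow>\<^sub>M E n \<Otimes>\<^sub>M E n"
    using measurable_compose[OF measurable_fst \<open>(\<lambda>h. snd (h (i - 1, n))) \<in> _\<close>]
    by (intro measurable_Pair) auto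
  from measurable_compose[OF this accept_step_measurable[OF n]]
  show "(\<lambda>(h, y). accept_step n (snd (h (i - 1, n))) y) \<in>
    hist_space i (n - 1) \<Otimes>\<^sub>M E n \<rightarrow>\<^sub>M prob_algebra (E n \<Otimes>\<^sub>M E n)"
    by (simp add: case_prod_beta')
qed

lemma integral_accept_step:
  fixes G :: "_ \<Rightarrow> real"
  assumes n: "n \<in> {1..P}" and xy: "x \<in> space (E n)" "y \<in> space (E n)"
    and G: "G \<in> borel_measurable (E n \<Otimes>\<^sub>M E n)" "\<And>z. z \<in> space (E n \<Otimes>\<^sub>M E n) \<Longrightarrow> \<bar>G z\<bar> \<le> c"
  shows "(\<integral>z. G z \<partial>accept_step n x y) = accept_prob n x y * G (y, y) + (1 - accept_prob n x y) * G (y, x)"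
proof -
  have sp: "(y, if b then y else x) \<in> space (E n \<Otimes>\<^sub>M E n)" for b
    using xy by (auto simp: space_pair_measure)
  have "(\<integral>z. G z \<partial>accept_step n x y) = (\<integral>b. \<integral>z. G z \<partial>return (E n \<Otimes>\<^sub>M E n) (y, if b then y else x)
      \<partial>measure_pmf (bernoulli_pmf (accept_prob n x y)))"
    unfolding accept_step_def
    by (rule integral_bind_prob[OF _ G])
       (use sp in \<open>auto simp: measure_pmf.prob_space_axioms space_prob_algebra prob_space_return\<close>)
  also have "\<dots> = (\<integral>b. G (y, if b then y else x) \<partial>measure_pmf (bernoulli_pmf (accept_prob n x y)))"
    using sp G(1) by (intro Bochner_Integration.integral_cong integral_return) auto
  finally show ?thesis
    using accept_prob_bounds[of n x y] by (simp add: mult.commute)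
qed

text \<open>If \<open>G\<close> reads only the new state, the right side is \<open>imh_op\<close> of
  the proposal law; if it reads only the proposal, the acceptance probability cancels. The two cases
  center the two martingales used later.\<close>

lemma integral_level_step:
  fixes G :: "_ \<Rightarrow> real"
  assumes n: "n \<in> {1..P}" and i: "1 \<le> i" and h: "h \<in> space (hist_space i (n - 1))"
    and G: "G \<in> borel_measurable (E n \<Otimes>\<^sub>M E n)" "\<And>z. z \<in> space (E n \<Otimes>\<^sub>M E n) \<Longrightarrow> \<bar>G z\<bar> \<le> c"
  shows "(\<integral>z. G z \<partial>level_step i n h) =
    (\<integral>y. accept_prob n (snd (h (i - 1, n))) y * G (y, y)
       + (1 - accept_prob n (snd (h (i - 1, n))) y) * G (y, snd (h (i - 1, n))) \<partial>proposal i n h)"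
proof -
  let ?x = "snd (h (i - 1, n))"
  have x: "?x \<in> space (E n)"
    using n i by (intro measurable_space[OF measurable_hist_state h]) (auto simp: hist_index_def)
  have meas: "accept_step n ?x \<in> proposal i n h \<rightarrow>\<^sub>M prob_algebra (E n \<Otimes>\<^sub>M E n)"
    using measurable_compose_Pair1[OF x accept_step_measurable[OF n]]
    by (simp add: measurable_cong_sets[OF sets_proposal[OF n h] refl])
  have "(\<integral>z. G z \<partial>level_step i n h) = (\<integral>y. \<integral>z. G z \<partial>accept_step n ?x y \<partial>proposal i n h)"
    unfolding level_step_eq by (rule integral_bind_prob[OF prob_space_proposal[OF n h] G meas])
  also have "\<dots> = (\<integral>y. accept_prob n ?x y * G (y, y) + (1 - accept_prob n ?x y) * G (y, ?x) \<partial>proposal i n h)"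
    using x G sets_eq_imp_space_eq[OF sets_proposal[OF n h]]
    by (intro Bochner_Integration.integral_cong integral_accept_step[OF n]) auto
  finally show ?thesis .
qed

end

section \<open>Laws of histories and martingale bounds\<close>

text \<open>Hoeffding's lemma on an interval of length \<open>2 * c\<close>. A negative
  \<open>s\<close> is handled by passing to \<open>- X\<close>.\<close>

lemma (in prob_space) nn_integral_exp_centered_le:
  fixes X :: "'a \<Rightarrow> real"
  assumes X: "X \<in> borel_measurable M" and bound: "\<And>x. x \<in> space M \<Longrightarrow> \<bar>X x\<bar> \<le> c"
    and centered: "(\<integral>x. X x \<partial>M) = 0"
  shows "(\<integral>\<^sup>+x. ennreal (exp (s * X x)) \<partial>M) \<le> ennreal (exp (s\<^sup>2 * c\<^sup>2 / 2))"
proof -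
  have pos: "(\<integral>\<^sup>+x. ennreal (exp (l * Y x)) \<partial>M) \<le> ennreal (exp (l\<^sup>2 * c\<^sup>2 / 2))"
    if l: "0 < l" and Y: "Y \<in> borel_measurable M" and Y_bound: "\<And>x. x \<in> space M \<Longrightarrow> \<bar>Y x\<bar> \<le> c"
      and Y_centered: "(\<integral>x. Y x \<partial>M) = 0" for l :: real and Y
  proof -
    have mem: "Y x \<in> {- c..c}" if "x \<in> space M" for x
      using Y_bound[OF that] by (simp add: abs_le_iff)
    have "interval_bounded_random_variable M Y (- c) c"
      by (intro interval_bounded_random_variable.intro interval_bounded_random_variable_axioms.intro
            prob_space_axioms Y AE_I2 mem)
    then have "(\<integral>\<^sup>+x. ennreal (exp (l * Y x)) \<partial>M) \<le> ennreal (exp (l\<^sup>2 * (c - - c)\<^sup>2 / 8))"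
      using l Y_centered by (rule interval_bounded_random_variable.Hoeffdings_lemma_nn_integral_0)
    also have "(c - - c)\<^sup>2 = 4 * c\<^sup>2"
      by (simp add: power2_eq_square)
    finally show ?thesis
      by (simp add: mult.commute)
  qed
  consider "0 < s" | "s = 0" | "0 < - s"
    by linarith
  then show ?thesis
  proof cases
    case 1
    then show ?thesis
      using X bound centered by (rule pos)
  next
    case 2
    then show ?thesis
      by (simp add: emeasure_space_1)
  next
    case 3
    have "(\<integral>\<^sup>+x. ennreal (exp (- s * - X x)) \<partial>M) \<le> ennreal (exp ((- s)\<^sup>2 * c\<^sup>2 / 2))"
    proof (rule pos[OF 3])
      show "\<bar>- X x\<bar> \<le> c" if "x \<in> space M" for x
        using bound[OF that] by simp
    qed (use X centered in auto)
    then show ?thesis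
      by simp
  qed
qed

lemma bind_in_prob_algebra:
  assumes "M \<in> space (prob_algebra A)" "N \<in> A \<rightarrow>\<^sub>M prob_algebra B"
  shows "M \<bind> N \<in> space (prob_algebra B)"
  using prob_space_bind'[OF assms] sets_bind'[OF assms] by (simp add: space_prob_algebra)

context simcmc
begin

definition hist_step ::
    "nat \<Rightarrow> nat \<Rightarrow> (nat \<times> nat \<Rightarrow> (nat \<Rightarrow> 'a) \<times> (nat \<Rightarrow> 'a))
      \<Rightarrow> (nat \<times> nat \<Rightarrow> (nat \<Rightarrow> 'a) \<times> (nat \<Rightarrow> 'a)) measure" where
  "hist_step m k h = level_step m (Suc k) h \<bind> (\<lambda>z. return (hist_space m (Suc k)) (h((m, Suc k) := z)))"

lemma sweep_Suc: "sweep m (Suc k) h = sweep m k h \<bind> hist_step m k"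
  by (simp add: hist_step_def[abs_def])

lemma measurable_return_hist_upd:
  "(\<lambda>(h, z). return (hist_space m (Suc k)) (h((m, Suc k) := z)))
    \<in> hist_space m k \<Otimes>\<^sub>M (E (Suc k) \<Otimes>\<^sub>M E (Suc k)) \<rightarrow>\<^sub>M prob_algebra (hist_space m (Suc k))"
  using measurable_compose[OF measurable_hist_upd measurable_return_prob_space]
  by (simp add: case_prod_beta')

lemma hist_step_measurable:
  assumes "1 \<le> m" "Suc k \<le> P"
  shows "hist_step m k \<in> hist_space m k \<rightarrow>\<^sub>M prob_algebra (hist_space m (Suc k))"
  unfolding hist_step_def[abs_def]
  by (rule measurable_bind_prob_space2[OF _ measurable_return_hist_upd])
     (use level_step_measurable[of "Suc k" m] assms in simp)

lemma sweep_measurable: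
  assumes "1 \<le> m" "k \<le> P"
  shows "sweep m k \<in> hist_space m 0 \<rightarrow>\<^sub>M prob_algebra (hist_space m k)"
  using assms(2)
proof (induction k)
  case 0
  have "sweep m 0 = return (hist_space m 0)"
    by (rule ext) simp
  then show ?case
    by simp
next
  case (Suc k)
  have "(\<lambda>h. sweep m k h \<bind> hist_step m k) \<in> hist_space m 0 \<rightarrow>\<^sub>M prob_algebra (hist_space m (Suc k))"
    using Suc assms(1) by (intro measurable_bind_prob_space[OF _ hist_step_measurable]) auto
  moreover have "sweep m (Suc k) = (\<lambda>h. sweep m k h \<bind> hist_step m k)"
    by (rule ext) (rule sweep_Suc)
  ultimately show ?case
    by simp
qed

text \<open>Everything that the draw of level \<open>n\<close> at iteration \<open>m\<close> may
  depend on. Conditioning on the past becomes restriction of the history, with no conditional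
  expectations.\<close>

definition past :: "nat \<Rightarrow> nat \<Rightarrow> (nat \<times> nat \<Rightarrow> (nat \<Rightarrow> 'a) \<times> (nat \<Rightarrow> 'a))
    \<Rightarrow> (nat \<times> nat \<Rightarrow> (nat \<Rightarrow> 'a) \<times> (nat \<Rightarrow> 'a))" where
  "past m n h = restrict h (hist_index m (n - 1))"

lemma past_eq [simp]: "(l, j) \<in> hist_index m (n - 1) \<Longrightarrow> past m n h (l, j) = h (l, j)"
  by (simp add: past_def)

text \<open>The stages inside an iteration, interpolating between consecutive values of
  \<open>run\<close>. The truncated \<open>m - 1\<close> is meant for
  \<open>m \<ge> 1\<close>.\<close>

definition law :: "(nat \<Rightarrow> nat \<Rightarrow> 'a) \<Rightarrow> nat \<Rightarrow> nat
    \<Rightarrow> (nat \<times> nat \<Rightarrow> (nat \<Rightarrow> 'a) \<times> (nat \<Rightarrow> 'a)) measure" where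
  "law x0 m k = run x0 (m - 1) \<bind> sweep m k"

lemma law_P: "1 \<le> m \<Longrightarrow> law x0 m P = run x0 m"
  by (cases m) (auto simp: law_def)

end

locale simcmc_init = simcmc P F L \<gamma> q1 q
  for P :: nat
    and F :: "'a measure"
    and L :: "nat \<Rightarrow> 'a measure"
    and \<gamma> :: "nat \<Rightarrow> (nat \<Rightarrow> 'a) \<Rightarrow> real"
    and q1 :: "'a \<Rightarrow> real"
    and q :: "nat \<Rightarrow> (nat \<Rightarrow> 'a) \<Rightarrow> 'a \<Rightarrow> real" +
  fixes x0 :: "nat \<Rightarrow> nat \<Rightarrow> 'a"
  assumes x0: "k \<in> {1..P} \<Longrightarrow> x0 k \<in> space (E k)"
begin

lemma run_in_prob_algebra: "run x0 i \<in> space (prob_algebra (hist_space i P))"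
proof (induction i)
  case 0
  have "(\<lambda>(m, k)\<in>{0} \<times> {1..P}. (x0 k, x0 k)) \<in> space (hist_space 0 P)"
    using x0 by (auto simp: hist_space_def space_PiM space_pair_measure split: prod.splits)
  then show ?case
    by (simp add: space_prob_algebra prob_space_return)
next
  case (Suc i)
  then show ?case
    using bind_in_prob_algebra[OF _ sweep_measurable[of "Suc i" P]]
    by (simp add: hist_space_Suc_0)
qed

lemma prob_space_run: "prob_space (run x0 i)"
  and sets_run: "sets (run x0 i) = sets (hist_space i P)"
  using run_in_prob_algebra[of i] by (auto simp: space_prob_algebra)

lemma law_in_prob_algebra:
  assumes "1 \<le> m" "k \<le> P"
  shows "law x0 m k \<in> space (prob_algebra (hist_space m k))"
proof -
  have "run x0 (m - 1) \<in> space (prob_algebra (hist_space m 0))"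
    using run_in_prob_algebra[of "m - 1"] hist_space_Suc_0[of "m - 1"] assms by simp
  then show ?thesis
    unfolding law_def using sweep_measurable[OF assms] by (rule bind_in_prob_algebra)
qed

lemma law_0: "law x0 (Suc m) 0 = run x0 m"
proof -
  have "sweep (Suc m) 0 = return (hist_space m P)"
    by (rule ext) (simp add: hist_space_Suc_0)
  then show ?thesis
    by (simp add: law_def bind_return'' sets_run)
qed

lemma law_Suc:
  assumes "1 \<le> m" "Suc k \<le> P"
  shows "law x0 m (Suc k) = law x0 m k \<bind> hist_step m k"
proof -
  have "run x0 (m - 1) \<bind> (\<lambda>h. sweep m k h \<bind> hist_step m k)
      = (run x0 (m - 1) \<bind> sweep m k) \<bind> hist_step m k"
  proof (rule bind_assoc[symmetric])
    show "sweep m k \<in> run x0 (m - 1) \<rightarrow>\<^sub>M subprob_algebra (hist_space m k)"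
      using measurable_prob_algebraD[OF sweep_measurable[of m k]] hist_space_Suc_0[of "m - 1"] assms
      by (simp add: measurable_cong_sets[OF sets_run refl])
    show "hist_step m k \<in> hist_space m k \<rightarrow>\<^sub>M subprob_algebra (hist_space m (Suc k))"
      using measurable_prob_algebraD[OF hist_step_measurable] assms by simp
  qed
  moreover have "sweep m (Suc k) = (\<lambda>h. sweep m k h \<bind> hist_step m k)"
    by (rule ext) (rule sweep_Suc)
  ultimately show ?thesis
    unfolding law_def by simp
qed

lemma nn_integral_law_Suc:
  assumes "1 \<le> m" "Suc k \<le> P" and [measurable]: "G \<in> borel_measurable (hist_space m (Suc k))"
  shows "(\<integral>\<^sup>+h. G h \<partial>law x0 m (Suc k)) =
    (\<integral>\<^sup>+h. \<integral>\<^sup>+z. G (h((m, Suc k) := z)) \<partial>level_step m (Suc k) h \<partial>law x0 m k)"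
proof -
  have law: "law x0 m k \<in> space (prob_algebra (hist_space m k))"
    using assms by (intro law_in_prob_algebra) auto
  then have sets_law: "sets (law x0 m k) = sets (hist_space m k)"
    by (simp add: space_prob_algebra)
  have "(\<integral>\<^sup>+h. G h \<partial>law x0 m (Suc k)) = (\<integral>\<^sup>+h. \<integral>\<^sup>+h'. G h' \<partial>hist_step m k h \<partial>law x0 m k)"
    unfolding law_Suc[OF assms(1,2)]
    using measurable_prob_algebraD[OF hist_step_measurable[OF assms(1,2)]]
    by (intro nn_integral_bind[where B = "hist_space m (Suc k)"])
       (auto simp: measurable_cong_sets[OF sets_law refl])
  also have "\<dots> = (\<integral>\<^sup>+h. \<integral>\<^sup>+z. G (h((m, Suc k) := z)) \<partial>level_step m (Suc k) h \<partial>law x0 m k)"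
  proof (rule nn_integral_cong)
    fix h assume "h \<in> space (law x0 m k)"
    then have h: "h \<in> space (hist_space m k)"
      using sets_eq_imp_space_eq[OF sets_law] by simp
    have sets_step: "sets (level_step m (Suc k) h) = sets (E (Suc k) \<Otimes>\<^sub>M E (Suc k))"
      using measurable_space[OF level_step_measurable[of "Suc k" m], of h] assms h
      by (simp add: space_prob_algebra)
    have upd: "(\<lambda>z. h((m, Suc k) := z)) \<in> E (Suc k) \<Otimes>\<^sub>M E (Suc k) \<rightarrow>\<^sub>M hist_space m (Suc k)"
      using measurable_compose_Pair1[OF h measurable_hist_upd] by simp
    have "(\<integral>\<^sup>+h'. G h' \<partial>hist_step m k h) = (\<integral>\<^sup>+z. \<integral>\<^sup>+h'. G h' \<partial>return (hist_space m (Suc k)) (h((m, Suc k) := z))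
        \<partial>level_step m (Suc k) h)"
      unfolding hist_step_def
      by (rule nn_integral_bind[where B = "hist_space m (Suc k)"])
         (auto intro!: measurable_compose[OF upd return_measurable] simp: measurable_cong_sets[OF sets_step refl])
    also have "\<dots> = (\<integral>\<^sup>+z. G (h((m, Suc k) := z)) \<partial>level_step m (Suc k) h)"
      using measurable_space[OF upd] sets_eq_imp_space_eq[OF sets_step]
      by (intro nn_integral_cong nn_integral_return) auto
    finally show "(\<integral>\<^sup>+h'. G h' \<partial>hist_step m k h) = (\<integral>\<^sup>+z. G (h((m, Suc k) := z)) \<partial>level_step m (Suc k) h)" .
  qed
  finally show ?thesis .
qed

lemma prob_space_level_step:
  "n \<in> {1..P} \<Longrightarrow> 1 \<le> i \<Longrightarrow> h \<in> space (hist_space i (n - 1)) \<Longrightarrow> prob_space (level_step i n h)"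
  and sets_level_step:
  "n \<in> {1..P} \<Longrightarrow> 1 \<le> i \<Longrightarrow> h \<in> space (hist_space i (n - 1)) \<Longrightarrow>
    sets (level_step i n h) = sets (E n \<Otimes>\<^sub>M E n)"
  using measurable_space[OF level_step_measurable] by (auto simp: space_prob_algebra)

lemma space_law: "1 \<le> m \<Longrightarrow> k \<le> P \<Longrightarrow> space (law x0 m k) = space (hist_space m k)"
  using law_in_prob_algebra[of m k] sets_eq_imp_space_eq by (auto simp: space_prob_algebra)

section \<open>Conditioning on the past of a draw\<close>

text \<open>Later draws do not disturb the joint law of earlier components: the new component is
  integrated out against a probability measure.\<close>

lemma nn_integral_law_restrict:
  assumes m: "1 \<le> m" and k: "Suc k \<le> P"
    and G: "G \<in> borel_measurable (hist_space m0 k0)" and sub: "hist_index m0 k0 \<subseteq> hist_index m k"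
  shows "(\<integral>\<^sup>+h. G (restrict h (hist_index m0 k0)) \<partial>law x0 m (Suc k)) =
    (\<integral>\<^sup>+h. G (restrict h (hist_index m0 k0)) \<partial>law x0 m k)"
proof -
  let ?J = "hist_index m0 k0"
  have sub': "?J \<subseteq> hist_index m (Suc k)"
    by (rule order_trans[OF sub]) (auto simp: hist_index_def)
  have "(m, Suc k) \<notin> hist_index m k"
    by (simp add: hist_index_def)
  with sub have notin: "(m, Suc k) \<notin> ?J"
    by blast
  have "(\<integral>\<^sup>+h. G (restrict h ?J) \<partial>law x0 m (Suc k)) =
      (\<integral>\<^sup>+h. \<integral>\<^sup>+z. G (restrict (h((m, Suc k) := z)) ?J) \<partial>level_step m (Suc k) h \<partial>law x0 m k)"
    using measurable_compose[OF measurable_hist_restrict[OF sub'] G] by (rule nn_integral_law_Suc[OF m k])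
  also have "\<dots> = (\<integral>\<^sup>+h. G (restrict h ?J) \<partial>law x0 m k)"
  proof (rule nn_integral_cong)
    fix h assume "h \<in> space (law x0 m k)"
    then have "h \<in> space (hist_space m k)"
      using space_law m k by auto
    then interpret prob_space "level_step m (Suc k) h"
      using prob_space_level_step[of "Suc k" m h] m k by simp
    have "restrict (h((m, Suc k) := z)) ?J = restrict h ?J" for z
      using notin by (auto simp: restrict_def fun_eq_iff)
    then show "(\<integral>\<^sup>+z. G (restrict (h((m, Suc k) := z)) ?J) \<partial>level_step m (Suc k) h) = G (restrict h ?J)"
      by (simp add: emeasure_space_1)
  qed
  finally show ?thesis .
qed

lemma nn_integral_law_restrict':
  assumes "1 \<le> m" "k \<le> k'" "k' \<le> P"
    and "G \<in> borel_measurable (hist_space m0 k0)" "hist_index m0 k0 \<subseteq> hist_index m k"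
  shows "(\<integral>\<^sup>+h. G (restrict h (hist_index m0 k0)) \<partial>law x0 m k') =
    (\<integral>\<^sup>+h. G (restrict h (hist_index m0 k0)) \<partial>law x0 m k)"
  using assms(2,3)
proof (induction k' rule: dec_induct)
  case (step k')
  have "hist_index m k \<subseteq> hist_index m k'"
    using step.hyps by (auto simp: hist_index_def)
  with assms(5) have "hist_index m0 k0 \<subseteq> hist_index m k'"
    by (rule order_trans)
  then have "(\<integral>\<^sup>+h. G (restrict h (hist_index m0 k0)) \<partial>law x0 m (Suc k')) =
      (\<integral>\<^sup>+h. G (restrict h (hist_index m0 k0)) \<partial>law x0 m k')"
    using step.prems by (intro nn_integral_law_restrict assms(1,4))
  also have "\<dots> = (\<integral>\<^sup>+h. G (restrict h (hist_index m0 k0)) \<partial>law x0 m k)"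
    using step.prems by (intro step.IH) auto
  finally show ?case .
qed (rule refl)

lemma nn_integral_run_restrict:
  assumes "1 \<le> m" "m \<le> i" "k \<le> P" and G: "G \<in> borel_measurable (hist_space m k)"
  shows "(\<integral>\<^sup>+h. G (restrict h (hist_index m k)) \<partial>run x0 i) = (\<integral>\<^sup>+h. G h \<partial>law x0 m k)"
  using assms(2)
proof (induction i rule: dec_induct)
  case base
  have "(\<integral>\<^sup>+h. G (restrict h (hist_index m k)) \<partial>run x0 m) = (\<integral>\<^sup>+h. G (restrict h (hist_index m k)) \<partial>law x0 m k)"
    using nn_integral_law_restrict'[of m k P G m k] assms by (simp add: law_P)
  also have "\<dots> = (\<integral>\<^sup>+h. G h \<partial>law x0 m k)"
    using assms
    by (intro nn_integral_cong) (auto simp: space_law hist_space_eq space_PiM PiE_restrict)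
  finally show ?case .
next
  case (step i)
  have "hist_index m k \<subseteq> hist_index (Suc i) 0"
    using step.hyps assms by (auto simp: hist_index_def)
  then have "(\<integral>\<^sup>+h. G (restrict h (hist_index m k)) \<partial>law x0 (Suc i) P) =
      (\<integral>\<^sup>+h. G (restrict h (hist_index m k)) \<partial>law x0 (Suc i) 0)"
    using G by (intro nn_integral_law_restrict') auto
  with step.IH show ?case
    unfolding law_0 law_P[OF le_SucI[OF order_trans[OF assms(1) step.hyps(1)]]] by (rule trans[rotated])
qed

lemma measurable_past:
  assumes "1 \<le> m" "m \<le> i" "n \<in> {1..P}"
  shows "past m n \<in> run x0 i \<rightarrow>\<^sub>M hist_space m (n - 1)"
proof -
  have "hist_index m (n - 1) \<subseteq> hist_index i P"
    using assms by (auto simp: hist_index_def)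
  then show ?thesis
    unfolding past_def[abs_def] using measurable_hist_restrict
    by (simp add: measurable_cong_sets[OF sets_run refl])
qed

lemma measurable_run_component:
  assumes "m \<le> i" "n \<in> {1..P}"
  shows "(\<lambda>h. h (m, n)) \<in> run x0 i \<rightarrow>\<^sub>M E n \<Otimes>\<^sub>M E n"
proof -
  have "(m, n) \<in> hist_index i P"
    using assms by (auto simp: hist_index_def)
  then show ?thesis
    unfolding measurable_cong_sets[OF sets_run refl] by (rule measurable_hist_component)
qed

text \<open>Given the past, the component \<open>(m, n)\<close> has law \<open>level_step\<close>.
  The identity is stated under \<open>run x0 i\<close> for a final time \<open>i\<close>, so that
  sums over \<open>m\<close> live on one probability space.\<close>

lemma nn_integral_markov:
  assumes m: "1 \<le> m" "m \<le> i" and n: "n \<in> {1..P}"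
    and G: "(\<lambda>(h, z). G h z) \<in> borel_measurable (hist_space m (n - 1) \<Otimes>\<^sub>M (E n \<Otimes>\<^sub>M E n))"
  shows "(\<integral>\<^sup>+h. G (past m n h) (h (m, n)) \<partial>run x0 i) =
    (\<integral>\<^sup>+h. \<integral>\<^sup>+z. G (past m n h) z \<partial>level_step m n (past m n h) \<partial>run x0 i)"
proof -
  obtain k where k: "n = Suc k"
    using n by (cases n) auto
  let ?G' = "\<lambda>h. G (past m n h) (h (m, n))"
  have sub: "hist_index m k \<subseteq> hist_index m n"
    using k by (auto simp: hist_index_def)
  have mem: "(m, n) \<in> hist_index m n"
    using n by (auto simp: hist_index_def)
  have past_meas: "past m n \<in> hist_space m n \<rightarrow>\<^sub>M hist_space m (n - 1)"
    unfolding past_def[abs_def] using measurable_hist_restrict[OF sub] k by simp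
  have G': "?G' \<in> borel_measurable (hist_space m n)"
    using measurable_compose[OF measurable_Pair[OF past_meas measurable_hist_component[OF mem]] G] by simp
  have restr: "?G' (restrict h (hist_index m n)) = ?G' h" for h
    using mem sub k by (simp add: past_def Int_absorb1)
  have "(\<integral>\<^sup>+h. ?G' h \<partial>run x0 i) = (\<integral>\<^sup>+h. ?G' h \<partial>law x0 m n)"
    using nn_integral_run_restrict[OF m _ G'] n restr by simp
  also have "\<dots> = (\<integral>\<^sup>+h. \<integral>\<^sup>+z. ?G' (h((m, n) := z)) \<partial>level_step m n h \<partial>law x0 m k)"
    using nn_integral_law_Suc[of m k ?G'] m n G' k by simp
  also have "\<dots> = (\<integral>\<^sup>+h. \<integral>\<^sup>+z. G h z \<partial>level_step m n h \<partial>law x0 m k)"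
  proof (rule nn_integral_cong)
    fix h assume "h \<in> space (law x0 m k)"
    then have "h \<in> space (hist_space m k)"
      using space_law m n k by auto
    \<comment> \<open>An exact equality, since histories are extensional on their index set and
      \<open>(m, n)\<close> lies outside that of the past.\<close>
    then have "past m n (h((m, n) := z)) = h" for z
      using k by (auto simp: past_def hist_space_eq space_PiM restrict_def fun_eq_iff hist_index_def PiE_def extensional_def)
    then show "(\<integral>\<^sup>+z. ?G' (h((m, n) := z)) \<partial>level_step m n h) = (\<integral>\<^sup>+z. G h z \<partial>level_step m n h)"
      by simp
  qed
  also have "\<dots> = (\<integral>\<^sup>+h. \<integral>\<^sup>+z. G (past m n h) z \<partial>level_step m n (past m n h) \<partial>run x0 i)"
    using nn_integral_run_restrict[of m i k "\<lambda>h. \<integral>\<^sup>+z. G h z \<partial>level_step m n h"] m n k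
      nn_integral_measurable_subprob_algebra2[OF G measurable_prob_algebraD[OF level_step_measurable[OF n m(1)]]]
    by (simp add: past_def)
  finally show ?thesis .
qed

text \<open>The Azuma-Hoeffding argument: each increment multiplies the exponential moment by at
  most \<open>exp (s\<^sup>2 * c\<^sup>2 / 2)\<close>. A sure bound on the increments thus gives
  order \<open>sqrt j\<close> for every exponent at once.\<close>

lemma moment_le_martingale:
  fixes \<psi> :: "nat \<Rightarrow> _ \<Rightarrow> _ \<Rightarrow> real"
  assumes n: "n \<in> {1..P}" and j: "1 \<le> j" "j \<le> i" and k: "1 \<le> k" and c: "0 < c"
    and \<psi>: "\<And>m. m \<in> {1..j} \<Longrightarrow>
      (\<lambda>(h, z). \<psi> m h z) \<in> borel_measurable (hist_space m (n - 1) \<Otimes>\<^sub>M (E n \<Otimes>\<^sub>M E n))"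
    and bound: "\<And>m h z. m \<in> {1..j} \<Longrightarrow> h \<in> space (hist_space m (n - 1)) \<Longrightarrow> z \<in> space (E n \<Otimes>\<^sub>M E n)
      \<Longrightarrow> \<bar>\<psi> m h z\<bar> \<le> c"
    and centered: "\<And>m h. m \<in> {1..j} \<Longrightarrow> h \<in> space (hist_space m (n - 1)) \<Longrightarrow>
      (\<integral>z. \<psi> m h z \<partial>level_step m n h) = 0"
  shows "moment_le (run x0 i) k (\<lambda>h. \<Sum>m=1..j. \<psi> m (past m n h) (h (m, n)))
    (subgaussian_const k * (c * sqrt j))"
proof -
  define M where "M l h = (\<Sum>m=1..l. \<psi> m (past m n h) (h (m, n)))" for l h
  have summand_meas: "(\<lambda>h. \<psi> m (past m n h) (h (m, n))) \<in> borel_measurable (run x0 i)" if "m \<in> {1..j}" for m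
    using measurable_compose[OF measurable_Pair[OF measurable_past measurable_run_component] \<psi>[OF that]]
      that j n by simp
  have exp_bound: "(\<integral>\<^sup>+h. ennreal (exp (s * M l h)) \<partial>run x0 i) \<le> ennreal (exp (l * (s\<^sup>2 * c\<^sup>2 / 2)))"
    if "l \<le> j" for l and s :: real
    using that
  proof (induction l)
    case 0
    then show ?case
      using prob_space.emeasure_space_1[OF prob_space_run[of i]] by (simp add: M_def)
  next
    case (Suc l)
    let ?m = "Suc l"
    have m: "?m \<in> {1..j}" "1 \<le> ?m" "?m \<le> i"
      using Suc j by auto
    let ?G = "\<lambda>h z. ennreal (exp (s * M l h)) * ennreal (exp (s * \<psi> ?m h z))"
    \<comment> \<open>Adaptedness: the first \<open>l\<close> increments read only components from
      iterations up to \<open>l\<close>, all of which belong to the past of iteration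
      \<open>Suc l\<close>.\<close>
    have M_past: "M l (past ?m n h) = M l h" for h
    proof -
      have "hist_index m (n - 1) \<subseteq> hist_index ?m (n - 1)" if "m \<in> {1..l}" for m
        using that n by (auto simp: hist_index_def)
      then have "past m n (past ?m n h) = past m n h" if "m \<in> {1..l}" for m
        using that unfolding past_def by (simp add: Int_absorb1 Int_absorb2)
      moreover have "past ?m n h (m, n) = h (m, n)" if "m \<in> {1..l}" for m
        using that n by (auto simp: past_def hist_index_def)
      ultimately show ?thesis
        by (simp add: M_def)
    qed
    have M_meas: "M l \<in> borel_measurable (hist_space ?m (n - 1))"
      unfolding M_def
    proof (rule borel_measurable_sum)
      fix m assume mm: "m \<in> {1..l}"
      have "past m n \<in> hist_space ?m (n - 1) \<rightarrow>\<^sub>M hist_space m (n - 1)"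
        unfolding past_def[abs_def]
        using mm n by (intro measurable_hist_restrict) (auto simp: hist_index_def)
      moreover have "(\<lambda>h. h (m, n)) \<in> hist_space ?m (n - 1) \<rightarrow>\<^sub>M E n \<Otimes>\<^sub>M E n"
        using mm n by (intro measurable_hist_component) (auto simp: hist_index_def)
      ultimately show "(\<lambda>h. \<psi> m (past m n h) (h (m, n))) \<in> borel_measurable (hist_space ?m (n - 1))"
        using measurable_compose[OF measurable_Pair \<psi>[of m]] mm Suc by simp
    qed
    have G: "(\<lambda>(h, z). ?G h z) \<in> borel_measurable (hist_space ?m (n - 1) \<Otimes>\<^sub>M (E n \<Otimes>\<^sub>M E n))"
    proof -
      have [measurable]: "(\<lambda>x. \<psi> ?m (fst x) (snd x)) \<in>
          borel_measurable (hist_space ?m (n - 1) \<Otimes>\<^sub>M (E n \<Otimes>\<^sub>M E n))"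
        using \<psi>[OF m(1)] by (simp add: case_prod_beta')
      have [measurable]: "(\<lambda>x. M l (fst x)) \<in>
          borel_measurable (hist_space ?m (n - 1) \<Otimes>\<^sub>M (E n \<Otimes>\<^sub>M E n))"
        by (rule measurable_compose[OF measurable_fst M_meas])
      show ?thesis
        unfolding case_prod_beta' by measurable
    qed
    have "(\<integral>\<^sup>+h. ennreal (exp (s * M ?m h)) \<partial>run x0 i) = (\<integral>\<^sup>+h. ?G (past ?m n h) (h (?m, n)) \<partial>run x0 i)"
      unfolding M_past
      by (intro nn_integral_cong) (simp add: M_def exp_add[symmetric] ennreal_mult[symmetric] algebra_simps)
    also have "\<dots> = (\<integral>\<^sup>+h. \<integral>\<^sup>+z. ?G (past ?m n h) z \<partial>level_step ?m n (past ?m n h) \<partial>run x0 i)"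
      by (rule nn_integral_markov[OF m(2,3) n G])
    also have "\<dots> \<le> (\<integral>\<^sup>+h. ennreal (exp (s * M l h)) * ennreal (exp (s\<^sup>2 * c\<^sup>2 / 2)) \<partial>run x0 i)"
    proof (rule nn_integral_mono)
      fix h assume "h \<in> space (run x0 i)"
      then have h: "past ?m n h \<in> space (hist_space ?m (n - 1))"
        using measurable_space[OF measurable_past] m n by auto
      let ?N = "level_step ?m n (past ?m n h)"
      interpret N: prob_space ?N
        using prob_space_level_step[OF n m(2) h] .
      have setsN: "sets ?N = sets (E n \<Otimes>\<^sub>M E n)"
        by (rule sets_level_step[OF n m(2) h])
      have meas: "\<psi> ?m (past ?m n h) \<in> borel_measurable ?N"
        using measurable_compose_Pair1[OF h \<psi>[OF m(1)]] by (simp add: measurable_cong_sets[OF setsN refl])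
      have bd: "\<bar>\<psi> ?m (past ?m n h) z\<bar> \<le> c" if "z \<in> space ?N" for z
        using bound[OF m(1) h] that sets_eq_imp_space_eq[OF setsN] by simp
      have "(\<integral>\<^sup>+z. ennreal (exp (s * \<psi> ?m (past ?m n h) z)) \<partial>?N) \<le> ennreal (exp (s\<^sup>2 * c\<^sup>2 / 2))"
        using meas bd centered[OF m(1) h] by (rule N.nn_integral_exp_centered_le)
      then have "ennreal (exp (s * M l (past ?m n h))) * (\<integral>\<^sup>+z. ennreal (exp (s * \<psi> ?m (past ?m n h) z)) \<partial>?N)
          \<le> ennreal (exp (s * M l h)) * ennreal (exp (s\<^sup>2 * c\<^sup>2 / 2))"
        unfolding M_past by (intro mult_left_mono) auto
      then show "(\<integral>\<^sup>+z. ?G (past ?m n h) z \<partial>?N) \<le> ennreal (exp (s * M l h)) * ennreal (exp (s\<^sup>2 * c\<^sup>2 / 2))"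
        using meas by (subst nn_integral_cmult) auto
    qed
    also have "\<dots> = (\<integral>\<^sup>+h. ennreal (exp (s * M l h)) \<partial>run x0 i) * ennreal (exp (s\<^sup>2 * c\<^sup>2 / 2))"
    proof (rule nn_integral_multc)
      have "M l \<in> borel_measurable (run x0 i)"
        unfolding M_def using Suc by (intro borel_measurable_sum summand_meas) auto
      then show "(\<lambda>h. ennreal (exp (s * M l h))) \<in> borel_measurable (run x0 i)"
        by measurable
    qed
    also have "\<dots> \<le> ennreal (exp (l * (s\<^sup>2 * c\<^sup>2 / 2))) * ennreal (exp (s\<^sup>2 * c\<^sup>2 / 2))"
      using Suc by (intro mult_right_mono) auto
    also have "\<dots> = ennreal (exp (?m * (s\<^sup>2 * c\<^sup>2 / 2)))"
      by (simp add: ennreal_mult[symmetric] exp_add[symmetric] algebra_simps)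
    finally show ?case .
  qed
  have "moment_le (run x0 i) k (M j) (subgaussian_const k * (c * sqrt j))"
  proof (rule moment_le_of_exp)
    show "M j \<in> borel_measurable (run x0 i)"
      unfolding M_def by (intro borel_measurable_sum summand_meas) auto
    \<comment> \<open>With \<open>s\<close> equal to plus or minus \<open>1 / (c * sqrt j)\<close>
      the exponent becomes the \<open>1 / 2\<close> that \<open>moment_le_of_exp\<close>
      expects.\<close>
    have "j * ((1 / (c * sqrt j))\<^sup>2 * c\<^sup>2 / 2) = 1 / 2" "j * ((- 1 / (c * sqrt j))\<^sup>2 * c\<^sup>2 / 2) = 1 / 2"
      using c j by (auto simp: power_divide power_mult_distrib)
    then show "(\<integral>\<^sup>+h. ennreal (exp (M j h / (c * sqrt j))) \<partial>run x0 i) \<le> ennreal (exp (1 / 2))"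
      "(\<integral>\<^sup>+h. ennreal (exp (- M j h / (c * sqrt j))) \<partial>run x0 i) \<le> ennreal (exp (1 / 2))"
      using exp_bound[of j "1 / (c * sqrt j)"] exp_bound[of j "- 1 / (c * sqrt j)"] by auto
  qed (use c j k in auto)
  then show ?thesis
    by (simp add: M_def[abs_def])
qed

end

section \<open>Bounded weights\<close>

text \<open>Pushing \<open>K x\<close> to the product space by \<open>y \<mapsto> (x, y)\<close>
  moves the parameter from the integrand into the measure.\<close>

lemma integral_measurable_subprob_algebra2:
  fixes f :: "'a \<Rightarrow> 'b \<Rightarrow> real"
  assumes f: "(\<lambda>(x, y). f x y) \<in> borel_measurable (M \<Otimes>\<^sub>M N)"
    and K: "K \<in> M \<rightarrow>\<^sub>M subprob_algebra N"
  shows "(\<lambda>x. \<integral>y. f x y \<partial>K x) \<in> borel_measurable M"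
proof -
  have "(\<lambda>x. distr (K x) (M \<Otimes>\<^sub>M N) (\<lambda>y. (x, y))) \<in> M \<rightarrow>\<^sub>M subprob_algebra (M \<Otimes>\<^sub>M N)"
    by (rule measurable_distr2[OF _ K]) simp
  from measurable_compose[OF this integral_measurable_subprob_algebra[OF f]]
  have "(\<lambda>x. \<integral>z. (case z of (x, y) \<Rightarrow> f x y) \<partial>distr (K x) (M \<Otimes>\<^sub>M N) (\<lambda>y. (x, y))) \<in> borel_measurable M" .
  moreover have "(\<integral>z. (case z of (x, y) \<Rightarrow> f x y) \<partial>distr (K x) (M \<Otimes>\<^sub>M N) (\<lambda>y. (x, y))) = (\<integral>y. f x y \<partial>K x)"
    if x: "x \<in> space M" for x
  proof -
    have "sets (K x) = sets N"
      using measurable_space[OF K x] by (simp add: space_subprob_algebra)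
    then have "(\<lambda>y. (x, y)) \<in> K x \<rightarrow>\<^sub>M M \<Otimes>\<^sub>M N"
      using x by (simp add: measurable_cong_sets[of "K x" N, OF _ refl])
    then show ?thesis
      by (subst integral_distr[OF _ f]) auto
  qed
  ultimately show ?thesis
    by (subst measurable_cong) auto
qed

locale simcmc_bounded = simcmc P F L \<gamma> q1 q
  for P :: nat
    and F :: "'a measure"
    and L :: "nat \<Rightarrow> 'a measure"
    and \<gamma> :: "nat \<Rightarrow> (nat \<Rightarrow> 'a) \<Rightarrow> real"
    and q1 :: "'a \<Rightarrow> real"
    and q :: "nat \<Rightarrow> (nat \<Rightarrow> 'a) \<Rightarrow> 'a \<Rightarrow> real" +
  fixes B :: "nat \<Rightarrow> real"
  assumes weight_le: "n \<in> {1..P} \<Longrightarrow> x \<in> S n \<Longrightarrow> weight n x \<le> ennreal (B n)"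
begin

definition w :: "nat \<Rightarrow> (nat \<Rightarrow> 'a) \<Rightarrow> real" where
  "w n x = enn2real (weight n x)"

definition weight_denom :: "nat \<Rightarrow> (nat \<Rightarrow> 'a) \<Rightarrow> real" where
  "weight_denom n x = (if n = 1 then q1 (x 1)
     else \<gamma> (n - 1) (restrict x {1..n - 1}) * q n (restrict x {1..n - 1}) (x n))"

lemma weight_eq_denom: "weight n x = ennreal (\<gamma> n x) / ennreal (weight_denom n x)"
  by (simp add: weight_def weight_denom_def Let_def)

lemma weight_denom_nonneg:
  assumes n: "n \<in> {1..P}" and x: "x \<in> space (E n)"
  shows "0 \<le> weight_denom n x"
proof (cases "n = 1")
  case True
  then show ?thesis
    using q1_nonneg measurable_space[OF measurable_E_last x] by (auto simp: weight_denom_def)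
next
  case False
  then have "n \<in> {2..P}" "n - 1 \<in> {1..P}" "1 \<le> n"
    using n by auto
  then show ?thesis
    using False \<gamma>_nonneg[of "n - 1"] q_nonneg[of n] measurable_space[OF measurable_E_restrict x]
      measurable_space[OF measurable_E_last[of n] x]
    by (simp add: weight_denom_def)
qed

lemma S_iff: "n \<in> {1..P} \<Longrightarrow> x \<in> space (E n) \<Longrightarrow> x \<in> S n \<longleftrightarrow> 0 < \<gamma> n x"
  using Z_pos[of n] by (simp add: S_def target_density_def zero_less_divide_iff)

text \<open>A zero denominator at a point of \<open>S n\<close> would make the weight infinite. The
  bound on the weights thus contains the domination of each target by its proposal.\<close>

lemma weight_denom_pos:
  assumes n: "n \<in> {1..P}" and x: "x \<in> S n"
  shows "0 < weight_denom n x"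
proof (rule ccontr)
  assume "\<not> 0 < weight_denom n x"
  then have "ennreal (weight_denom n x) = 0"
    by (simp add: ennreal_neg)
  moreover have "0 < \<gamma> n x"
    using x S_iff[OF n] by (auto simp: S_def)
  ultimately have "weight n x = \<top>"
    by (simp add: weight_eq_denom ennreal_divide_eq_top_iff)
  then show False
    using weight_le[OF n x] by (simp add: top_unique)
qed

lemma \<gamma>_eq_0: "n \<in> {1..P} \<Longrightarrow> x \<in> space (E n) \<Longrightarrow> x \<notin> S n \<Longrightarrow> \<gamma> n x = 0"
  using S_iff[of n x] \<gamma>_nonneg[of n x] by auto

lemma weight_eq:
  assumes n: "n \<in> {1..P}" and x: "x \<in> space (E n)"
  shows "weight n x = ennreal (\<gamma> n x / weight_denom n x)"
proof (cases "x \<in> S n")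
  case True
  then show ?thesis
    using weight_denom_pos[OF n True] \<gamma>_nonneg[OF n x] by (simp add: weight_eq_denom divide_ennreal)
next
  case False
  then show ?thesis
    using \<gamma>_eq_0[OF n x] by (simp add: weight_eq_denom)
qed

lemma w_eq:
  assumes n: "n \<in> {1..P}" and x: "x \<in> space (E n)"
  shows "w n x = \<gamma> n x / weight_denom n x"
  using weight_eq[OF assms] \<gamma>_nonneg[OF assms] weight_denom_nonneg[OF assms] by (simp add: w_def)

lemma weight_eq_w:
  assumes n: "n \<in> {1..P}" and x: "x \<in> space (E n)"
  shows "weight n x = ennreal (w n x)"
  using weight_eq[OF assms] w_eq[OF assms] by simp

lemma w_mult_denom:
  assumes n: "n \<in> {1..P}" and x: "x \<in> space (E n)"
  shows "w n x * weight_denom n x = \<gamma> n x"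
proof (cases "x \<in> S n")
  case True
  then show ?thesis
    using weight_denom_pos[OF n True] w_eq[OF assms] by simp
next
  case False
  then show ?thesis
    using \<gamma>_eq_0[OF n x] w_eq[OF assms] by simp
qed

lemma w_nonneg: "0 \<le> w n x"
  by (simp add: w_def)

lemma w_measurable: "n \<in> {1..P} \<Longrightarrow> w n \<in> borel_measurable (E n)"
  unfolding w_def[abs_def] using weight_measurable by measurable

text \<open>\<open>Z n > 0\<close> forces \<open>S n\<close> to be nonempty, and at any of its
  points a positive weight lies below \<open>ennreal (B n)\<close>.\<close>

lemma B_pos:
  assumes n: "n \<in> {1..P}"
  shows "0 < B n"
proof -
  have "\<exists>x. x \<in> S n"
  proof (rule ccontr)
    assume "\<nexists>x. x \<in> S n"
    then have "(\<integral>x. \<gamma> n x \<partial>E n) = (\<integral>x. 0 \<partial>E n)"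
      using \<gamma>_eq_0[OF n] by (intro Bochner_Integration.integral_cong) auto
    then show False
      using Z_pos[OF n] by (simp add: Z_def)
  qed
  then obtain x where x: "x \<in> S n" ..
  then have "x \<in> space (E n)" "0 < \<gamma> n x"
    using S_iff[OF n] by (auto simp: S_def)
  then have pos: "0 < \<gamma> n x / weight_denom n x" and "ennreal (\<gamma> n x / weight_denom n x) \<le> ennreal (B n)"
    using weight_le[OF n x] weight_eq[OF n, of x] weight_denom_pos[OF n x] by auto
  then show ?thesis
    using ennreal_less_zero_iff[of "\<gamma> n x / weight_denom n x"] ennreal_less_zero_iff[of "B n"]
    by (metis less_le_trans)
qed

lemma w_le:
  assumes n: "n \<in> {1..P}" and x: "x \<in> space (E n)"
  shows "w n x \<le> B n"
proof (cases "x \<in> S n")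
  case True
  then show ?thesis
    using weight_le[OF n True] weight_eq_w[OF assms] B_pos[OF n] by simp
next
  case False
  then show ?thesis
    using \<gamma>_eq_0[OF n x] w_eq[OF assms] B_pos[OF n] by simp
qed

lemma accept_prob_eq:
  assumes n: "n \<in> {1..P}" and x: "x \<in> space (E n)" and y: "y \<in> space (E n)"
  shows "accept_prob n x y = (if w n x = 0 then if w n y = 0 then 0 else 1 else min 1 (w n y / w n x))"
proof (cases "w n x = 0")
  case True
  then show ?thesis
    using w_nonneg[of n y] weight_eq_w[OF n x] weight_eq_w[OF n y]
    by (auto simp: accept_prob_def ennreal_divide_eq_top_iff ennreal_top_divide divide_ennreal_def)
next
  case False
  then have "weight n y / weight n x = ennreal (w n y / w n x)"
    using w_nonneg[of n x] w_nonneg[of n y] weight_eq_w[OF n x] weight_eq_w[OF n y]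
    by (simp add: divide_ennreal less_le)
  then have "min 1 (weight n y / weight n x) = ennreal (min 1 (w n y / w n x))"
    using w_nonneg[of n x] w_nonneg[of n y] by (simp add: min_def flip: ennreal_1)
  then show ?thesis
    using False w_nonneg[of n x] w_nonneg[of n y] by (simp add: accept_prob_def)
qed

text \<open>
  Points of weight \<open>0\<close> (those off \<open>S n\<close>) need no exclusion: by the conventions \<open>a / 0 = \<infinity>\<close> and
  \<open>0 / 0 = 0\<close>, detailed balance and the minorization hold at them as well. Hence the initial state
  only has to lie in \<open>space (E n)\<close>.
\<close>

lemma imh_level:
  assumes n: "n \<in> {1..P}" and \<nu>: "prob_space \<nu>" "sets \<nu> = sets (E n)" and pos: "0 < (\<integral>x. w n x \<partial>\<nu>)"
  shows "imh \<nu> (w n) (accept_prob n) (B n)"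
proof -
  have sp: "space \<nu> = space (E n)"
    using \<nu>(2) by (rule sets_eq_imp_space_eq)
  have pair: "sets (\<nu> \<Otimes>\<^sub>M \<nu>) = sets (E n \<Otimes>\<^sub>M E n)"
    using \<nu>(2) by (intro sets_pair_measure_cong)
  show ?thesis
  proof (intro imh.intro imh_axioms.intro \<nu>(1) pos w_nonneg accept_prob_bounds)
    show "w n \<in> borel_measurable \<nu>"
      using w_measurable[OF n] by (simp add: measurable_cong_sets[OF \<nu>(2) refl])
    show "(\<lambda>(x, y). accept_prob n x y) \<in> borel_measurable (\<nu> \<Otimes>\<^sub>M \<nu>)"
      using accept_prob_measurable[OF n] by (simp add: measurable_cong_sets[OF pair refl])
    fix x assume "x \<in> space \<nu>"
    then have x: "x \<in> space (E n)"
      by (simp add: sp)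
    show "w n x \<le> B n"
      by (rule w_le[OF n x])
    fix y assume "y \<in> space \<nu>"
    then have y: "y \<in> space (E n)"
      by (simp add: sp)
    note bounds = w_nonneg[of n x] w_nonneg[of n y] w_le[OF n x] w_le[OF n y]
    show "w n x * accept_prob n x y = min (w n x) (w n y)"
    proof (cases "w n x = 0")
      case True
      then show ?thesis
        using bounds by simp
    next
      case False
      then show ?thesis
        using bounds by (simp add: accept_prob_eq[OF n x y] min_mult_distrib_left)
    qed
    show "w n y \<le> B n * accept_prob n x y"
    proof (cases "w n x = 0")
      case True
      then show ?thesis
        using bounds by (simp add: accept_prob_eq[OF n x y])
    next
      case False
      then have "w n y = w n x * (w n y / w n x)"
        by simp
      also have "\<dots> \<le> B n * (w n y / w n x)"
        using bounds by (intro mult_right_mono) auto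
      finally have "w n y \<le> min (B n) (B n * (w n y / w n x))"
        using bounds by simp
      also have "\<dots> = B n * min 1 (w n y / w n x)"
        using B_pos[OF n] by (simp add: min_mult_distrib_left)
      finally show ?thesis
        using False by (simp add: accept_prob_eq[OF n x y])
    qed
  qed
qed

section \<open>The limiting proposal as an importance distribution\<close>

definition target :: "nat \<Rightarrow> (nat \<Rightarrow> 'a) measure" where
  "target n = density (E n) (\<lambda>x. ennreal (\<gamma> n x / Z n))"

text \<open>The convention that the normalizer before level \<open>1\<close> is \<open>1\<close>
  merges the two cases of the theorem: \<open>ratio 1\<close> is \<open>Z 1\<close>.\<close>

definition Z_prev :: "nat \<Rightarrow> real" where
  "Z_prev n = (if n = 1 then 1 else Z (n - 1))"

definition limit_proposal :: "nat \<Rightarrow> (nat \<Rightarrow> 'a) measure" where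
  "limit_proposal n = (if n = 1 then proposal1 else target (n - 1) \<bind> kern n)"

lemma Z_prev_pos:
  assumes "n \<in> {1..P}"
  shows "0 < Z_prev n"
proof (cases "n = 1")
  case False
  then have "n - 1 \<in> {1..P}"
    using assms by auto
  then show ?thesis
    using False Z_pos by (simp add: Z_prev_def)
qed (simp add: Z_prev_def)

lemma sets_target [measurable_cong]: "sets (target n) = sets (E n)"
  by (simp add: target_def)

lemma prob_space_target:
  assumes n: "n \<in> {1..P}"
  shows "prob_space (target n)"
proof (rule prob_spaceI)
  have [measurable]: "\<gamma> n \<in> borel_measurable (E n)"
    by (rule \<gamma>_measurable[OF n])
  have "emeasure (target n) (space (target n)) = (\<integral>\<^sup>+x. ennreal (\<gamma> n x / Z n) \<partial>E n)"
    by (auto simp: target_def emeasure_density intro!: nn_integral_cong)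
  also have "\<dots> = ennreal (\<integral>x. \<gamma> n x / Z n \<partial>E n)"
    using \<gamma>_integrable[OF n] \<gamma>_nonneg[OF n] Z_pos[OF n]
    by (intro nn_integral_eq_integral) (auto intro!: AE_I2)
  also have "\<dots> = 1"
    using Z_pos[OF n] by (simp add: Z_def)
  finally show "emeasure (target n) (space (target n)) = 1" .
qed

lemma limit_proposal_in_prob_algebra:
  assumes n: "n \<in> {1..P}"
  shows "limit_proposal n \<in> space (prob_algebra (E n))"
proof (cases "n = 1")
  case True
  then show ?thesis
    by (simp add: limit_proposal_def space_prob_algebra prob_space_proposal1 sets_proposal1)
next
  case False
  then have "n \<in> {2..P}" "n - 1 \<in> {1..P}"
    using n by auto
  then show ?thesis
    using False bind_in_prob_algebra[OF _ kern_measurable, of "target (n - 1)" n]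
    by (simp add: limit_proposal_def space_prob_algebra prob_space_target sets_target)
qed

text \<open>The limiting proposal has density \<open>weight_denom n / Z_prev n\<close> with respect
  to \<open>E n\<close>, and multiplying by the weight leaves \<open>\<gamma> n / Z_prev n\<close>.
  By \<open>w_mult_denom\<close> this includes points where the denominator vanishes.\<close>

lemma nn_integral_limit_proposal:
  assumes n: "n \<in> {1..P}" and G: "G \<in> borel_measurable (E n)"
  shows "(\<integral>\<^sup>+x. ennreal (w n x) * G x \<partial>limit_proposal n) = (\<integral>\<^sup>+x. ennreal (\<gamma> n x / Z_prev n) * G x \<partial>E n)"
proof -
  \<comment> \<open>\<open>product_sigma_finite\<close> requires a \<open>\<sigma>\<close>-finite measure at every index, also beyond \<open>P\<close>\<close>
  define L' where "L' j = (if j \<in> {1..P} then L j else count_space {undefined})" for j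
  interpret L': product_sigma_finite L'
  proof (rule product_sigma_finite.intro)
    show "sigma_finite_measure (L' j)" for j
      using sigma_finite_L[of j] sigma_finite_measure_count_space_finite[of "{undefined}"]
      by (cases "j \<in> {1..P}") (simp_all add: L'_def)
  qed
  have E_L': "E j = PiM {1..j} L'" if "j \<le> P" for j
    unfolding E_def using that by (intro PiM_cong) (auto simp: L'_def)
  have wG: "(\<lambda>x. ennreal (w n x) * G x) \<in> borel_measurable (E n)"
    using w_measurable[OF n] G by measurable
  have \<gamma>G: "(\<lambda>x. ennreal (\<gamma> n x / Z_prev n) * G x) \<in> borel_measurable (E n)"
    using \<gamma>_measurable[OF n] G by measurable
  have w_denom: "ennreal (weight_denom n x / Z_prev n) * (ennreal (w n x) * G x) = ennreal (\<gamma> n x / Z_prev n) * G x"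
    if "x \<in> space (E n)" for x
  proof -
    have "ennreal (weight_denom n x / Z_prev n) * ennreal (w n x) = ennreal (weight_denom n x / Z_prev n * w n x)"
      using w_nonneg[of n x] weight_denom_nonneg[OF n that] Z_prev_pos[OF n] by (intro ennreal_mult[symmetric]) auto
    also have "weight_denom n x / Z_prev n * w n x = \<gamma> n x / Z_prev n"
      using w_mult_denom[OF n that] by (simp add: mult.commute)
    finally show ?thesis
      by (simp add: mult.assoc[symmetric])
  qed
  show ?thesis
  proof (cases "n = 1")
    case True
    let ?pt = "\<lambda>a. \<lambda>j\<in>{1::nat}. a"
    note [measurable] = q1_measurable measurable_singleton_point
    have meas: "(\<lambda>a. ennreal (w 1 (?pt a)) * G (?pt a)) \<in> borel_measurable (L 1)"
      "(\<lambda>a. ennreal (\<gamma> 1 (?pt a) / Z_prev 1) * G (?pt a)) \<in> borel_measurable (L 1)"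
      using measurable_compose[OF measurable_singleton_point] wG \<gamma>G True by auto
    have "(\<integral>\<^sup>+x. ennreal (w 1 x) * G x \<partial>proposal1)
        = (\<integral>\<^sup>+a. ennreal (w 1 (?pt a)) * G (?pt a) \<partial>density (L 1) (\<lambda>a. ennreal (q1 a)))"
      unfolding proposal1_def using wG measurable_singleton_point True by (subst nn_integral_distr) auto
    also have "\<dots> = (\<integral>\<^sup>+a. ennreal (q1 a) * (ennreal (w 1 (?pt a)) * G (?pt a)) \<partial>L 1)"
      using meas q1_measurable by (intro nn_integral_density) auto
    also have "\<dots> = (\<integral>\<^sup>+a. ennreal (\<gamma> 1 (?pt a) / Z_prev 1) * G (?pt a) \<partial>L 1)"
    proof (rule nn_integral_cong)
      fix a assume "a \<in> space (L 1)"
      then have "?pt a \<in> space (E 1)"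
        by (rule measurable_space[OF measurable_singleton_point])
      then show "ennreal (q1 a) * (ennreal (w 1 (?pt a)) * G (?pt a)) = ennreal (\<gamma> 1 (?pt a) / Z_prev 1) * G (?pt a)"
        using w_denom[of "?pt a"] True by (simp add: weight_denom_def Z_prev_def)
    qed
    also have "\<dots> = (\<integral>\<^sup>+x. ennreal (\<gamma> 1 (?pt (x 1)) / Z_prev 1) * G (?pt (x 1)) \<partial>PiM {1} L')"
      using meas P_ge_1 by (subst L'.product_nn_integral_singleton) (auto simp: L'_def)
    also have "\<dots> = (\<integral>\<^sup>+x. ennreal (\<gamma> 1 x / Z_prev 1) * G x \<partial>PiM {1} L')"
    proof (rule nn_integral_cong)
      fix x assume "x \<in> space (PiM {1} L')"
      then have "?pt (x 1) = x"
        by (auto simp: space_PiM PiE_def extensional_def restrict_def fun_eq_iff)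
      then show "ennreal (\<gamma> 1 (?pt (x 1)) / Z_prev 1) * G (?pt (x 1)) = ennreal (\<gamma> 1 x / Z_prev 1) * G x"
        by simp
    qed
    finally show ?thesis
      using True P_ge_1 E_L'[of 1] by (simp add: limit_proposal_def)
  next
    case False
    then have n2: "n \<in> {2..P}" "n - 1 \<in> {1..P}" "1 \<le> n"
      using n by auto
    let ?G = "\<lambda>x. ennreal (w n x) * G x"
    note [measurable] = wG \<gamma>_measurable[OF n2(2)]
    have sets_t: "kern n \<in> target (n - 1) \<rightarrow>\<^sub>M subprob_algebra (E n)"
      using measurable_prob_algebraD[OF kern_measurable[OF n2(1)]]
      by (simp add: measurable_cong_sets[OF sets_target refl])
    have kern_meas: "(\<lambda>x. \<integral>\<^sup>+y. ?G y \<partial>kern n x) \<in> borel_measurable (E (n - 1))"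
      by (rule measurable_compose[OF measurable_prob_algebraD[OF kern_measurable[OF n2(1)]]
            nn_integral_measurable_subprob_algebra[OF wG]])
    have upd: "(\<lambda>a. x(n := a)) \<in> L n \<rightarrow>\<^sub>M E n" if "x \<in> space (E (n - 1))" for x
      using measurable_compose_Pair1[OF that measurable_E_extend[OF n2(3)]] by simp
    have q_x: "q n x \<in> borel_measurable (L n)" if "x \<in> space (E (n - 1))" for x
      using measurable_compose_Pair1[OF that q_measurable[OF n2(1)]] by simp
    have kern: "(\<integral>\<^sup>+y. ?G y \<partial>kern n x) = (\<integral>\<^sup>+a. ennreal (q n x a) * ?G (x(n := a)) \<partial>L n)"
      if x: "x \<in> space (E (n - 1))" for x
    proof -
      have "(\<integral>\<^sup>+y. ?G y \<partial>kern n x) = (\<integral>\<^sup>+a. ?G (x(n := a)) \<partial>density (L n) (\<lambda>a. ennreal (q n x a)))"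
        unfolding kern_def using upd[OF x] by (intro nn_integral_distr) auto
      also have "\<dots> = (\<integral>\<^sup>+a. ennreal (q n x a) * ?G (x(n := a)) \<partial>L n)"
        using q_x[OF x] measurable_compose[OF upd[OF x] wG] by (intro nn_integral_density) auto
      finally show ?thesis .
    qed
    have "(\<integral>\<^sup>+x. ?G x \<partial>limit_proposal n) = (\<integral>\<^sup>+x. \<integral>\<^sup>+y. ?G y \<partial>kern n x \<partial>target (n - 1))"
      using False nn_integral_bind[OF wG sets_t] by (simp add: limit_proposal_def)
    also have "\<dots> = (\<integral>\<^sup>+x. ennreal (\<gamma> (n - 1) x / Z (n - 1)) * (\<integral>\<^sup>+y. ?G y \<partial>kern n x) \<partial>E (n - 1))"
      unfolding target_def using kern_meas \<gamma>_measurable[OF n2(2)] by (intro nn_integral_density) auto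
    also have "\<dots> = (\<integral>\<^sup>+x. \<integral>\<^sup>+a. ennreal (\<gamma> n (x(n := a)) / Z_prev n) * G (x(n := a)) \<partial>L n \<partial>E (n - 1))"
    proof (rule nn_integral_cong)
      fix x assume x: "x \<in> space (E (n - 1))"
      have "ennreal (\<gamma> (n - 1) x / Z (n - 1)) * (\<integral>\<^sup>+y. ?G y \<partial>kern n x)
          = (\<integral>\<^sup>+a. ennreal (\<gamma> (n - 1) x / Z (n - 1)) * (ennreal (q n x a) * ?G (x(n := a))) \<partial>L n)"
        unfolding kern[OF x] using q_x[OF x] measurable_compose[OF upd[OF x] wG]
        by (intro nn_integral_cmult[symmetric]) auto
      also have "\<dots> = (\<integral>\<^sup>+a. ennreal (\<gamma> n (x(n := a)) / Z_prev n) * G (x(n := a)) \<partial>L n)"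
      proof (rule nn_integral_cong)
        fix a assume a: "a \<in> space (L n)"
        let ?y = "x(n := a)"
        have y: "?y \<in> space (E n)"
          using measurable_space[OF upd[OF x] a] .
        have "restrict ?y {1..n - 1} = x"
          using x n2(3) by (auto simp: E_def space_PiM PiE_def extensional_def restrict_def fun_eq_iff)
        then have "weight_denom n ?y = \<gamma> (n - 1) x * q n x a"
          using False by (simp add: weight_denom_def)
        then have "ennreal (weight_denom n ?y / Z_prev n) = ennreal (\<gamma> (n - 1) x / Z (n - 1)) * ennreal (q n x a)"
          using False \<gamma>_nonneg[OF n2(2) x] q_nonneg[OF n2(1) x a] Z_pos[OF n2(2)]
          by (simp add: Z_prev_def ennreal_mult[symmetric])
        then show "ennreal (\<gamma> (n - 1) x / Z (n - 1)) * (ennreal (q n x a) * ?G ?y)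
            = ennreal (\<gamma> n ?y / Z_prev n) * G ?y"
          using w_denom[OF y] by (simp add: mult.assoc)
      qed
      finally show "ennreal (\<gamma> (n - 1) x / Z (n - 1)) * (\<integral>\<^sup>+y. ?G y \<partial>kern n x)
          = (\<integral>\<^sup>+a. ennreal (\<gamma> n (x(n := a)) / Z_prev n) * G (x(n := a)) \<partial>L n)" .
    qed
    also have "\<dots> = (\<integral>\<^sup>+x. \<integral>\<^sup>+a. ennreal (\<gamma> n (x(n := a)) / Z_prev n) * G (x(n := a)) \<partial>L' n \<partial>PiM {1..n - 1} L')"
    proof -
      have "E (n - 1) = PiM {1..n - 1} L'"
        using n by (intro E_L') auto
      then show ?thesis
        using n by (simp add: L'_def)
    qed
    also have "\<dots> = (\<integral>\<^sup>+x. ennreal (\<gamma> n x / Z_prev n) * G x \<partial>PiM (insert n {1..n - 1}) L')"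
    proof (rule L'.product_nn_integral_insert[symmetric])
      have "insert n {1..n - 1} = {1..n}"
        using n2 by auto
      then show "(\<lambda>x. ennreal (\<gamma> n x / Z_prev n) * G x) \<in> borel_measurable (PiM (insert n {1..n - 1}) L')"
        using \<gamma>G E_L'[of n] n by simp
    qed (use n2 in auto)
    also have "insert n {1..n - 1} = {1..n}"
      using n2 by auto
    finally show ?thesis
      using E_L'[of n] n by simp
  qed
qed

text \<open>As an equality of measures, the identity carries over to Bochner integrals of signed
  functions without an integrability condition.\<close>

lemma density_limit_proposal:
  assumes n: "n \<in> {1..P}"
  shows "density (limit_proposal n) (\<lambda>x. ennreal (w n x)) = density (E n) (\<lambda>x. ennreal (\<gamma> n x / Z_prev n))"
proof (rule measure_eqI)
  have sets_l: "sets (limit_proposal n) = sets (E n)"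
    using limit_proposal_in_prob_algebra[OF n] by (simp add: space_prob_algebra)
  then show "sets (density (limit_proposal n) (\<lambda>x. ennreal (w n x))) =
      sets (density (E n) (\<lambda>x. ennreal (\<gamma> n x / Z_prev n)))"
    by simp
  fix A assume "A \<in> sets (density (limit_proposal n) (\<lambda>x. ennreal (w n x)))"
  then have A: "A \<in> sets (E n)"
    by (simp add: sets_l)
  have "w n \<in> borel_measurable (limit_proposal n)"
    using w_measurable[OF n] by (simp add: measurable_cong_sets[OF sets_l refl])
  then show "emeasure (density (limit_proposal n) (\<lambda>x. ennreal (w n x))) A =
      emeasure (density (E n) (\<lambda>x. ennreal (\<gamma> n x / Z_prev n))) A"
    using A sets_l \<gamma>_measurable[OF n] nn_integral_limit_proposal[OF n, of "indicator A"]
    by (simp add: emeasure_density)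
qed

definition ratio :: "nat \<Rightarrow> real" where
  "ratio n = Z n / Z_prev n"

lemma ratio_pos: "n \<in> {1..P} \<Longrightarrow> 0 < ratio n"
  using Z_pos Z_prev_pos by (simp add: ratio_def)

text \<open>Divided by its instance for the constant \<open>1\<close>, this says that the limiting
  kernel of level \<open>n\<close> has invariant law \<open>target n\<close>.\<close>

lemma integral_w_limit_proposal:
  fixes \<phi> :: "_ \<Rightarrow> real"
  assumes n: "n \<in> {1..P}" and \<phi>: "\<phi> \<in> borel_measurable (E n)"
  shows "(\<integral>x. w n x * \<phi> x \<partial>limit_proposal n) = ratio n * (\<integral>x. \<phi> x \<partial>target n)"
proof -
  have sets_l: "sets (limit_proposal n) = sets (E n)"
    using limit_proposal_in_prob_algebra[OF n] by (simp add: space_prob_algebra)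
  have "w n \<in> borel_measurable (limit_proposal n)" "\<phi> \<in> borel_measurable (limit_proposal n)"
    using w_measurable[OF n] \<phi> by (simp_all add: measurable_cong_sets[OF sets_l refl])
  then have "(\<integral>x. w n x * \<phi> x \<partial>limit_proposal n) = (\<integral>x. \<phi> x \<partial>density (limit_proposal n) (\<lambda>x. ennreal (w n x)))"
    using w_nonneg by (subst integral_density) auto
  also have "\<dots> = (\<integral>x. \<gamma> n x / Z_prev n * \<phi> x \<partial>E n)"
    unfolding density_limit_proposal[OF n]
    using \<gamma>_measurable[OF n] \<gamma>_nonneg[OF n] Z_prev_pos[OF n] \<phi>
    by (subst integral_density) (auto intro!: AE_I2)
  also have "\<dots> = (\<integral>x. Z n / Z_prev n * (\<gamma> n x / Z n * \<phi> x) \<partial>E n)"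
    using Z_pos[OF n] by (intro Bochner_Integration.integral_cong) auto
  also have "\<dots> = Z n / Z_prev n * (\<integral>x. \<gamma> n x / Z n * \<phi> x \<partial>E n)"
    by simp
  also have "(\<integral>x. \<gamma> n x / Z n * \<phi> x \<partial>E n) = (\<integral>x. \<phi> x \<partial>target n)"
    unfolding target_def
    using \<gamma>_measurable[OF n] \<gamma>_nonneg[OF n] Z_pos[OF n] \<phi>
    by (subst integral_density) (auto intro!: AE_I2)
  finally show ?thesis
    by (simp add: ratio_def)
qed

lemma integral_w_limit:
  assumes n: "n \<in> {1..P}"
  shows "(\<integral>x. w n x \<partial>limit_proposal n) = ratio n"
  using integral_w_limit_proposal[OF n, of "\<lambda>_. 1"] prob_space.prob_space[OF prob_space_target[OF n]] by simp

end

section \<open>The Poisson equation along a run\<close>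

context simcmc_bounded
begin

lemma integral_kern_measurable:
  fixes \<phi> :: "_ \<Rightarrow> real"
  assumes n: "n \<in> {2..P}" and \<phi>: "\<phi> \<in> borel_measurable (E n)"
  shows "(\<lambda>x. \<integral>y. \<phi> y \<partial>kern n x) \<in> borel_measurable (E (n - 1))"
  by (rule measurable_compose[OF measurable_prob_algebraD[OF kern_measurable[OF n]]
        integral_measurable_subprob_algebra[OF \<phi>]])

lemma abs_integral_kern_le:
  fixes \<phi> :: "_ \<Rightarrow> real"
  assumes n: "n \<in> {2..P}" and \<phi>: "\<phi> \<in> borel_measurable (E n)" "\<And>x. x \<in> space (E n) \<Longrightarrow> \<bar>\<phi> x\<bar> \<le> c"
    and x: "x \<in> space (E (n - 1))"
  shows "\<bar>\<integral>y. \<phi> y \<partial>kern n x\<bar> \<le> c"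
proof -
  have k: "prob_space (kern n x)" "sets (kern n x) = sets (E n)"
    using measurable_space[OF kern_measurable[OF n] x] by (auto simp: space_prob_algebra)
  show ?thesis
    using \<phi> sets_eq_imp_space_eq[OF k(2)]
    by (intro prob_space.abs_integral_le k(1)) (auto simp: measurable_cong_sets[OF k(2) refl])
qed

text \<open>The link between neighbouring levels: testing the proposal of level \<open>n\<close>
  amounts to averaging a function over the \<open>Suc i\<close> states of level
  \<open>n - 1\<close>, the initial one included.\<close>

lemma integral_proposal:
  fixes \<phi> :: "_ \<Rightarrow> real"
  assumes n: "n \<in> {2..P}" and h: "h \<in> space (hist_space i (n - 1))"
    and \<phi>: "\<phi> \<in> borel_measurable (E n)" "\<And>x. x \<in> space (E n) \<Longrightarrow> \<bar>\<phi> x\<bar> \<le> c"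
  shows "(\<integral>x. \<phi> x \<partial>proposal i n h) = (\<Sum>l\<le>i. \<integral>x. \<phi> x \<partial>kern n (snd (h (l, n - 1)))) / real (Suc i)"
proof -
  have idx: "(l, n - 1) \<in> hist_index i (n - 1)" if "l \<le> i" for l
    using n that by (auto simp: hist_index_def)
  have emp: "prob_space (empirical (n - 1) i h)" "sets (empirical (n - 1) i h) = sets (E (n - 1))"
    using measurable_space[OF empirical_measurable[OF idx] h] by (auto simp: space_prob_algebra)
  have "(\<integral>x. \<phi> x \<partial>proposal i n h) = (\<integral>x. \<integral>y. \<phi> y \<partial>kern n x \<partial>empirical (n - 1) i h)"
    unfolding proposal_ge_2[of n i h, OF atLeastAtMost_iff[THEN iffD1, OF n, THEN conjunct1]]
    by (rule integral_bind_prob[OF emp(1) \<phi>])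
       (auto simp only: measurable_cong_sets[OF emp(2) refl] kern_measurable[OF n])
  also have "\<dots> = (\<integral>l. \<integral>y. \<phi> y \<partial>kern n (snd (h (l, n - 1))) \<partial>uniform_count_measure {0..i})"
    unfolding empirical_def
  proof (rule integral_distr[OF _ integral_kern_measurable[OF n \<phi>(1)]])
    have "(\<lambda>m. snd (h (m, n - 1))) \<in> count_space {0..i} \<rightarrow>\<^sub>M E (n - 1)"
      using measurable_space[OF measurable_hist_state[OF idx] h] by auto
    then show "(\<lambda>m. snd (h (m, n - 1))) \<in> uniform_count_measure {0..i} \<rightarrow>\<^sub>M E (n - 1)"
      by (simp add: measurable_cong_sets[OF sets_uniform_count_measure_count_space refl])
  qed
  also have "\<dots> = (\<Sum>l\<le>i. \<integral>x. \<phi> x \<partial>kern n (snd (h (l, n - 1)))) / real (Suc i)"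
    by (simp add: integral_uniform_count_measure atLeast0AtMost)
  finally show ?thesis .
qed

lemma integral_proposal_measurable:
  fixes \<phi> :: "_ \<Rightarrow> real"
  assumes "n \<in> {1..P}" "\<phi> \<in> borel_measurable (E n)"
  shows "(\<lambda>h. \<integral>x. \<phi> x \<partial>proposal i n h) \<in> borel_measurable (hist_space i (n - 1))"
  by (rule measurable_compose[OF measurable_prob_algebraD[OF proposal_measurable[OF assms(1)]]
        integral_measurable_subprob_algebra[OF assms(2)]])

text \<open>The cutoff makes the bound \<open>4 * B n / ratio n\<close> hold for every history, as
  the exponential martingale bound requires. It is decided by the past alone, so increments built
  from the solution remain centered.\<close>

definition poisson_solution ::
    "nat \<Rightarrow> ((nat \<Rightarrow> 'a) \<Rightarrow> real) \<Rightarrow> nat \<Rightarrow> (nat \<times> nat \<Rightarrow> (nat \<Rightarrow> 'a) \<times> (nat \<Rightarrow> 'a)) \<Rightarrow> (nat \<Rightarrow> 'a) \<Rightarrow> real" where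
  "poisson_solution n f i h x =
    (if ratio n / 2 \<le> (\<integral>y. w n y \<partial>proposal i n h)
     then imh_potential (proposal i n h) (accept_prob n) (w n) f x else 0)"

lemma imh_op_measurable:
  assumes n: "n \<in> {1..P}" and u: "(\<lambda>(h, x). u h x) \<in> borel_measurable (hist_space i (n - 1) \<Otimes>\<^sub>M E n)"
  shows "(\<lambda>(h, x). imh_op (proposal i n h) (accept_prob n) (u h) x)
    \<in> borel_measurable (hist_space i (n - 1) \<Otimes>\<^sub>M E n)"
proof -
  let ?H = "hist_space i (n - 1)"
  have [measurable]: "(\<lambda>z. accept_prob n (snd (fst z)) (snd z)) \<in> borel_measurable ((?H \<Otimes>\<^sub>M E n) \<Otimes>\<^sub>M E n)"
    using measurable_compose[OF measurable_Pair accept_prob_measurable[OF n],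
        of "\<lambda>z. snd (fst z)" "(?H \<Otimes>\<^sub>M E n) \<Otimes>\<^sub>M E n" snd] by simp
  have [measurable]: "(\<lambda>z. u (fst (fst z)) (snd z)) \<in> borel_measurable ((?H \<Otimes>\<^sub>M E n) \<Otimes>\<^sub>M E n)"
    using measurable_compose[OF measurable_Pair u,
        of "\<lambda>z. fst (fst z)" "(?H \<Otimes>\<^sub>M E n) \<Otimes>\<^sub>M E n" snd] by simp
  have [measurable]: "(\<lambda>z. u (fst (fst z)) (snd (fst z))) \<in> borel_measurable ((?H \<Otimes>\<^sub>M E n) \<Otimes>\<^sub>M E n)"
    using measurable_compose[OF measurable_fst u, of "E n"] by (simp add: case_prod_beta')
  have "(\<lambda>z. \<integral>y. accept_prob n (snd z) y * u (fst z) y + (1 - accept_prob n (snd z) y) * u (fst z) (snd z)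
      \<partial>proposal i n (fst z)) \<in> borel_measurable (?H \<Otimes>\<^sub>M E n)"
  proof (rule integral_measurable_subprob_algebra2[where N = "E n"])
    show "(\<lambda>(z, y). accept_prob n (snd z) y * u (fst z) y + (1 - accept_prob n (snd z) y) * u (fst z) (snd z))
      \<in> borel_measurable ((?H \<Otimes>\<^sub>M E n) \<Otimes>\<^sub>M E n)"
      unfolding case_prod_beta' by measurable
    show "(\<lambda>z. proposal i n (fst z)) \<in> ?H \<Otimes>\<^sub>M E n \<rightarrow>\<^sub>M subprob_algebra (E n)"
      by (rule measurable_compose[OF measurable_fst measurable_prob_algebraD[OF proposal_measurable[OF n]]])
  qed
  then show ?thesis
    by (simp add: imh_op_def case_prod_beta')
qed

text \<open>Joint measurability in history and state passes through each application of the kernel,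
  hence to every iterate and to the Neumann series.\<close>

lemma poisson_solution_measurable:
  assumes n: "n \<in> {1..P}" and f: "f \<in> borel_measurable (E n)"
  shows "(\<lambda>(h, x). poisson_solution n f i h x) \<in> borel_measurable (hist_space i (n - 1) \<Otimes>\<^sub>M E n)"
proof -
  let ?H = "hist_space i (n - 1)"
  have wf: "(\<lambda>x. w n x * f x) \<in> borel_measurable (E n)"
    using w_measurable[OF n] f by measurable
  have mean: "(\<lambda>z. \<integral>y. w n y * f y \<partial>proposal i n (fst z)) \<in> borel_measurable (?H \<Otimes>\<^sub>M E n)"
    "(\<lambda>z. \<integral>y. w n y \<partial>proposal i n (fst z)) \<in> borel_measurable (?H \<Otimes>\<^sub>M E n)"
    by (rule measurable_compose[OF measurable_fst integral_proposal_measurable[OF n wf]],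
        rule measurable_compose[OF measurable_fst integral_proposal_measurable[OF n w_measurable[OF n]]])
  note [measurable] = mean
  have f_snd [measurable]: "(\<lambda>z. f (snd z)) \<in> borel_measurable (?H \<Otimes>\<^sub>M E n)"
    by (rule measurable_compose[OF measurable_snd f])
  let ?it = "\<lambda>k h. (imh_op (proposal i n h) (accept_prob n) ^^ k)
      (\<lambda>y. f y - weighted_mean (proposal i n h) (w n) f)"
  have it: "(\<lambda>(h, x). ?it k h x) \<in> borel_measurable (?H \<Otimes>\<^sub>M E n)" for k
  proof (induction k)
    case 0
    show ?case
      unfolding case_prod_beta' weighted_mean_def funpow_0 by measurable
  next
    case (Suc k)
    from imh_op_measurable[OF n this] show ?case
      by simp
  qed
  then have [measurable]: "(\<lambda>z. ?it k (fst z) (snd z)) \<in> borel_measurable (?H \<Otimes>\<^sub>M E n)" for k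
    by (simp add: case_prod_beta')
  show ?thesis
    unfolding poisson_solution_def imh_potential_def case_prod_beta' by measurable
qed

end

locale simcmc_bounded_init =
  simcmc_bounded P F L \<gamma> q1 q B + simcmc_init P F L \<gamma> q1 q x0
  for P :: nat
    and F :: "'a measure"
    and L :: "nat \<Rightarrow> 'a measure"
    and \<gamma> :: "nat \<Rightarrow> (nat \<Rightarrow> 'a) \<Rightarrow> real"
    and q1 :: "'a \<Rightarrow> real"
    and q :: "nat \<Rightarrow> (nat \<Rightarrow> 'a) \<Rightarrow> 'a \<Rightarrow> real"
    and B :: "nat \<Rightarrow> real"
    and x0 :: "nat \<Rightarrow> nat \<Rightarrow> 'a"
begin

lemma space_past:
  "1 \<le> m \<Longrightarrow> m \<le> i \<Longrightarrow> n \<in> {1..P} \<Longrightarrow> h \<in> space (run x0 i) \<Longrightarrow> past m n h \<in> space (hist_space m (n - 1))"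
  using measurable_space[OF measurable_past] .

lemma space_state:
  "m \<le> i \<Longrightarrow> n \<in> {1..P} \<Longrightarrow> h \<in> space (run x0 i) \<Longrightarrow> snd (h (m, n)) \<in> space (E n)"
  using measurable_space[OF measurable_run_component] by (fastforce simp: space_pair_measure)

lemma measurable_state:
  "m \<le> i \<Longrightarrow> n \<in> {1..P} \<Longrightarrow> (\<lambda>h. snd (h (m, n))) \<in> run x0 i \<rightarrow>\<^sub>M E n"
  using measurable_compose[OF measurable_run_component measurable_snd] .

lemma integral_proposal_past:
  fixes \<phi> :: "_ \<Rightarrow> real"
  assumes n: "n \<in> {2..P}" and m: "1 \<le> m" "m \<le> i" and h: "h \<in> space (run x0 i)"
    and \<phi>: "\<phi> \<in> borel_measurable (E n)" "\<And>x. x \<in> space (E n) \<Longrightarrow> \<bar>\<phi> x\<bar> \<le> c"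
  shows "(\<integral>x. \<phi> x \<partial>proposal m n (past m n h)) =
    (\<Sum>l\<le>m. \<integral>x. \<phi> x \<partial>kern n (snd (h (l, n - 1)))) / real (Suc m)"
proof -
  have "past m n h (l, n - 1) = h (l, n - 1)" if "l \<le> m" for l
    using n that by (intro past_eq) (auto simp: hist_index_def)
  moreover have "past m n h \<in> space (hist_space m (n - 1))"
    using n by (intro space_past[OF m _ h]) auto
  ultimately show ?thesis
    using \<phi> by (subst integral_proposal[OF n]) auto
qed

lemma integral_proposal_Suc_diff:
  fixes \<phi> :: "_ \<Rightarrow> real"
  assumes n: "n \<in> {1..P}" and m: "1 \<le> m" "Suc m \<le> i" and h: "h \<in> space (run x0 i)"
    and \<phi>: "\<phi> \<in> borel_measurable (E n)" "\<And>x. x \<in> space (E n) \<Longrightarrow> \<bar>\<phi> x\<bar> \<le> 1"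
  shows "\<bar>(\<integral>x. \<phi> x \<partial>proposal (Suc m) n (past (Suc m) n h)) - (\<integral>x. \<phi> x \<partial>proposal m n (past m n h))\<bar>
    \<le> 2 / (real m + 2)"
proof (cases "n = 1")
  case True
  then show ?thesis
    using proposal_1 by simp
next
  case False
  then have n2: "n \<in> {2..P}"
    using n by auto
  let ?k = "\<lambda>l. \<integral>x. \<phi> x \<partial>kern n (snd (h (l, n - 1)))"
  have k: "\<bar>?k l\<bar> \<le> 1" if "l \<le> Suc m" for l
    using n2 m that by (intro abs_integral_kern_le[OF n2 \<phi>] space_state[OF _ _ h]) auto
  have "\<bar>\<Sum>l\<le>m. ?k l\<bar> \<le> (\<Sum>l\<le>m. 1)"
    using k by (intro order_trans[OF sum_abs] sum_mono) auto
  then have s: "\<bar>\<Sum>l\<le>m. ?k l\<bar> \<le> real m + 1"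
    by simp
  have "(\<integral>x. \<phi> x \<partial>proposal (Suc m) n (past (Suc m) n h)) - (\<integral>x. \<phi> x \<partial>proposal m n (past m n h))
      = ((\<Sum>l\<le>m. ?k l) + ?k (Suc m)) / (real m + 2) - (\<Sum>l\<le>m. ?k l) / (real m + 1)"
    using m by (subst (1 2) integral_proposal_past[OF n2 _ _ h \<phi>]) (auto simp: add.commute)
  \<comment> \<open>Adding one term moves a mean of \<open>m + 1\<close> terms towards the new term
    by the fraction \<open>1 / (m + 2)\<close> of their distance.\<close>
  also have "\<dots> = (?k (Suc m) - (\<Sum>l\<le>m. ?k l) / (real m + 1)) / (real m + 2)"
    by (simp add: divide_simps) (simp add: algebra_simps)
  also have "\<bar>\<dots>\<bar> \<le> (1 + 1) / (real m + 2)"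
  proof -
    have "\<bar>(\<Sum>l\<le>m. ?k l) / (real m + 1)\<bar> \<le> 1"
      using s by (simp add: abs_divide)
    then have "\<bar>?k (Suc m) - (\<Sum>l\<le>m. ?k l) / (real m + 1)\<bar> \<le> 1 + 1"
      using k[of "Suc m"] by linarith
    then show ?thesis
      by (simp add: abs_divide divide_right_mono)
  qed
  finally show ?thesis
    by simp
qed

end

section \<open>The ergodic bound for one level\<close>

text \<open>Applied with the solution of iteration \<open>m\<close> at the states before and after
  that iteration. In \<open>a (Suc m) - b m\<close> two consecutive solutions are then compared at
  the same state.\<close>

lemma sum_telescope_varying:
  fixes a b :: "nat \<Rightarrow> real"
  assumes "1 \<le> i"
  shows "(\<Sum>m=1..i. a m - b m) = a 1 - b i + (\<Sum>m=1..<i. a (Suc m) - b m)"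
  using assms
proof (induction i rule: dec_induct)
  case (step i)
  then show ?case
    by (simp add: sum.atLeastLessThan_Suc)
qed simp

text \<open>The first summand pays for the martingale, whose increments are at most
  \<open>2 * (4 * B n / ratio n)\<close>, the second for the boundary terms and the drift of the
  solutions. In the third, \<open>4 * B n * D\<close> collects the deviations of two functions
  bounded by \<open>B n\<close>, with a \<open>2\<close> from summing
  \<open>1 / sqrt m\<close>.\<close>

definition (in simcmc_bounded) ergodic_const :: "nat \<Rightarrow> nat \<Rightarrow> real \<Rightarrow> real" where
  "ergodic_const n k D = subgaussian_const k * (2 * (4 * B n / ratio n))
     + (2 * (4 * B n / ratio n) + 128 * (B n)\<^sup>2 / (ratio n)\<^sup>2)
     + (4 / ratio n + 4 * (4 * B n / ratio n) / ratio n) * (4 * B n * D)"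

lemma (in simcmc_bounded) ergodic_const_pos:
  assumes n: "n \<in> {1..P}" and D: "0 < D"
  shows "0 < ergodic_const n k D"
  unfolding ergodic_const_def
  using ratio_pos[OF n] B_pos[OF n] D subgaussian_const_ge_1[of k]
  by (intro add_pos_pos mult_pos_pos divide_pos_pos) auto

context simcmc_bounded_init
begin

context
  fixes n :: nat and f :: "(nat \<Rightarrow> 'a) \<Rightarrow> real" and I :: nat
  assumes n: "n \<in> {1..P}"
    and f: "f \<in> borel_measurable (E n)" and f_bound: "x \<in> space (E n) \<Longrightarrow> \<bar>f x\<bar> \<le> 1"
begin

abbreviation "\<theta> \<equiv> ratio n"
abbreviation "\<nu> m h \<equiv> proposal m n (past m n h)"
abbreviation "X m h \<equiv> snd (h (m, n))"
abbreviation "sol m h \<equiv> poisson_solution n f m (past m n h)"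
abbreviation "sol_bound \<equiv> 4 * B n / \<theta>"
abbreviation "dev m \<phi> h \<equiv> (\<integral>x. \<phi> x \<partial>\<nu> m h) - (\<integral>x. \<phi> x \<partial>limit_proposal n)"
abbreviation "f_target \<equiv> \<integral>x. f x \<partial>target n"

lemma \<theta>_pos: "0 < \<theta>"
  by (rule ratio_pos[OF n])

lemma sol_bound_pos: "0 < sol_bound"
  using \<theta>_pos B_pos[OF n] by simp

lemma coefficient_nonneg: "0 \<le> c \<Longrightarrow> 0 \<le> c * sol_bound / \<theta>"
  using \<theta>_pos B_pos[OF n] by simp

lemma f_meas: "sets N = sets (E n) \<Longrightarrow> f \<in> borel_measurable N"
  using f by (simp add: measurable_cong_sets[of N "E n" borel borel])

context
  fixes i :: nat and h :: "nat \<times> nat \<Rightarrow> (nat \<Rightarrow> 'a) \<times> (nat \<Rightarrow> 'a)"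
  assumes h: "h \<in> space (hist_space i (n - 1))"
begin

lemma imh_proposal: "0 < (\<integral>x. w n x \<partial>proposal i n h) \<Longrightarrow> imh (proposal i n h) (w n) (accept_prob n) (B n)"
  by (rule imh_level[OF n prob_space_proposal[OF n h] sets_proposal[OF n h]])

lemma space_proposal: "space (proposal i n h) = space (E n)"
  by (rule sets_eq_imp_space_eq[OF sets_proposal[OF n h]])

lemma poisson_solution_bound:
  assumes x: "x \<in> space (E n)"
  shows "\<bar>poisson_solution n f i h x\<bar> \<le> sol_bound"
proof (cases "\<theta> / 2 \<le> (\<integral>y. w n y \<partial>proposal i n h)")
  case True
  then have pos: "0 < (\<integral>y. w n y \<partial>proposal i n h)"
    using \<theta>_pos by linarith
  interpret I: imh "proposal i n h" "w n" "accept_prob n" "B n"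
    by (rule imh_proposal[OF pos])
  have "\<bar>poisson_solution n f i h x\<bar> \<le> 2 * 1 * B n / (\<integral>y. w n y \<partial>proposal i n h)"
    using True I.potential_bound[OF f_meas[OF sets_proposal[OF n h]], of 1 x] f_bound x
    by (simp add: poisson_solution_def space_proposal)
  also have "\<dots> \<le> 2 * 1 * B n / (\<theta> / 2)"
    using True \<theta>_pos B_pos[OF n] pos by (intro divide_left_mono mult_pos_pos) auto
  finally show ?thesis
    by simp
next
  case False
  then show ?thesis
    using sol_bound_pos by (simp add: poisson_solution_def)
qed

lemma poisson_solution_eq:
  assumes x: "x \<in> space (E n)"
  shows "poisson_solution n f i h x - imh_op (proposal i n h) (accept_prob n) (poisson_solution n f i h) x =
    (if \<theta> / 2 \<le> (\<integral>y. w n y \<partial>proposal i n h) then f x - weighted_mean (proposal i n h) (w n) f else 0)"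
proof (cases "\<theta> / 2 \<le> (\<integral>y. w n y \<partial>proposal i n h)")
  case True
  then have pos: "0 < (\<integral>y. w n y \<partial>proposal i n h)"
    using \<theta>_pos by linarith
  interpret I: imh "proposal i n h" "w n" "accept_prob n" "B n"
    by (rule imh_proposal[OF pos])
  have "poisson_solution n f i h = imh_potential (proposal i n h) (accept_prob n) (w n) f"
    using True by (simp add: poisson_solution_def[abs_def])
  then show ?thesis
    using True I.poisson_equation[OF f_meas[OF sets_proposal[OF n h]], of 1 x] f_bound x
    by (simp add: space_proposal)
next
  case False
  then have "poisson_solution n f i h = (\<lambda>_. 0)"
    by (simp add: poisson_solution_def[abs_def])
  with False show ?thesis
    by (simp add: imh_op_def)
qed

lemma weighted_mean_deviation:
  assumes "\<theta> / 2 \<le> (\<integral>y. w n y \<partial>proposal i n h)"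
  shows "\<bar>weighted_mean (proposal i n h) (w n) f - f_target\<bar> \<le> 2 / \<theta> *
    (\<bar>(\<integral>y. w n y \<partial>proposal i n h) - (\<integral>y. w n y \<partial>limit_proposal n)\<bar>
     + \<bar>(\<integral>y. w n y * f y \<partial>proposal i n h) - (\<integral>y. w n y * f y \<partial>limit_proposal n)\<bar>)"
proof -
  let ?\<theta> = "\<integral>y. w n y \<partial>proposal i n h" and ?N = "\<integral>y. w n y * f y \<partial>proposal i n h"
  have pos: "0 < ?\<theta>"
    using assms \<theta>_pos by linarith
  have t: "\<bar>f_target\<bar> \<le> 1"
    using f_bound sets_eq_imp_space_eq[OF sets_target[of n]]
    by (intro prob_space.abs_integral_le prob_space_target[OF n] f_meas sets_target) auto
  \<comment> \<open>The deviations of numerator and denominator of the weighted mean from their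
    limits. The factor \<open>2 / \<theta>\<close> arises because the denominator is at least
    \<open>\<theta> / 2\<close>.\<close>
  define A D where "A = ?N - \<theta> * f_target" and "D = ?\<theta> - \<theta>"
  have "weighted_mean (proposal i n h) (w n) f * ?\<theta> = ?N"
    using pos by (simp add: weighted_mean_def)
  then have "(weighted_mean (proposal i n h) (w n) f - f_target) * ?\<theta> = A - f_target * D"
    unfolding A_def D_def left_diff_distrib right_diff_distrib by simp
  with pos have "weighted_mean (proposal i n h) (w n) f - f_target = (A - f_target * D) / ?\<theta>"
    by (intro eq_divide_imp) auto
  also have "\<bar>\<dots>\<bar> = \<bar>A - f_target * D\<bar> / ?\<theta>"
    unfolding abs_divide abs_of_pos[OF pos] ..
  also have "\<dots> \<le> (\<bar>A\<bar> + \<bar>D\<bar>) / ?\<theta>"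
  proof (rule divide_right_mono)
    have "\<bar>f_target * D\<bar> \<le> 1 * \<bar>D\<bar>"
      unfolding abs_mult using t by (rule mult_right_mono) simp
    then show "\<bar>A - f_target * D\<bar> \<le> \<bar>A\<bar> + \<bar>D\<bar>"
      by linarith
  qed (use pos in linarith)
  also have "\<dots> \<le> (\<bar>A\<bar> + \<bar>D\<bar>) / (\<theta> / 2)"
    using assms \<theta>_pos pos by (intro divide_left_mono mult_pos_pos) linarith+
  also have "\<dots> = 2 / \<theta> * (\<bar>D\<bar> + \<bar>A\<bar>)"
    by (simp add: add.commute)
  finally show ?thesis
    by (simp only: A_def D_def integral_w_limit[OF n] integral_w_limit_proposal[OF n f])
qed

end

text \<open>If both solutions pass the cutoff, the perturbation bound applies with distance
  \<open>2 / (m + 2)\<close>. Otherwise one of them is \<open>0\<close>, and the deviation of the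
  mean weight that caused the failure pays for the trivial bound \<open>sol_bound\<close>.\<close>

lemma poisson_solution_Suc_diff:
  assumes m: "1 \<le> m" "Suc m \<le> I" and h: "h \<in> space (run x0 I)" and x: "x \<in> space (E n)"
  shows "\<bar>sol (Suc m) h x - sol m h x\<bar> \<le> 64 * (B n)\<^sup>2 / \<theta>\<^sup>2 * (1 / sqrt m)
    + 2 * sol_bound / \<theta> * (\<bar>dev m (w n) h\<bar> + \<bar>dev (Suc m) (w n) h\<bar>)"
proof -
  have past: "past m n h \<in> space (hist_space m (n - 1))" "past (Suc m) n h \<in> space (hist_space (Suc m) (n - 1))"
    using space_past[OF _ _ n h] m by auto
  note sol = poisson_solution_bound[OF past(1) x] poisson_solution_bound[OF past(2) x]
  have bad: "1 \<le> 2 / \<theta> * \<bar>dev j (w n) h\<bar>" if "\<not> \<theta> / 2 \<le> (\<integral>y. w n y \<partial>\<nu> j h)" for j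
  proof -
    have "\<theta> / 2 \<le> \<bar>dev j (w n) h\<bar>"
      using that unfolding integral_w_limit[OF n] by linarith
    then show ?thesis
      using \<theta>_pos by (simp add: field_simps)
  qed
  have nonneg: "0 \<le> 64 * (B n)\<^sup>2 / \<theta>\<^sup>2 * (1 / sqrt m)"
    by simp
  have sol_mult: "sol_bound \<le> 2 * sol_bound / \<theta> * \<bar>dev j (w n) h\<bar>" if "\<not> \<theta> / 2 \<le> (\<integral>y. w n y \<partial>\<nu> j h)" for j
    using mult_left_mono[OF bad[OF that], of sol_bound] sol_bound_pos by (simp add: mult_ac)
  have dev_nonneg: "0 \<le> 2 * sol_bound / \<theta> * \<bar>dev j (w n) h\<bar>" for j
    by (intro mult_nonneg_nonneg coefficient_nonneg) auto
  show ?thesis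
  proof (cases "\<theta> / 2 \<le> (\<integral>y. w n y \<partial>\<nu> m h)")
    case good: True
    show ?thesis
    proof (cases "\<theta> / 2 \<le> (\<integral>y. w n y \<partial>\<nu> (Suc m) h)")
      case good': True
      have pos: "0 < (\<integral>y. w n y \<partial>\<nu> m h)" "0 < (\<integral>y. w n y \<partial>\<nu> (Suc m) h)"
        using good good' \<theta>_pos by linarith+
      have sets: "sets (\<nu> (Suc m) h) = sets (E n)" "sets (\<nu> m h) = sets (E n)"
        using sets_proposal[OF n past(1)] sets_proposal[OF n past(2)] by auto
      interpret C: imh_pair "\<nu> (Suc m) h" "\<nu> m h" "w n" "accept_prob n" "B n" "2 / (real m + 2)" "\<theta> / 2"
      proof (intro imh_pair.intro imh_pair_axioms.intro imh_proposal[OF past(1) pos(1)] imh_proposal[OF past(2) pos(2)] good good')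
        show "sets (\<nu> m h) = sets (\<nu> (Suc m) h)"
          using sets by simp
        show "0 < \<theta> / 2"
          using \<theta>_pos by simp
        fix \<phi> :: "(nat \<Rightarrow> 'a) \<Rightarrow> real"
        assume "\<phi> \<in> borel_measurable (\<nu> (Suc m) h)" "\<And>x. x \<in> space (\<nu> (Suc m) h) \<Longrightarrow> \<bar>\<phi> x\<bar> \<le> 1"
        then show "\<bar>(\<integral>x. \<phi> x \<partial>\<nu> (Suc m) h) - (\<integral>x. \<phi> x \<partial>\<nu> m h)\<bar> \<le> 2 / (real m + 2)"
          using sets_eq_imp_space_eq[OF sets(1)]
          by (intro integral_proposal_Suc_diff[OF n m h]) (auto simp: measurable_cong_sets[OF sets(1) refl])
      qed
      have "\<bar>sol (Suc m) h x - sol m h x\<bar> \<le> 8 * (B n)\<^sup>2 * 1 * (2 / (real m + 2)) / (\<theta> / 2)\<^sup>2"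
        using C.potential_diff[OF f_meas[OF sets(1)], of 1 x] f_bound x good good' sets_eq_imp_space_eq[OF sets(1)]
        by (simp add: poisson_solution_def)
      \<comment> \<open>\<open>64\<close> is \<open>8 * 2\<close> divided by the square of the
        \<open>1 / 2\<close> in the cutoff. Weakening \<open>1 / (m + 2)\<close> to
        \<open>1 / sqrt m\<close> afterwards costs nothing in the final order.\<close>
      also have "\<dots> = 64 * (B n)\<^sup>2 / \<theta>\<^sup>2 * (1 / (real m + 2))"
        by (simp add: power_divide)
      also have "\<dots> \<le> 64 * (B n)\<^sup>2 / \<theta>\<^sup>2 * (1 / sqrt m)"
      proof (rule mult_left_mono)
        have "sqrt (real m) \<le> real m + 2"
          by (rule real_le_lsqrt) (auto simp: power2_eq_square algebra_simps)
        then show "1 / (real m + 2) \<le> 1 / sqrt m"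
          using m by (intro divide_left_mono) auto
      qed simp
      finally show ?thesis
        using dev_nonneg[of m] dev_nonneg[of "Suc m"] by (simp add: distrib_left)
    next
      case False
      then have "sol (Suc m) h x = 0"
        by (simp add: poisson_solution_def)
      then have "\<bar>sol (Suc m) h x - sol m h x\<bar> \<le> sol_bound"
        using sol by simp
      then show ?thesis
        using sol_mult[OF False] nonneg dev_nonneg[of m] unfolding distrib_left by linarith
    qed
  next
    case False
    then have "sol m h x = 0"
      by (simp add: poisson_solution_def)
    then have "\<bar>sol (Suc m) h x - sol m h x\<bar> \<le> sol_bound"
      using sol by simp
    then show ?thesis
      using sol_mult[OF False] nonneg dev_nonneg[of "Suc m"] unfolding distrib_left by linarith
  qed
qed

text \<open>The martingale increment: the solution at the new state minus its conditional mean given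
  the past.\<close>

definition noise ::
    "nat \<Rightarrow> (nat \<times> nat \<Rightarrow> (nat \<Rightarrow> 'a) \<times> (nat \<Rightarrow> 'a)) \<Rightarrow> (nat \<Rightarrow> 'a) \<times> (nat \<Rightarrow> 'a) \<Rightarrow> real" where
  "noise m h z = poisson_solution n f m h (snd z)
     - imh_op (proposal m n h) (accept_prob n) (poisson_solution n f m h) (snd (h (m - 1, n)))"

text \<open>A pathwise inequality. Histories that fail the cutoff are charged to their own
  deviations, so their probability never has to be estimated.\<close>

lemma ergodic_sum_decomposition:
  assumes i: "1 \<le> i" "i \<le> I" and h: "h \<in> space (run x0 I)"
  shows "\<bar>\<Sum>m<i. f (X m h) - f_target\<bar> \<le> \<bar>\<Sum>m=1..i. noise m (past m n h) (h (m, n))\<bar>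
    + (2 * sol_bound + 128 * (B n)\<^sup>2 / \<theta>\<^sup>2) * sqrt i
    + (4 / \<theta> + 4 * sol_bound / \<theta>) * (\<Sum>m=1..i. \<bar>dev m (w n) h\<bar> + \<bar>dev m (\<lambda>x. w n x * f x) h\<bar>)"
proof -
  let ?a = "\<lambda>m. \<bar>dev m (w n) h\<bar>" and ?b = "\<lambda>m. \<bar>dev m (\<lambda>x. w n x * f x) h\<bar>"
  let ?N = "\<lambda>m. noise m (past m n h) (h (m, n))"
  have past: "past m n h \<in> space (hist_space m (n - 1))" if "m \<in> {1..i}" for m
    using space_past[OF _ _ n h, of m] that i by auto
  have X: "X m h \<in> space (E n)" if "m \<le> i" for m
    using space_state[OF _ n h, of m] that i by auto
  have t: "\<bar>f_target\<bar> \<le> 1"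
    using f_bound sets_eq_imp_space_eq[OF sets_target[of n]]
    by (intro prob_space.abs_integral_le prob_space_target[OF n] f_meas sets_target) auto
  \<comment> \<open>What the Poisson equation misses: the gap between current and limiting invariant
    mean, or the whole centered summand if the cutoff fails.\<close>
  define R where "R m = (f (X (m - 1) h) - f_target) - (?N m + (sol m h (X (m - 1) h) - sol m h (X m h)))" for m
  have R: "\<bar>R m\<bar> \<le> 4 / \<theta> * (?a m + ?b m)" if m: "m \<in> {1..i}" for m
  proof -
    have prev: "past m n h (m - 1, n) = h (m - 1, n)"
      using m n by (intro past_eq) (auto simp: hist_index_def)
    have Xm: "X (m - 1) h \<in> space (E n)"
      using m by (intro X) auto
    have "?N m + (sol m h (X (m - 1) h) - sol m h (X m h))
        = sol m h (X (m - 1) h) - imh_op (\<nu> m h) (accept_prob n) (sol m h) (X (m - 1) h)"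
      unfolding noise_def prev by simp
    also have "\<dots> = (if \<theta> / 2 \<le> (\<integral>y. w n y \<partial>\<nu> m h)
        then f (X (m - 1) h) - weighted_mean (\<nu> m h) (w n) f else 0)"
      by (rule poisson_solution_eq[OF past[OF m] Xm])
    finally have R_eq: "R m = (if \<theta> / 2 \<le> (\<integral>y. w n y \<partial>\<nu> m h)
        then weighted_mean (\<nu> m h) (w n) f - f_target else f (X (m - 1) h) - f_target)"
      by (simp add: R_def)
    show ?thesis
    proof (cases "\<theta> / 2 \<le> (\<integral>y. w n y \<partial>\<nu> m h)")
      case True
      then have "\<bar>R m\<bar> \<le> 2 / \<theta> * (?a m + ?b m)"
        using weighted_mean_deviation[OF past[OF m] True] by (simp add: R_eq)
      also have "\<dots> \<le> 4 / \<theta> * (?a m + ?b m)"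
        using \<theta>_pos by (intro mult_right_mono divide_right_mono) auto
      finally show ?thesis .
    next
      case False
      then have "\<theta> / 2 \<le> ?a m"
        unfolding integral_w_limit[OF n] by linarith
      \<comment> \<open>\<open>2\<close> is the trivial bound for the difference of \<open>f\<close>
        and its target mean.\<close>
      then have "2 \<le> 4 / \<theta> * ?a m"
        using \<theta>_pos by (simp add: field_simps)
      also have "\<dots> \<le> 4 / \<theta> * (?a m + ?b m)"
        using \<theta>_pos by (intro mult_left_mono) auto
      finally show ?thesis
        using False f_bound[OF Xm] t by (simp add: R_eq)
    qed
  qed
  let ?T = "\<Sum>m=1..i. sol m h (X (m - 1) h) - sol m h (X m h)"
  have T: "\<bar>?T\<bar> \<le> 2 * sol_bound + 64 * (B n)\<^sup>2 / \<theta>\<^sup>2 * (2 * sqrt i) + 4 * sol_bound / \<theta> * (\<Sum>m=1..i. ?a m)"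
  proof -
    have double: "2 * sol_bound / \<theta> * (s + s) = 4 * sol_bound / \<theta> * s" for s :: real
      by simp
    have T_eq: "?T = sol 1 h (X 0 h) - sol i h (X i h) + (\<Sum>m=1..<i. sol (Suc m) h (X m h) - sol m h (X m h))"
      using sum_telescope_varying[OF i(1), of "\<lambda>m. sol m h (X (m - 1) h)" "\<lambda>m. sol m h (X m h)"] by simp
    have "\<bar>?T\<bar> \<le> \<bar>sol 1 h (X 0 h)\<bar> + \<bar>sol i h (X i h)\<bar>
        + (\<Sum>m=1..<i. \<bar>sol (Suc m) h (X m h) - sol m h (X m h)\<bar>)"
      unfolding T_eq using sum_abs[of "\<lambda>m. sol (Suc m) h (X m h) - sol m h (X m h)" "{1..<i}"] by linarith
    also have "\<dots> \<le> sol_bound + sol_bound + (\<Sum>m=1..<i. 64 * (B n)\<^sup>2 / \<theta>\<^sup>2 * (1 / sqrt m)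
        + 2 * sol_bound / \<theta> * (?a m + ?a (Suc m)))"
    proof (intro add_mono sum_mono)
      show "\<bar>sol 1 h (X 0 h)\<bar> \<le> sol_bound" "\<bar>sol i h (X i h)\<bar> \<le> sol_bound"
        using i by (auto intro!: poisson_solution_bound past X)
      fix m assume "m \<in> {1..<i}"
      then show "\<bar>sol (Suc m) h (X m h) - sol m h (X m h)\<bar> \<le> 64 * (B n)\<^sup>2 / \<theta>\<^sup>2 * (1 / sqrt m)
        + 2 * sol_bound / \<theta> * (?a m + ?a (Suc m))"
        using i by (intro poisson_solution_Suc_diff h X) auto
    qed
    also have "\<dots> = 2 * sol_bound + 64 * (B n)\<^sup>2 / \<theta>\<^sup>2 * (\<Sum>m=1..<i. 1 / sqrt m)
        + 2 * sol_bound / \<theta> * ((\<Sum>m=1..<i. ?a m) + (\<Sum>m=1..<i. ?a (Suc m)))"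
      by (simp only: sum.distrib sum_distrib_left distrib_left mult_2 add.assoc)
    also have "\<dots> \<le> 2 * sol_bound + 64 * (B n)\<^sup>2 / \<theta>\<^sup>2 * (2 * sqrt i)
        + 2 * sol_bound / \<theta> * ((\<Sum>m=1..i. ?a m) + (\<Sum>m=1..i. ?a m))"
    proof (intro add_mono mult_left_mono order_refl)
      have "(\<Sum>m=1..<i. 1 / sqrt m) \<le> (\<Sum>m=1..i. 1 / sqrt m)"
        by (intro sum_mono2) auto
      then show "(\<Sum>m=1..<i. 1 / sqrt m) \<le> 2 * sqrt i"
        using sum_inverse_sqrt_le[of i] by simp
      show "(\<Sum>m=1..<i. ?a m) \<le> (\<Sum>m=1..i. ?a m)"
        by (intro sum_mono2) auto
      have "(\<Sum>m=1..<i. ?a (Suc m)) = (\<Sum>m\<in>Suc ` {1..<i}. ?a m)"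
        by (rule sum.reindex_cong[where l = Suc, symmetric]) auto
      also have "\<dots> \<le> (\<Sum>m=1..i. ?a m)"
        by (intro sum_mono2) auto
      finally show "(\<Sum>m=1..<i. ?a (Suc m)) \<le> (\<Sum>m=1..i. ?a m)" .
      show "0 \<le> 2 * sol_bound / \<theta>"
        by (rule coefficient_nonneg) simp
    qed simp_all
    finally show ?thesis
      unfolding double .
  qed
  \<comment> \<open>The shift pairs each state with the kernel that acts on it: iteration
    \<open>m\<close> starts from the state of iteration \<open>m - 1\<close>.\<close>
  have "(\<Sum>m<i. f (X m h) - f_target) = (\<Sum>m=1..i. f (X (m - 1) h) - f_target)"
    by (rule sum.reindex_bij_witness[of _ "\<lambda>m. m - 1" Suc]) auto
  also have "\<dots> = (\<Sum>m=1..i. ?N m + ((sol m h (X (m - 1) h) - sol m h (X m h)) + R m))"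
    by (intro sum.cong) (auto simp: R_def)
  also have "\<dots> = (\<Sum>m=1..i. ?N m) + ?T + (\<Sum>m=1..i. R m)"
    by (simp add: sum.distrib)
  finally have main: "\<bar>\<Sum>m<i. f (X m h) - f_target\<bar> \<le> \<bar>\<Sum>m=1..i. ?N m\<bar> + \<bar>?T\<bar> + (\<Sum>m=1..i. \<bar>R m\<bar>)"
    using sum_abs[of R "{1..i}"] by linarith
  have "(\<Sum>m=1..i. \<bar>R m\<bar>) \<le> (\<Sum>m=1..i. 4 / \<theta> * (?a m + ?b m))"
    by (intro sum_mono R)
  then have R_sum: "(\<Sum>m=1..i. \<bar>R m\<bar>) \<le> 4 / \<theta> * (\<Sum>m=1..i. ?a m + ?b m)"
    by (simp only: sum_distrib_left)
  have drift: "2 * sol_bound + 64 * (B n)\<^sup>2 / \<theta>\<^sup>2 * (2 * sqrt i) \<le> (2 * sol_bound + 128 * (B n)\<^sup>2 / \<theta>\<^sup>2) * sqrt i"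
  proof -
    have "2 * sol_bound * 1 \<le> 2 * sol_bound * sqrt i"
      using sol_bound_pos i by (intro mult_left_mono) auto
    moreover have "64 * (B n)\<^sup>2 / \<theta>\<^sup>2 * (2 * sqrt i) = 128 * (B n)\<^sup>2 / \<theta>\<^sup>2 * sqrt i"
      by simp
    ultimately show ?thesis
      unfolding distrib_right by linarith
  qed
  have "4 * sol_bound / \<theta> * (\<Sum>m=1..i. ?a m) \<le> 4 * sol_bound / \<theta> * (\<Sum>m=1..i. ?a m + ?b m)"
  proof (intro mult_left_mono sum_mono)
    show "0 \<le> 4 * sol_bound / \<theta>"
      by (rule coefficient_nonneg) simp
  qed simp
  with main R_sum drift T show ?thesis
    unfolding distrib_right[of "4 / \<theta>"] by linarith
qed

lemma noise_measurable:
  assumes m: "1 \<le> m"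
  shows "(\<lambda>(h, z). noise m h z) \<in> borel_measurable (hist_space m (n - 1) \<Otimes>\<^sub>M (E n \<Otimes>\<^sub>M E n))"
proof -
  let ?H = "hist_space m (n - 1)" and ?EE = "E n \<Otimes>\<^sub>M E n"
  note sol = poisson_solution_measurable[OF n f, of m]
  have state: "(\<lambda>h. snd (h (m - 1, n))) \<in> ?H \<rightarrow>\<^sub>M E n"
    using n m by (intro measurable_hist_state) (auto simp: hist_index_def)
  have [measurable]: "(\<lambda>x. poisson_solution n f m (fst x) (snd (snd x))) \<in> borel_measurable (?H \<Otimes>\<^sub>M ?EE)"
    using measurable_compose[OF measurable_Pair sol, of fst "?H \<Otimes>\<^sub>M ?EE" "\<lambda>x. snd (snd x)"] by simp
  have [measurable]: "(\<lambda>x. imh_op (proposal m n (fst x)) (accept_prob n) (poisson_solution n f m (fst x))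
      (snd (fst x (m - 1, n)))) \<in> borel_measurable (?H \<Otimes>\<^sub>M ?EE)"
    using measurable_compose[OF measurable_Pair imh_op_measurable[OF n sol],
        OF measurable_fst measurable_compose[OF measurable_fst state]] by simp
  show ?thesis
    unfolding noise_def case_prod_beta' by measurable
qed

context
  fixes m :: nat and h :: "nat \<times> nat \<Rightarrow> (nat \<Rightarrow> 'a) \<times> (nat \<Rightarrow> 'a)"
  assumes m: "1 \<le> m" and h: "h \<in> space (hist_space m (n - 1))"
begin

lemma sol_section_measurable: "poisson_solution n f m h \<in> borel_measurable (E n)"
  using measurable_compose_Pair1[OF h poisson_solution_measurable[OF n f]] by simp

lemma prev_state_space: "snd (h (m - 1, n)) \<in> space (E n)"
  using n m by (intro measurable_space[OF measurable_hist_state h]) (auto simp: hist_index_def)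

lemma noise_bound:
  assumes z: "z \<in> space (E n \<Otimes>\<^sub>M E n)"
  shows "\<bar>noise m h z\<bar> \<le> 2 * sol_bound"
proof -
  let ?p = "proposal m n h" and ?x = "snd (h (m - 1, n))"
  have "accept_prob n ?x \<in> borel_measurable (E n)"
    using measurable_compose_Pair1[OF prev_state_space accept_prob_measurable[OF n]] by simp
  then have "\<bar>imh_op ?p (accept_prob n) (poisson_solution n f m h) ?x\<bar> \<le> sol_bound"
    unfolding imh_op_def using sol_section_measurable space_proposal[OF h]
    by (intro prob_space.abs_integral_le prob_space_proposal[OF n h] abs_convex_combination_le
          accept_prob_bounds poisson_solution_bound[OF h] prev_state_space)
       (auto simp: measurable_cong_sets[OF sets_proposal[OF n h] refl])
  moreover have "\<bar>poisson_solution n f m h (snd z)\<bar> \<le> sol_bound"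
    using z by (intro poisson_solution_bound[OF h]) (auto simp: space_pair_measure)
  ultimately show ?thesis
    unfolding noise_def by linarith
qed

lemma noise_centered: "(\<integral>z. noise m h z \<partial>level_step m n h) = 0"
proof -
  let ?s = "poisson_solution n f m h" and ?x = "snd (h (m - 1, n))"
  interpret N: prob_space "level_step m n h"
    by (rule prob_space_level_step[OF n m h])
  have s: "(\<lambda>z. ?s (snd z)) \<in> borel_measurable (E n \<Otimes>\<^sub>M E n)"
    by (rule measurable_compose[OF measurable_snd sol_section_measurable])
  have bound: "\<bar>?s (snd z)\<bar> \<le> sol_bound" if "z \<in> space (E n \<Otimes>\<^sub>M E n)" for z
    using that by (intro poisson_solution_bound[OF h]) (auto simp: space_pair_measure)
  have sp: "space (level_step m n h) = space (E n \<Otimes>\<^sub>M E n)"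
    by (rule sets_eq_imp_space_eq[OF sets_level_step[OF n m h]])
  have int: "integrable (level_step m n h) (\<lambda>z. ?s (snd z))"
    using s bound sp
    by (intro N.integrable_bounded) (auto simp: measurable_cong_sets[OF sets_level_step[OF n m h] refl])
  have "(\<integral>z. noise m h z \<partial>level_step m n h)
      = (\<integral>z. ?s (snd z) \<partial>level_step m n h) - imh_op (proposal m n h) (accept_prob n) ?s ?x"
    unfolding noise_def using int by (simp add: N.prob_space)
  also have "(\<integral>z. ?s (snd z) \<partial>level_step m n h) = imh_op (proposal m n h) (accept_prob n) ?s ?x"
    using integral_level_step[OF n m h s bound] by (simp add: imh_op_def)
  finally show ?thesis
    by simp
qed

end

lemma moment_le_ergodic_sum:
  assumes i: "1 \<le> i" "i \<le> I" and k: "1 \<le> k" and D: "0 < D"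
    and dev: "\<And>m \<phi>. m \<in> {1..i} \<Longrightarrow> \<phi> \<in> borel_measurable (E n) \<Longrightarrow> (\<And>x. x \<in> space (E n) \<Longrightarrow> \<bar>\<phi> x\<bar> \<le> 1)
      \<Longrightarrow> moment_le (run x0 I) k (dev m \<phi>) (D / sqrt m)"
  shows "moment_le (run x0 I) k (\<lambda>h. \<Sum>m<i. f (X m h) - f_target) (ergodic_const n k D * sqrt i)"
proof -
  let ?N = "\<lambda>h. \<Sum>m=1..i. noise m (past m n h) (h (m, n))"
  let ?wf = "\<lambda>x. w n x * f x"
  let ?c0 = "2 * sol_bound + 128 * (B n)\<^sup>2 / \<theta>\<^sup>2" and ?c1 = "4 / \<theta> + 4 * sol_bound / \<theta>"
  let ?D = "\<lambda>h. \<Sum>m=1..i. \<bar>dev m (w n) h\<bar> + \<bar>dev m ?wf h\<bar>"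
  interpret prob_space "run x0 I"
    by (rule prob_space_run)
  \<comment> \<open>The hypothesis covers test functions bounded by \<open>1\<close>; rescaling by
    \<open>B n\<close> makes it available for \<open>w n\<close> and for \<open>w n\<close> times
    \<open>f\<close>.\<close>
  have scaled: "moment_le (run x0 I) k (\<lambda>h. \<bar>dev m \<phi> h\<bar>) (B n * D / sqrt m)"
    if m: "m \<in> {1..i}" and \<phi>: "\<phi> \<in> borel_measurable (E n)" "\<And>x. x \<in> space (E n) \<Longrightarrow> \<bar>\<phi> x\<bar> \<le> B n" for m \<phi>
  proof -
    have "moment_le (run x0 I) k (dev m (\<lambda>x. \<phi> x / B n)) (D / sqrt m)"
      using \<phi> B_pos[OF n] by (intro dev m) (auto simp: abs_divide)
    then have "moment_le (run x0 I) k (\<lambda>h. B n * dev m (\<lambda>x. \<phi> x / B n) h) (\<bar>B n\<bar> * (D / sqrt m))"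
      by (rule moment_le_cmult)
    then have *: "moment_le (run x0 I) k (dev m \<phi>) (B n * D / sqrt m)"
      using B_pos[OF n] by (simp add: right_diff_distrib)
    show ?thesis
      by (rule moment_le_mono[OF *]) (use moment_le_measurable[OF *] B_pos[OF n] D in auto)
  qed
  have wf: "?wf \<in> borel_measurable (E n)"
    using w_measurable[OF n] f by measurable
  have wf_bound: "\<bar>?wf x\<bar> \<le> B n" if "x \<in> space (E n)" for x
    using mult_mono[OF w_le[OF n that] f_bound[OF that]] w_nonneg[of n x] B_pos[OF n] by (simp add: abs_mult)
  have D0: "moment_le (run x0 I) k ?D (\<Sum>m=1..i. B n * D / sqrt m + B n * D / sqrt m)"
  proof (intro moment_le_sum moment_le_add scaled wf wf_bound w_measurable[OF n])
    show "\<bar>w n x\<bar> \<le> B n" if "x \<in> space (E n)" for x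
      using w_le[OF n that] w_nonneg[of n x] by simp
  qed (use i D B_pos[OF n] in auto)
  have "(\<Sum>m=1..i. B n * D / sqrt m + B n * D / sqrt m) = 2 * B n * D * (\<Sum>m=1..i. 1 / sqrt m)"
    unfolding sum_distrib_left by (intro sum.cong refl) simp
  also have "\<dots> \<le> 2 * B n * D * (2 * sqrt i)"
    using B_pos[OF n] D by (intro mult_left_mono sum_inverse_sqrt_le) auto
  finally have sum_le: "(\<Sum>m=1..i. B n * D / sqrt m + B n * D / sqrt m) \<le> 4 * B n * D * sqrt i"
    by simp
  have sum_nonneg: "0 \<le> (\<Sum>m=1..i. B n * D / sqrt m + B n * D / sqrt m)"
    using B_pos[OF n] D by (intro sum_nonneg) simp
  have D_moment: "moment_le (run x0 I) k ?D (4 * B n * D * sqrt i)"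
    by (rule moment_le_mono[OF D0 moment_le_measurable[OF D0] order_refl sum_nonneg sum_le])
  have N_moment: "moment_le (run x0 I) k ?N (subgaussian_const k * (2 * sol_bound * sqrt i))"
    using sol_bound_pos by (intro moment_le_martingale n i k noise_measurable noise_bound noise_centered) auto
  have N_pos: "0 < subgaussian_const k * (2 * sol_bound * sqrt i)"
    using subgaussian_const_ge_1[of k] sol_bound_pos i by (intro mult_pos_pos) auto
  have c1: "0 < ?c1"
    using \<theta>_pos coefficient_nonneg[of 4] by (intro add_pos_nonneg) auto
  have c0: "0 < ?c0"
    using sol_bound_pos by (intro add_pos_nonneg) auto
  have "moment_le (run x0 I) k (\<lambda>h. (\<bar>?N h\<bar> + ?c0 * sqrt i) + ?c1 * ?D h)
    ((subgaussian_const k * (2 * sol_bound * sqrt i) + ?c0 * sqrt i) + \<bar>?c1\<bar> * (4 * B n * D * sqrt i))"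
  proof (intro moment_le_add moment_le_cmult D_moment)
    show "moment_le (run x0 I) k (\<lambda>h. \<bar>?N h\<bar>) (subgaussian_const k * (2 * sol_bound * sqrt i))"
      using moment_le_measurable[OF N_moment]
      by (intro moment_le_mono[OF N_moment _ _ less_imp_le[OF N_pos] order_refl]) auto
    show "moment_le (run x0 I) k (\<lambda>h. ?c0 * sqrt i) (?c0 * sqrt i)"
      using c0 by (intro moment_le_bounded) auto
    show "0 < subgaussian_const k * (2 * sol_bound * sqrt i)"
      by (rule N_pos)
    show c0_sqrt: "0 < ?c0 * sqrt i"
      using i by (intro mult_pos_pos[OF c0]) simp
    show "0 < subgaussian_const k * (2 * sol_bound * sqrt i) + ?c0 * sqrt i"
      by (rule add_pos_pos[OF N_pos c0_sqrt])
    show "0 < \<bar>?c1\<bar> * (4 * B n * D * sqrt i)"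
      unfolding abs_of_pos[OF c1] using B_pos[OF n] D i by (intro mult_pos_pos[OF c1]) auto
  qed
  moreover have "(subgaussian_const k * (2 * sol_bound * sqrt i) + ?c0 * sqrt i) + \<bar>?c1\<bar> * (4 * B n * D * sqrt i)
      = ergodic_const n k D * sqrt i"
    unfolding abs_of_pos[OF c1] ergodic_const_def distrib_right by (simp only: mult.assoc)
  ultimately have bound: "moment_le (run x0 I) k (\<lambda>h. (\<bar>?N h\<bar> + ?c0 * sqrt i) + ?c1 * ?D h) (ergodic_const n k D * sqrt i)"
    by simp
  show ?thesis
  proof (rule moment_le_mono[OF bound])
    show "(\<lambda>h. \<Sum>m<i. f (X m h) - f_target) \<in> borel_measurable (run x0 I)"
      using i n by (intro borel_measurable_sum borel_measurable_diff measurable_compose[OF measurable_state f]) auto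
    show "\<bar>\<Sum>m<i. f (X m h) - f_target\<bar> \<le> \<bar>(\<bar>?N h\<bar> + ?c0 * sqrt i) + ?c1 * ?D h\<bar>"
      if h: "h \<in> space (run x0 I)" for h
      using ergodic_sum_decomposition[OF i h] by (rule order_trans[OF _ abs_ge_self])
    show "0 \<le> ergodic_const n k D * sqrt i"
      using ergodic_const_pos[OF n D, of k] by simp
  qed simp
qed

end

end

section \<open>Induction over the levels\<close>

context simcmc_bounded
begin

text \<open>\<open>D\<close> is chosen before initial states and test functions, so that it survives
  the change of test function from one level to the next. The horizon \<open>i\<close> is separate
  from \<open>m\<close>, which lets deviations at different times be added under one law.\<close>

definition proposal_deviation_bound :: "nat \<Rightarrow> nat \<Rightarrow> real \<Rightarrow> bool" where
  "proposal_deviation_bound n k D \<longleftrightarrow> 0 < D \<and>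
    (\<forall>x0 i m \<phi>. simcmc_init P F L \<gamma> q1 q x0 \<longrightarrow> m \<in> {1..i} \<longrightarrow> \<phi> \<in> borel_measurable (E n) \<longrightarrow>
      (\<forall>x\<in>space (E n). \<bar>\<phi> x\<bar> \<le> 1) \<longrightarrow>
      moment_le (run x0 i) k
        (\<lambda>h. (\<integral>x. \<phi> x \<partial>proposal m n (past m n h)) - (\<integral>x. \<phi> x \<partial>limit_proposal n)) (D / sqrt m))"

lemma proposal_deviation_boundD:
  assumes "proposal_deviation_bound n k D" "simcmc_init P F L \<gamma> q1 q x0" "m \<in> {1..i}"
    "\<phi> \<in> borel_measurable (E n)" "\<And>x. x \<in> space (E n) \<Longrightarrow> \<bar>\<phi> x\<bar> \<le> 1"
  shows "moment_le (run x0 i) k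
    (\<lambda>h. (\<integral>x. \<phi> x \<partial>proposal m n (past m n h)) - (\<integral>x. \<phi> x \<partial>limit_proposal n)) (D / sqrt m)"
  using assms unfolding proposal_deviation_bound_def by blast

text \<open>The deviation at level \<open>Suc n\<close> and time \<open>m\<close> is the centered
  mean of \<open>m + 1\<close> states of level \<open>n\<close>. The ergodic sum covers those before
  time \<open>m\<close>; the last one is bounded by \<open>2\<close>, whence the increment of the
  constant.\<close>

lemma proposal_deviation_bound_Suc:
  assumes n: "1 \<le> n" "Suc n \<le> P" and k: "1 \<le> k" and D: "proposal_deviation_bound n k D"
  shows "proposal_deviation_bound (Suc n) k (ergodic_const n k D + 2)"
  unfolding proposal_deviation_bound_def
proof (intro conjI allI impI)
  have n': "n \<in> {1..P}" "Suc n \<in> {1..P}" "Suc n \<in> {2..P}"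
    using n by auto
  have D_pos: "0 < D"
    using D by (simp add: proposal_deviation_bound_def)
  let ?C = "ergodic_const n k D"
  have C: "0 < ?C"
    by (rule ergodic_const_pos[OF n'(1) D_pos])
  then show "0 < ?C + 2"
    by simp
  fix x0 and i m :: nat and \<phi> :: "(nat \<Rightarrow> 'a) \<Rightarrow> real"
  assume init: "simcmc_init P F L \<gamma> q1 q x0" and m: "m \<in> {1..i}"
    and \<phi>: "\<phi> \<in> borel_measurable (E (Suc n))" "\<forall>x\<in>space (E (Suc n)). \<bar>\<phi> x\<bar> \<le> 1"
  interpret simcmc_init P F L \<gamma> q1 q x0
    by (rule init)
  interpret simcmc_bounded_init P F L \<gamma> q1 q B x0 ..
  interpret R: prob_space "run x0 i"
    by (rule prob_space_run)
  define f where "f x = (\<integral>y. \<phi> y \<partial>kern (Suc n) x)" for x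
  have f: "f \<in> borel_measurable (E n)"
    using integral_kern_measurable[OF n'(3) \<phi>(1)] by (simp add: f_def[abs_def])
  have f_bound: "\<bar>f x\<bar> \<le> 1" if "x \<in> space (E n)" for x
    unfolding f_def using abs_integral_kern_le[OF n'(3) \<phi>(1), of 1 x] \<phi>(2) that by simp
  let ?t = "\<integral>x. f x \<partial>target n"
  have t: "\<bar>?t\<bar> \<le> 1"
    using f_bound sets_eq_imp_space_eq[OF sets_target[of n]] f
    by (intro prob_space.abs_integral_le prob_space_target[OF n'(1)])
       (auto simp: measurable_cong_sets[OF sets_target refl])
  \<comment> \<open>The limiting proposal of level \<open>Suc n\<close> starts from
    \<open>target n\<close>, so its value on \<open>\<phi>\<close> is the limit of the ergodic
    averages of \<open>f\<close>.\<close>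
  have limit: "(\<integral>x. \<phi> x \<partial>limit_proposal (Suc n)) = ?t"
  proof -
    have "kern (Suc n) \<in> target n \<rightarrow>\<^sub>M prob_algebra (E (Suc n))"
      using kern_measurable[OF n'(3)] by (simp add: measurable_cong_sets[OF sets_target refl])
    then show ?thesis
      using n \<phi> integral_bind_prob[OF prob_space_target[OF n'(1)] \<phi>(1), of 1 "kern (Suc n)"]
      by (simp add: limit_proposal_def f_def)
  qed
  let ?S = "\<lambda>h. \<Sum>l<m. f (snd (h (l, n))) - ?t" and ?r = "\<lambda>h. f (snd (h (m, n))) - ?t"
  have S_moment: "moment_le (run x0 i) k ?S (?C * sqrt m)"
  proof (rule moment_le_ergodic_sum[OF n'(1) f f_bound])
    fix m' and \<psi> :: "(nat \<Rightarrow> 'a) \<Rightarrow> real"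
    assume "m' \<in> {1..m}" "\<psi> \<in> borel_measurable (E n)" "\<And>x. x \<in> space (E n) \<Longrightarrow> \<bar>\<psi> x\<bar> \<le> 1"
    then show "moment_le (run x0 i) k
        (\<lambda>h. (\<integral>x. \<psi> x \<partial>proposal m' n (past m' n h)) - (\<integral>x. \<psi> x \<partial>limit_proposal n)) (D / sqrt m')"
      using m by (intro proposal_deviation_boundD[OF D init]) auto
  qed (use m k D_pos in auto)
  have r_meas: "?r \<in> borel_measurable (run x0 i)"
    using m n' by (intro borel_measurable_diff measurable_compose[OF measurable_state f]) auto
  have r_moment: "moment_le (run x0 i) k ?r 2"
  proof (rule R.moment_le_bounded[OF r_meas])
    fix h assume "h \<in> space (run x0 i)"
    then have "\<bar>f (snd (h (m, n)))\<bar> \<le> 1"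
      using m n' by (intro f_bound space_state) auto
    with t show "\<bar>?r h\<bar> \<le> 2"
      by linarith
  qed
  have "moment_le (run x0 i) k (\<lambda>h. 1 / real (Suc m) * (?S h + ?r h)) (\<bar>1 / real (Suc m)\<bar> * (?C * sqrt m + 2))"
    using C m by (intro moment_le_cmult moment_le_add S_moment r_moment mult_pos_pos) auto
  then show "moment_le (run x0 i) k (\<lambda>h. (\<integral>x. \<phi> x \<partial>proposal m (Suc n) (past m (Suc n) h))
      - (\<integral>x. \<phi> x \<partial>limit_proposal (Suc n))) ((?C + 2) / sqrt m)"
  proof (rule moment_le_mono)
    show "(\<lambda>h. (\<integral>x. \<phi> x \<partial>proposal m (Suc n) (past m (Suc n) h)) - (\<integral>x. \<phi> x \<partial>limit_proposal (Suc n)))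
        \<in> borel_measurable (run x0 i)"
      using m n' \<phi>(1)
      by (intro borel_measurable_diff measurable_compose[OF measurable_past integral_proposal_measurable]) auto
    show "0 \<le> \<bar>1 / real (Suc m)\<bar> * (?C * sqrt m + 2)"
      using C by simp
    \<comment> \<open>The isolated \<open>2\<close> is absorbed as \<open>2 * sqrt m\<close>, since
      \<open>m\<close> is at least \<open>1\<close>.\<close>
    have "\<bar>1 / real (Suc m)\<bar> * (?C * sqrt m + 2) \<le> 1 / real m * (?C * sqrt m + 2 * sqrt m)"
      using C m by (intro mult_mono add_mono) (auto intro!: divide_left_mono)
    also have "\<dots> = (?C + 2) * (sqrt m / real m)"
      by (simp add: field_simps)
    also have "sqrt m / real m = 1 / sqrt m"
      using m by (simp add: field_simps)
    finally show "\<bar>1 / real (Suc m)\<bar> * (?C * sqrt m + 2) \<le> (?C + 2) / sqrt m"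
      by simp
    fix h assume h: "h \<in> space (run x0 i)"
    have "(\<integral>x. \<phi> x \<partial>proposal m (Suc n) (past m (Suc n) h)) = (\<Sum>l\<le>m. f (snd (h (l, n)))) / real (Suc m)"
      using integral_proposal_past[OF n'(3) _ _ h \<phi>(1), of m 1] m \<phi>(2) by (simp add: f_def)
    also have "(\<Sum>l\<le>m. f (snd (h (l, n)))) = ?S h + ?r h + real (Suc m) * ?t"
      by (simp add: lessThan_Suc_atMost[symmetric] sum_subtractf algebra_simps)
    also have "(?S h + ?r h + real (Suc m) * ?t) / real (Suc m) = 1 / real (Suc m) * (?S h + ?r h) + ?t"
      by (simp only: add_divide_distrib[of _ "real (Suc m) * ?t"]) simp
    finally show "\<bar>(\<integral>x. \<phi> x \<partial>proposal m (Suc n) (past m (Suc n) h)) - (\<integral>x. \<phi> x \<partial>limit_proposal (Suc n))\<bar>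
        \<le> \<bar>1 / real (Suc m) * (?S h + ?r h)\<bar>"
      unfolding limit by simp
  qed
qed

lemma ex_proposal_deviation_bound:
  assumes "n \<in> {1..P}" and k: "1 \<le> k"
  shows "\<exists>D. proposal_deviation_bound n k D"
proof -
  have "1 \<le> n" "n \<le> P"
    using assms by auto
  then show ?thesis
  proof (induction n rule: dec_induct)
    case base
    \<comment> \<open>The proposal of level \<open>1\<close> never changes and is its own limit. The
      deviation is \<open>0\<close>, and \<open>1\<close> stands for an arbitrary positive
      constant.\<close>
    have "proposal_deviation_bound 1 k 1"
      unfolding proposal_deviation_bound_def
    proof (intro conjI allI impI)
      fix x0 and i m :: nat and \<phi> :: "(nat \<Rightarrow> 'a) \<Rightarrow> real"
      assume "simcmc_init P F L \<gamma> q1 q x0"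
      then interpret simcmc_init P F L \<gamma> q1 q x0 .
      show "moment_le (run x0 i) k
          (\<lambda>h. (\<integral>x. \<phi> x \<partial>proposal m 1 (past m 1 h)) - (\<integral>x. \<phi> x \<partial>limit_proposal 1)) (1 / sqrt m)"
        unfolding proposal_1 by (intro prob_space.moment_le_bounded prob_space_run) (auto simp: limit_proposal_def)
    qed simp
    then show ?case ..
  next
    case (step n)
    then obtain D where "proposal_deviation_bound n k D"
      by auto
    then have "proposal_deviation_bound (Suc n) k (ergodic_const n k D + 2)"
      using step k by (intro proposal_deviation_bound_Suc) auto
    then show ?case ..
  qed
qed

end

section \<open>Estimates of the normalizing constants\<close>

context simcmc_bounded_init
begin

text \<open>The estimate averages weights of proposals, not of states. Given the past, each proposal
  has exactly the current proposal law, so level \<open>n\<close> itself requires no Poisson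
  equation: a martingale and the deviations of the mean weight suffice.\<close>

lemma moment_le_estimate:
  assumes n: "n \<in> {1..P}" and k: "1 \<le> k" and i: "1 \<le> i" and D: "proposal_deviation_bound n k D"
  shows "moment_le (run x0 i) k (\<lambda>h. estimate n i h - ratio n) (B n * (subgaussian_const k + 2 * D) / sqrt i)"
proof -
  have D_pos: "0 < D"
    using D by (simp add: proposal_deviation_bound_def)
  note B = B_pos[OF n]
  define \<psi> where "\<psi> m h z = w n (fst z) - (\<integral>x. w n x \<partial>proposal m n h)"
    for m :: nat and h and z :: "(nat \<Rightarrow> 'a) \<times> (nat \<Rightarrow> 'a)"
  let ?N = "\<lambda>h. \<Sum>m=1..i. \<psi> m (past m n h) (h (m, n))"
  let ?dev = "\<lambda>m h. (\<integral>x. w n x \<partial>proposal m n (past m n h)) - (\<integral>x. w n x \<partial>limit_proposal n)"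
  let ?D = "\<lambda>h. \<Sum>m=1..i. ?dev m h"
  have wfst: "(\<lambda>z. w n (fst z)) \<in> borel_measurable (E n \<Otimes>\<^sub>M E n)"
    by (rule measurable_compose[OF measurable_fst w_measurable[OF n]])
  have wfst_bound: "\<bar>w n (fst z)\<bar> \<le> B n" if "z \<in> space (E n \<Otimes>\<^sub>M E n)" for z
    using that w_le[OF n] w_nonneg by (auto simp: space_pair_measure)
  have N_moment: "moment_le (run x0 i) k ?N (subgaussian_const k * (B n * sqrt i))"
  proof (rule moment_le_martingale[OF n i order_refl k B])
    fix m assume m: "m \<in> {1..i}"
    have [measurable]: "(\<lambda>x. w n (fst (snd x))) \<in> borel_measurable (hist_space m (n - 1) \<Otimes>\<^sub>M (E n \<Otimes>\<^sub>M E n))"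
      "(\<lambda>x. \<integral>y. w n y \<partial>proposal m n (fst x)) \<in> borel_measurable (hist_space m (n - 1) \<Otimes>\<^sub>M (E n \<Otimes>\<^sub>M E n))"
      by (rule measurable_compose[OF measurable_snd wfst],
          rule measurable_compose[OF measurable_fst integral_proposal_measurable[OF n w_measurable[OF n]]])
    show "(\<lambda>(h, z). \<psi> m h z) \<in> borel_measurable (hist_space m (n - 1) \<Otimes>\<^sub>M (E n \<Otimes>\<^sub>M E n))"
      unfolding \<psi>_def case_prod_beta' by measurable
    fix h assume h: "h \<in> space (hist_space m (n - 1))"
    interpret p: prob_space "proposal m n h"
      by (rule prob_space_proposal[OF n h])
    have sp: "space (proposal m n h) = space (E n)"
      by (rule sets_eq_imp_space_eq[OF sets_proposal[OF n h]])
    have w_meas: "w n \<in> borel_measurable (proposal m n h)"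
      using w_measurable[OF n] by (simp add: measurable_cong_sets[OF sets_proposal[OF n h] refl])
    show "\<bar>\<psi> m h z\<bar> \<le> B n" if z: "z \<in> space (E n \<Otimes>\<^sub>M E n)" for z
    proof -
      \<comment> \<open>Weight and mean weight both lie between \<open>0\<close> and
        \<open>B n\<close>, so the increment is at most \<open>B n\<close> and not only
        \<open>2 * B n\<close>.\<close>
      have "0 \<le> (\<integral>x. w n x \<partial>proposal m n h)"
        using w_nonneg by (intro integral_nonneg_AE) auto
      moreover have "\<bar>\<integral>x. w n x \<partial>proposal m n h\<bar> \<le> B n"
        using w_meas w_le[OF n] w_nonneg sp by (intro p.abs_integral_le) auto
      ultimately show ?thesis
        using wfst_bound[OF z] w_nonneg[of n "fst z"] unfolding \<psi>_def by linarith
    qed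
    have m1: "1 \<le> m"
      using m by simp
    interpret N: prob_space "level_step m n h"
      by (rule prob_space_level_step[OF n m1 h])
    have "integrable (level_step m n h) (\<lambda>z. w n (fst z))"
      using wfst wfst_bound sets_eq_imp_space_eq[OF sets_level_step[OF n m1 h]]
      by (intro N.integrable_bounded) (auto simp: measurable_cong_sets[OF sets_level_step[OF n m1 h] refl])
    then have "(\<integral>z. \<psi> m h z \<partial>level_step m n h)
        = (\<integral>z. w n (fst z) \<partial>level_step m n h) - (\<integral>x. w n x \<partial>proposal m n h)"
      unfolding \<psi>_def by (simp add: N.prob_space)
    also have "(\<integral>z. w n (fst z) \<partial>level_step m n h) = (\<integral>x. w n x \<partial>proposal m n h)"
      using integral_level_step[OF n m1 h wfst wfst_bound] by (simp add: algebra_simps)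
    finally show "(\<integral>z. \<psi> m h z \<partial>level_step m n h) = 0"
      by simp
  qed
  have dev_moment: "moment_le (run x0 i) k (?dev m) (B n * D / sqrt m)" if m: "m \<in> {1..i}" for m
  proof -
    have "moment_le (run x0 i) k
      (\<lambda>h. (\<integral>x. w n x / B n \<partial>proposal m n (past m n h)) - (\<integral>x. w n x / B n \<partial>limit_proposal n)) (D / sqrt m)"
    proof (rule proposal_deviation_boundD[OF D simcmc_init_axioms m])
      show "(\<lambda>x. w n x / B n) \<in> borel_measurable (E n)"
        using w_measurable[OF n] by measurable
      show "\<bar>w n x / B n\<bar> \<le> 1" if "x \<in> space (E n)" for x
        using w_le[OF n that] w_nonneg[of n x] B by simp
    qed
    from moment_le_cmult[OF this, of "B n"] show ?thesis
      using B by (simp add: right_diff_distrib)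
  qed
  have D0: "moment_le (run x0 i) k ?D (\<Sum>m=1..i. B n * D / sqrt m)"
    using i B D_pos by (intro moment_le_sum dev_moment) auto
  have "(\<Sum>m=1..i. B n * D / sqrt m) = B n * D * (\<Sum>m=1..i. 1 / sqrt m)"
    by (simp add: sum_distrib_left)
  also have "\<dots> \<le> B n * D * (2 * sqrt i)"
    using B D_pos by (intro mult_left_mono sum_inverse_sqrt_le) auto
  finally have sum_le: "(\<Sum>m=1..i. B n * D / sqrt m) \<le> B n * D * (2 * sqrt i)" .
  have sum_nonneg: "0 \<le> (\<Sum>m=1..i. B n * D / sqrt m)"
    using B D_pos by (intro sum_nonneg) simp
  have D_moment: "moment_le (run x0 i) k ?D (B n * D * (2 * sqrt i))"
    by (rule moment_le_mono[OF D0 moment_le_measurable[OF D0] order_refl sum_nonneg sum_le])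
  have "moment_le (run x0 i) k (\<lambda>h. 1 / real i * (?N h + ?D h))
      (\<bar>1 / real i\<bar> * (subgaussian_const k * (B n * sqrt i) + B n * D * (2 * sqrt i)))"
    using B D_pos i subgaussian_const_ge_1[of k]
    by (intro moment_le_cmult moment_le_add N_moment D_moment mult_pos_pos) auto
  moreover have "1 / real i * (?N h + ?D h) = estimate n i h - ratio n" for h
  proof -
    have "?N h + ?D h = (\<Sum>m=1..i. w n (fst (h (m, n))) - ratio n)"
      unfolding \<psi>_def integral_w_limit[OF n] sum.distrib[symmetric] by (intro sum.cong) auto
    also have "\<dots> = (\<Sum>m=1..i. w n (fst (h (m, n)))) - real i * ratio n"
      by (simp add: sum_subtractf)
    finally show ?thesis
      using i by (simp add: estimate_def w_def right_diff_distrib)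
  qed
  moreover have "\<bar>1 / real i\<bar> * (subgaussian_const k * (B n * sqrt i) + B n * D * (2 * sqrt i))
      = B n * (subgaussian_const k + 2 * D) / sqrt i"
  proof -
    have "\<bar>1 / real i\<bar> * (subgaussian_const k * (B n * sqrt i) + B n * D * (2 * sqrt i))
        = B n * (subgaussian_const k + 2 * D) * (sqrt i / real i)"
      by (simp add: algebra_simps)
    also have "sqrt i / real i = 1 / sqrt i"
      using i by (simp add: field_simps)
    finally show ?thesis
      by simp
  qed
  ultimately show ?thesis
    by simp
qed

end

theorem theorem3p2:
  fixes P :: nat
    and F :: "'a measure"
    and L :: "nat \<Rightarrow> 'a measure"
    and \<gamma> :: "nat \<Rightarrow> (nat \<Rightarrow> 'a) \<Rightarrow> real"
    and q1 :: "'a \<Rightarrow> real"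
    and q :: "nat \<Rightarrow> (nat \<Rightarrow> 'a) \<Rightarrow> 'a \<Rightarrow> real"
    and B :: "nat \<Rightarrow> real"
  assumes "simcmc P F L \<gamma> q1 q"
    and "\<And>n x. n \<in> {1..P} \<Longrightarrow> x \<in> simcmc_data.S L \<gamma> n \<Longrightarrow>
           simcmc_data.weight \<gamma> q1 q n x \<le> ennreal (B n)"
  shows "\<exists>(C1 :: nat \<Rightarrow> real) (C2 :: real \<Rightarrow> real).
    \<forall>n\<in>{1..P}. \<forall>p\<ge>1. \<forall>x0 :: nat \<Rightarrow> nat \<Rightarrow> 'a.
      (\<forall>k\<in>{1..P}. x0 k \<in> simcmc_data.S L \<gamma> k) \<longrightarrow>
      (\<forall>i\<ge>1.
        (n = 1 \<longrightarrow>
          integrable (simcmc_data.run P L \<gamma> q1 q x0 i)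
            (\<lambda>h. \<bar>simcmc_data.estimate \<gamma> q1 q 1 i h - simcmc_data.Z L \<gamma> 1\<bar> powr p) \<and>
          (\<integral>h. \<bar>simcmc_data.estimate \<gamma> q1 q 1 i h - simcmc_data.Z L \<gamma> 1\<bar> powr p
              \<partial>simcmc_data.run P L \<gamma> q1 q x0 i) powr (1 / p)
            \<le> B 1 * C1 1 * C2 p / sqrt (real i)) \<and>
        (n \<noteq> 1 \<longrightarrow>
          integrable (simcmc_data.run P L \<gamma> q1 q x0 i)
            (\<lambda>h. \<bar>simcmc_data.estimate \<gamma> q1 q n i h
                  - simcmc_data.Z L \<gamma> n / simcmc_data.Z L \<gamma> (n - 1)\<bar> powr p) \<and>
          (\<integral>h. \<bar>simcmc_data.estimate \<gamma> q1 q n i h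
                  - simcmc_data.Z L \<gamma> n / simcmc_data.Z L \<gamma> (n - 1)\<bar> powr p
              \<partial>simcmc_data.run P L \<gamma> q1 q x0 i) powr (1 / p)
            \<le> B n * C1 n * C2 p / sqrt (real i)))"
proof -
  interpret simcmc P F L \<gamma> q1 q
    by (rule assms(1))
  interpret simcmc_bounded P F L \<gamma> q1 q B
    using assms(2) by unfold_locales
  \<comment> \<open>The constants are selected as functions of level and exponent alone, before any
    initial state or iteration count is given.\<close>
  define D where "D n k = (SOME D. proposal_deviation_bound n k D)" for n k
  have D: "proposal_deviation_bound n k (D n k)" if "1 \<le> k" "n \<in> {1..P}" for n k
    unfolding D_def by (rule someI_ex[OF ex_proposal_deviation_bound[OF that(2,1)]])
  define A where "A p n = 2 * (subgaussian_const (nat \<lceil>p\<rceil>) + 2 * D n (nat \<lceil>p\<rceil>))" for p :: real and n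
  \<comment> \<open>\<open>A p n\<close> depends on level and exponent together. As there are
    finitely many levels, a maximum removes the level, and \<open>C1\<close> can be the constant
    \<open>1\<close>.\<close>
  define C2 where "C2 p = Max (A p ` {1..P})" for p
  have bound: "integrable (run x0 i) (\<lambda>h. \<bar>estimate n i h - ratio n\<bar> powr p) \<and>
      (\<integral>h. \<bar>estimate n i h - ratio n\<bar> powr p \<partial>run x0 i) powr (1 / p) \<le> B n * 1 * C2 p / sqrt i"
    if n: "n \<in> {1..P}" and p: "1 \<le> p" and x0: "\<forall>k\<in>{1..P}. x0 k \<in> S k" and i: "1 \<le> i" for n p x0 i
  proof -
    let ?k = "nat \<lceil>p\<rceil>"
    have k: "1 \<le> ?k" "p \<le> real ?k"
      using p by linarith+
    interpret simcmc_init P F L \<gamma> q1 q x0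
      using x0 by unfold_locales (auto simp: S_def)
    interpret simcmc_bounded_init P F L \<gamma> q1 q B x0 ..
    interpret R: prob_space "run x0 i"
      by (rule prob_space_run)
    have D_pos: "0 < D n ?k"
      using D[OF k(1) n] by (simp add: proposal_deviation_bound_def)
    let ?a = "B n * (subgaussian_const ?k + 2 * D n ?k) / sqrt i"
    have a: "0 < ?a"
      using B_pos[OF n] D_pos subgaussian_const_ge_1[of ?k] i
      by (intro divide_pos_pos mult_pos_pos) auto
    note moment = moment_le_estimate[OF n k(1) i D[OF k(1) n]]
    have "(\<integral>h. \<bar>estimate n i h - ratio n\<bar> powr p \<partial>run x0 i) powr (1 / p) \<le> 2 * ?a"
      by (rule R.moment_le_imp_powr_norm(2)[OF moment a p k(2)])
    also have "\<dots> = B n * A p n / sqrt i"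
      by (simp add: A_def)
    also have "\<dots> \<le> B n * C2 p / sqrt i"
      using B_pos[OF n] n unfolding C2_def by (intro divide_right_mono mult_left_mono Max_ge) auto
    finally show ?thesis
      using R.moment_le_imp_powr_norm(1)[OF moment a p k(2)] by simp
  qed
  show ?thesis
  proof (rule exI[of _ "\<lambda>_. 1"], rule exI[of _ C2], intro ballI allI impI)
    fix n x0 and p :: real and i :: nat
    assume *: "n \<in> {1..P}" "1 \<le> p" "\<forall>k\<in>{1..P}. x0 k \<in> S k" "1 \<le> i"
    show "(n = 1 \<longrightarrow> integrable (run x0 i) (\<lambda>h. \<bar>estimate 1 i h - Z 1\<bar> powr p) \<and>
        (\<integral>h. \<bar>estimate 1 i h - Z 1\<bar> powr p \<partial>run x0 i) powr (1 / p) \<le> B 1 * 1 * C2 p / sqrt (real i)) \<and>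
      (n \<noteq> 1 \<longrightarrow> integrable (run x0 i) (\<lambda>h. \<bar>estimate n i h - Z n / Z (n - 1)\<bar> powr p) \<and>
        (\<integral>h. \<bar>estimate n i h - Z n / Z (n - 1)\<bar> powr p \<partial>run x0 i) powr (1 / p) \<le> B n * 1 * C2 p / sqrt (real i))"
      using bound[OF *] by (cases "n = 1") (auto simp: ratio_def Z_prev_def)
  qed
qed

end
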